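(* For each conjugacy class $\mathcal O$ of $\tilde W$ fix a minimal length element $\tilde w_{\mathcal O}\in\mathcal O$. Then for every $\tilde w\in\tilde W$ there exist polynomials $f_{\tilde w,\mathcal O}\in\mathbb Z[v-v^{-1}]$ with nonnegative coefficients, nonzero for only finitely many $\mathcal O$, such that $$T_{\tilde w}\equiv\sum_{\mathcal O}f_{\tilde w,\mathcal O}\,T_{\tilde w_{\mathcal O}}\mod[\tilde H,\tilde H].$$
   Context: Setting: $W=Q\rtimes W_0$ affine Weyl group (Coxeter group with simple reflections $S$), $\tilde W=P\rtimes(W_0\rtimes\Omega')=W\rtimes\Omega$ for a connected complex reductive group with coweight lattice $P$ and finite group $\Omega'$ of diagram automorphisms, $\ell$ the length on $\tilde W$ (number of affine root hyperplanes separating fundamental alcove from its image), $\Omega=\{\ell=0\}$. Let $\mathcal A=\mathbb Z[v,v^{-1}]$. The Hecke algebra $\tilde H$ is the $\mathcal A$-algebra with $\mathcal A$-basis $\{T_w\}_{w\in\tilde W}$ and multiplication determined by $T_xT_y=T_{xy}$ if $\ell(xy)=\ell(x)+\ell(y)$, and $(T_s-v)(T_s+v^{-1})=0$ for $s\in S$. $[\tilde H,\tilde H]$ is the $\mathcal A$-submodule spanned by all commutators $hh'-h'h$. Conjugacy classes are those of the group $\tilde W$. *)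

theory Defs
  imports "HOL-Analysis.Analysis" "HOL-Computational_Algebra.Polynomial"
begin

text \<open>Coordinates: the coweight lattice P is identified with the integer points of
  V = real^'n; the character lattice X is identified with the integer points as well,
  the pairing X x P being the dot product. Roots live in X, coroots in P.\<close>

definition lattice :: "(real^'n) set" where
  "lattice = {x. \<forall>i. x $ i \<in> \<int>}"

definition refl_lin :: "(real^'n \<Rightarrow> real^'n) \<Rightarrow> real^'n \<Rightarrow> real^'n \<Rightarrow> real^'n" where
  "refl_lin cor \<alpha> = (\<lambda>x. x - (\<alpha> \<bullet> x) *\<^sub>R cor \<alpha>)"

definition root_datum :: "(real^'n) set \<Rightarrow> (real^'n \<Rightarrow> real^'n) \<Rightarrow> bool" where
  "root_datum \<Phi> cor \<longleftrightarrow> finite \<Phi> \<and> \<Phi> \<subseteq> lattice \<and> cor ` \<Phi> \<subseteq> lattice \<and> inj_on cor \<Phi> \<and>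
     (\<forall>\<alpha>\<in>\<Phi>. \<alpha> \<bullet> cor \<alpha> = 2) \<and>
     (\<forall>\<alpha>\<in>\<Phi>. \<forall>\<beta>\<in>\<Phi>. \<beta> - (\<beta> \<bullet> cor \<alpha>) *\<^sub>R \<alpha> \<in> \<Phi>) \<and>
     (\<forall>\<alpha>\<in>\<Phi>. refl_lin cor \<alpha> ` (cor ` \<Phi>) \<subseteq> cor ` \<Phi>) \<and>
     (\<forall>\<alpha>\<in>\<Phi>. 2 *\<^sub>R \<alpha> \<notin> \<Phi>)"

text \<open>Positive roots, determined by a vector z not orthogonal to any root.\<close>
definition posroots :: "(real^'n) set \<Rightarrow> real^'n \<Rightarrow> (real^'n) set" where
  "posroots \<Phi> z = {\<alpha>\<in>\<Phi>. 0 < \<alpha> \<bullet> z}"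

definition fund_alcove :: "(real^'n) set \<Rightarrow> real^'n \<Rightarrow> (real^'n) set" where
  "fund_alcove \<Phi> z = {x. \<forall>\<alpha>\<in>posroots \<Phi> z. 0 < \<alpha> \<bullet> x \<and> \<alpha> \<bullet> x < 1}"

definition separates :: "(real^'n) set \<Rightarrow> (real^'n) set \<Rightarrow> real^'n \<Rightarrow> int \<Rightarrow> bool" where
  "separates A B \<alpha> k \<longleftrightarrow>
     (A \<subseteq> {x. \<alpha> \<bullet> x < of_int k} \<and> B \<subseteq> {x. \<alpha> \<bullet> x > of_int k}) \<or>
     (A \<subseteq> {x. \<alpha> \<bullet> x > of_int k} \<and> B \<subseteq> {x. \<alpha> \<bullet> x < of_int k})"

definition len :: "(real^'n) set \<Rightarrow> real^'n \<Rightarrow> (real^'n \<Rightarrow> real^'n) \<Rightarrow> nat" where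
  "len \<Phi> z w = card {(\<alpha>, k). \<alpha> \<in> posroots \<Phi> z \<and>
       separates (fund_alcove \<Phi> z) (w ` fund_alcove \<Phi> z) \<alpha> k}"

definition diagram_aut :: "(real^'n) set \<Rightarrow> (real^'n \<Rightarrow> real^'n) \<Rightarrow> real^'n \<Rightarrow> (real^'n \<Rightarrow> real^'n) \<Rightarrow> bool" where
  "diagram_aut \<Phi> cor z \<sigma> \<longleftrightarrow> linear \<sigma> \<and> bij \<sigma> \<and> \<sigma> ` lattice = lattice \<and>
     (\<forall>\<alpha>\<in>\<Phi>. \<exists>\<beta>\<in>\<Phi>. (\<forall>x. \<beta> \<bullet> \<sigma> x = \<alpha> \<bullet> x) \<and> cor \<beta> = \<sigma> (cor \<alpha>) \<and>
                       (0 < \<beta> \<bullet> z \<longleftrightarrow> 0 < \<alpha> \<bullet> z))"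

definition diagram_group :: "(real^'n) set \<Rightarrow> (real^'n \<Rightarrow> real^'n) \<Rightarrow> real^'n \<Rightarrow> (real^'n \<Rightarrow> real^'n) set \<Rightarrow> bool" where
  "diagram_group \<Phi> cor z \<Omega> \<longleftrightarrow> finite \<Omega> \<and> id \<in> \<Omega> \<and> (\<forall>\<sigma>\<in>\<Omega>. \<forall>\<tau>\<in>\<Omega>. \<sigma> \<circ> \<tau> \<in> \<Omega>) \<and>
     (\<forall>\<sigma>\<in>\<Omega>. diagram_aut \<Phi> cor z \<sigma>)"

text \<open>The finite group W_0 x| Omega', generated by the reflections s_alpha and Omega'.\<close>
inductive_set lin_group :: "(real^'n) set \<Rightarrow> (real^'n \<Rightarrow> real^'n) \<Rightarrow> (real^'n \<Rightarrow> real^'n) set \<Rightarrow> (real^'n \<Rightarrow> real^'n) set"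
  for \<Phi> cor \<Omega> where
  lg_id: "id \<in> lin_group \<Phi> cor \<Omega>"
| lg_refl: "\<alpha> \<in> \<Phi> \<Longrightarrow> g \<in> lin_group \<Phi> cor \<Omega> \<Longrightarrow> refl_lin cor \<alpha> \<circ> g \<in> lin_group \<Phi> cor \<Omega>"
| lg_diag: "\<sigma> \<in> \<Omega> \<Longrightarrow> g \<in> lin_group \<Phi> cor \<Omega> \<Longrightarrow> \<sigma> \<circ> g \<in> lin_group \<Phi> cor \<Omega>"

text \<open>Extended affine Weyl group P x| (W_0 x| Omega') as affine maps of V; product = composition.\<close>
definition ext_affine_weyl :: "(real^'n) set \<Rightarrow> (real^'n \<Rightarrow> real^'n) \<Rightarrow> (real^'n \<Rightarrow> real^'n) set \<Rightarrow> (real^'n \<Rightarrow> real^'n) set" where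
  "ext_affine_weyl \<Phi> cor \<Omega> = {(\<lambda>x. g x + t) | g t. g \<in> lin_group \<Phi> cor \<Omega> \<and> t \<in> lattice}"

definition aff_refl :: "(real^'n \<Rightarrow> real^'n) \<Rightarrow> real^'n \<Rightarrow> int \<Rightarrow> real^'n \<Rightarrow> real^'n" where
  "aff_refl cor \<alpha> k = (\<lambda>x. x - (\<alpha> \<bullet> x - of_int k) *\<^sub>R cor \<alpha>)"

text \<open>Simple reflections S: the affine reflections of length one (reflections in the walls of the fundamental alcove).\<close>
definition simple_refls :: "(real^'n) set \<Rightarrow> (real^'n \<Rightarrow> real^'n) \<Rightarrow> real^'n \<Rightarrow> (real^'n \<Rightarrow> real^'n) set" where
  "simple_refls \<Phi> cor z = {aff_refl cor \<alpha> k | \<alpha> k. \<alpha> \<in> \<Phi> \<and> len \<Phi> z (aff_refl cor \<alpha> k) = 1}"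

definition conj_class :: "('a \<Rightarrow> 'a) set \<Rightarrow> ('a \<Rightarrow> 'a) \<Rightarrow> ('a \<Rightarrow> 'a) set" where
  "conj_class W w = {w' \<in> W. \<exists>u\<in>W. w' \<circ> u = u \<circ> w}"

definition conj_classes :: "('a \<Rightarrow> 'a) set \<Rightarrow> ('a \<Rightarrow> 'a) set set" where
  "conj_classes W = conj_class W ` W"

text \<open>v^k for k an integer, with vi = v^{-1}.\<close>
definition vpow :: "'h::ring_1 \<Rightarrow> 'h \<Rightarrow> int \<Rightarrow> 'h" where
  "vpow v vi k = (if 0 \<le> k then v ^ nat k else vi ^ nat (- k))"

text \<open>Hecke algebra: a ring with a central unit v (so a Z[v,v^{-1}]-algebra) in which the
  elements v^k T_w (k integer, w in W) form a Z-basis (equivalently, T_w form a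
  Z[v,v^{-1}]-basis and v is transcendental), subject to the braid and quadratic relations.\<close>
definition hecke_alg :: "('a \<Rightarrow> 'a) set \<Rightarrow> (('a \<Rightarrow> 'a) \<Rightarrow> nat) \<Rightarrow> ('a \<Rightarrow> 'a) set \<Rightarrow> 'h::ring_1 \<Rightarrow> 'h \<Rightarrow> (('a \<Rightarrow> 'a) \<Rightarrow> 'h) \<Rightarrow> bool" where
  "hecke_alg W lenf S v vi T \<longleftrightarrow>
     (\<forall>h. v * h = h * v) \<and> v * vi = 1 \<and>
     (\<forall>h. \<exists>!c :: int \<times> ('a \<Rightarrow> 'a) \<Rightarrow> int.
         finite {p. c p \<noteq> 0} \<and> (\<forall>p. c p \<noteq> 0 \<longrightarrow> snd p \<in> W) \<and>
         h = (\<Sum>p\<in>{p. c p \<noteq> 0}. of_int (c p) * vpow v vi (fst p) * T (snd p))) \<and>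
     (\<forall>x\<in>W. \<forall>y\<in>W. lenf (x \<circ> y) = lenf x + lenf y \<longrightarrow> T (x \<circ> y) = T x * T y) \<and>
     (\<forall>s\<in>S. (T s - v) * (T s + vi) = 0)"

inductive_set comm_span :: "'h::ring_1 \<Rightarrow> 'h \<Rightarrow> 'h set" for v vi where
  cs_zero: "0 \<in> comm_span v vi"
| cs_comm: "a * b - b * a \<in> comm_span v vi"
| cs_add: "x \<in> comm_span v vi \<Longrightarrow> y \<in> comm_span v vi \<Longrightarrow> x + y \<in> comm_span v vi"
| cs_neg: "x \<in> comm_span v vi \<Longrightarrow> - x \<in> comm_span v vi"
| cs_smult: "x \<in> comm_span v vi \<Longrightarrow> vpow v vi k * x \<in> comm_span v vi"

text \<open>Evaluation of a polynomial with nonnegative integer coefficients at u (in a possibly noncommutative ring).\<close>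
definition peval :: "nat poly \<Rightarrow> 'h::ring_1 \<Rightarrow> 'h" where
  "peval f u = (\<Sum>i\<le>degree f. of_nat (coeff f i) * u ^ i)"

end

theory Submission
  imports Defs
begin

text \<open>
  Fix an element \<open>w\<close> of the extended affine Weyl group. A conjugate \<open>x\<inverse> w x\<close> corresponds to the alcove \<open>x A\<close>,
  and its length is the number of hyperplanes between \<open>x A\<close> and \<open>w x A\<close>; so conjugation becomes motion of an
  alcove while \<open>w\<close> stays fixed. Crossing a single wall never increases the length along the flow
  \<open>p' = w p + w\<inverse> p - 2 p\<close> (the gradient flow of the squared displacement): at a wall \<open>h = 0\<close> one has
  \<open>h(p)' = h(w p) + h(w\<inverse> p)\<close>, so the flow does not leave a half-space containing both \<open>w p\<close> and \<open>w\<inverse> p\<close>.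
  If the length never drops, the flow ends in an alcove described, lexicographically, by generic points of
  the minimal displacement set and of the eigenspaces of \<open>L + L\<inverse>\<close> (\<open>L\<close> the linear part of \<open>w\<close>). Any two such
  alcoves are connected by steps with \<open>T\<^sub>u T\<^sub>y\<^sub>' = T\<^sub>y T\<^sub>u\<close>, or by reflections commuting with \<open>w\<close>. Hence
  \<open>T\<^sub>w\<close> either agrees modulo commutators with the chosen minimal length representative, or is congruent to
  \<open>T\<^sub>s\<^sub>y\<^sub>s + (v - v\<inverse>) T\<^sub>y\<^sub>s\<close> with shorter elements, and induction on the length applies.
\<close>

section \<open>Spectral decomposition of a periodic affine map\<close>

text \<open>The dot product pairs characters with coweights and need not be invariant under
  \<open>L\<close>; the eigenspaces are therefore reached by Fourier averages over the powers of
  \<open>L\<close>. Lengths see only alcoves, so any point may be perturbed inside its alcove. This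
  is used to let a flow line cross one hyperplane at a time, to keep its leading terms nonzero, and
  to join two limits along a segment on which nonproportional leading forms vanish at different
  times. The limit of a flow line still lies on every hyperplane that contains the whole minimal
  displacement set; there the slowest decaying exponential decides the side, whence the
  lexicographic description.

  The dangerous crossing is the one with \<open>w p\<close> and \<open>w' p\<close> both on the near
  side, since it would lengthen the conjugate. For the flow it is excluded by the sign of a
  derivative; for the segment by an eigenvalue equation
  \<open>g (w q) + g (w' q) = \<mu> * g q\<close>, whose right side vanishes at the crossing.

  Nonnegativity of the coefficients comes for free: the recursion only adds and multiplies by
  \<open>v - vi\<close>.\<close>

lemma sum_cos_multiples:
  fixes m N :: nat
  assumes "m < N"
  shows "(\<Sum>j<N. cos (2 * pi * real j * real m / real N)) = (if m = 0 then real N else 0)"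
proof (cases "m = 0")
  case False
  define z where "z = cis (2 * pi * real m / real N)"
  have zp: "z ^ j = cis (2 * pi * real j * real m / real N)" for j
    by (simp add: z_def Complex.DeMoivre algebra_simps)
  have "2 * pi * real N * real m / real N = 2 * pi * real m" using assms by simp
  then have zN: "z ^ N = 1" using cis_multiple_2pi[of "real m"] by (simp add: zp)
  have "z \<noteq> 1"
  proof
    assume "z = 1"
    then have "cos (2 * pi * real m / real N) = 1"
      by (simp add: z_def cis.ctr complex_eq_iff)
    then obtain n :: int where n: "2 * pi * real m / real N = of_int n * 2 * pi"
      using cos_one_2pi_int by blast
    then have "(2 * pi) * (real m / real N) = (2 * pi) * of_int n" by simp
    then have "real m / real N = of_int n" using pi_neq_zero by (metis mult_left_cancel mult_eq_0_iff zero_neq_numeral)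
    moreover have "0 < real m / real N" "real m / real N < 1"
      using False assms by auto
    ultimately show False by simp
  qed
  \<comment> \<open>A full geometric sum over the powers of a nontrivial \<open>N\<close>-th root of
    unity; its real part is the claim.\<close>
  then have "(\<Sum>j<N. z ^ j) = 0"
    using zN by (simp add: geometric_sum)
  then have "Re (\<Sum>j<N. z ^ j) = 0" by simp
  then show ?thesis using False by (simp add: zp)
qed simp

lemma sum_cyclic_shift:
  fixes f :: "nat \<Rightarrow> 'a::ab_group_add"
  assumes "f N = f 0"
  shows "(\<Sum>m<N. f (Suc m)) = (\<Sum>m<N. f m)"
  using sum.lessThan_Suc_shift[of f N] assms by simp

text \<open>Forms instead of hyperplanes: once \<Phi> is closed under negation every hyperplane
  occurs with both signs, and counts of forms are twice counts of hyperplanes.\<close>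

definition affine_forms :: "'a::real_inner set \<Rightarrow> ('a \<Rightarrow> real) set" where
  "affine_forms \<Phi> = {(\<lambda>x. \<alpha> \<bullet> x - of_int k) | \<alpha> k. \<alpha> \<in> \<Phi>}"

lemma affine_formsE:
  assumes "h \<in> affine_forms \<Phi>"
  obtains \<alpha> k where "h = (\<lambda>x. \<alpha> \<bullet> x - of_int k)" "\<alpha> \<in> \<Phi>"
  using assms unfolding affine_forms_def by blast

text \<open>One group element as far as the hyperplanes can see it. \<open>w\<close> and
  \<open>w'\<close> are constrained only through pairings with roots, which leaves the freedom to
  choose a linear part \<open>L\<close> of finite order.\<close>

locale periodic_arrangement =
  fixes \<Phi> :: "'a::euclidean_space set" and L :: "'a \<Rightarrow> 'a" and lam :: 'a and N :: nat
    and w w' :: "'a \<Rightarrow> 'a"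
  assumes fin: "finite \<Phi>" and nz: "0 \<notin> \<Phi>"
    and neg: "\<alpha> \<in> \<Phi> \<Longrightarrow> - \<alpha> \<in> \<Phi>"
    and reduced: "\<alpha> \<in> \<Phi> \<Longrightarrow> \<beta> \<in> \<Phi> \<Longrightarrow> \<beta> = c *\<^sub>R \<alpha> \<Longrightarrow> \<beta> = \<alpha> \<or> \<beta> = - \<alpha>"
    and lin: "linear L" and Npos: "0 < N" and LN: "(L ^^ N) x = x"
    and pull: "\<alpha> \<in> \<Phi> \<Longrightarrow> \<exists>\<beta>\<in>\<Phi>. \<forall>x. \<beta> \<bullet> x = \<alpha> \<bullet> L x"
    and lam_int: "\<alpha> \<in> \<Phi> \<Longrightarrow> \<alpha> \<bullet> lam \<in> \<int>"
    and w: "\<alpha> \<in> \<Phi> \<Longrightarrow> \<alpha> \<bullet> w x = \<alpha> \<bullet> (L x + lam)"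
    and ww': "\<alpha> \<in> \<Phi> \<Longrightarrow> \<alpha> \<bullet> w (w' x) = \<alpha> \<bullet> x"
begin

text \<open>The inverse of \<open>L\<close>, since the order of \<open>L\<close> divides
  \<open>N\<close>.\<close>

definition L' :: "'a \<Rightarrow> 'a" where "L' = L ^^ (N - 1)"

lemma linear_funpow: "linear (L ^^ n)"
proof (induction n)
  case (Suc n)
  then show ?case using linear_compose[OF Suc lin] by (simp add: o_def)
qed (use linear_id in \<open>simp add: id_def\<close>)

lemma linear_L': "linear L'"
  by (simp add: L'_def linear_funpow)

lemma LL' [simp]: "L (L' x) = x"
proof -
  obtain n where "N = Suc n" using Npos by (cases N) auto
  then show ?thesis using LN[of x] unfolding L'_def by simp
qed

lemma L'L [simp]: "L' (L x) = x"
proof -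
  obtain n where "N = Suc n" using Npos by (cases N) auto
  then show ?thesis using LN[of x] unfolding L'_def by (simp add: funpow_swap1)
qed

lemma pull': "\<alpha> \<in> \<Phi> \<Longrightarrow> \<exists>\<beta>\<in>\<Phi>. \<forall>x. \<beta> \<bullet> x = \<alpha> \<bullet> L' x"
proof -
  have "\<alpha> \<in> \<Phi> \<Longrightarrow> \<exists>\<beta>\<in>\<Phi>. \<forall>x. \<beta> \<bullet> x = \<alpha> \<bullet> (L ^^ n) x" for n
  proof (induction n arbitrary: \<alpha>)
    case (Suc n)
    then show ?case using pull[OF Suc.prems] by (metis comp_apply funpow.simps(2))
  qed auto
  then show "\<alpha> \<in> \<Phi> \<Longrightarrow> ?thesis" by (simp add: L'_def)
qed

lemma w': "\<alpha> \<in> \<Phi> \<Longrightarrow> \<alpha> \<bullet> w' x = \<alpha> \<bullet> L' (x - lam)"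
proof -
  assume a: "\<alpha> \<in> \<Phi>"
  obtain \<beta> where b: "\<beta> \<in> \<Phi>" "\<And>x. \<beta> \<bullet> x = \<alpha> \<bullet> L' x" using pull'[OF a] by blast
  have "\<beta> \<bullet> (L (w' x) + lam) = \<beta> \<bullet> x" using ww'[OF b(1)] w[OF b(1)] by simp
  then have "\<alpha> \<bullet> L' (L (w' x) + lam) = \<alpha> \<bullet> L' x" by (simp only: b(2))
  then show ?thesis by (simp add: linear_add[OF linear_L'] linear_diff[OF linear_L'] inner_simps)
qed

section \<open>Eigenprojections of \<open>L + L'\<close>\<close>

definition E :: "real set" where
  "E = (\<lambda>j. 2 * cos (2 * pi * real j / real N)) ` {..<N}"

text \<open>Over the complex numbers the Fourier average of index \<open>j\<close> projects to one
  eigenvalue of \<open>L\<close>, an \<open>N\<close>-th root of unity. The cosine takes the mean of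
  the averages for \<open>j\<close> and \<open>N - j\<close>, and the outer sum runs over both, so
  the result is the real projection to the eigenvalue \<mu> of \<open>L + L'\<close>. It is zero
  when an element of \<open>E\<close> is not an eigenvalue.\<close>

definition Pr :: "real \<Rightarrow> 'a \<Rightarrow> 'a" where
  "Pr \<mu> y = (\<Sum>j\<in>{j\<in>{..<N}. 2 * cos (2 * pi * real j / real N) = \<mu>}.
      (1 / real N) *\<^sub>R (\<Sum>m<N. cos (2 * pi * real j * real m / real N) *\<^sub>R (L ^^ m) y))"

lemma finite_E: "finite E" by (simp add: E_def)

lemma assumes "\<mu> \<in> E" shows E_le: "\<mu> \<le> 2" and E_ge: "-2 \<le> \<mu>"
proof -
  from assms obtain j where j: "\<mu> = 2 * cos (2 * pi * real j / real N)" by (auto simp: E_def)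
  show "\<mu> \<le> 2" unfolding j using cos_le_one[of "2 * pi * real j / real N"] by linarith
  show "-2 \<le> \<mu>" unfolding j using cos_ge_minus_one[of "2 * pi * real j / real N"] by linarith
qed

lemma two_in_E: "2 \<in> E"
  unfolding E_def using Npos by (intro image_eqI[of _ _ 0]) auto

lemma linear_Pr: "linear (Pr \<mu>)"
  unfolding Pr_def by (intro linear_compose_sum ballI linear_compose_scale_right linear_funpow)

text \<open>After exchanging the sums, the cosines over \<open>j\<close> cancel unless
  \<open>m = 0\<close>: completeness is character orthogonality on the cyclic group of order
  \<open>N\<close>.\<close>

lemma sum_Pr: "(\<Sum>\<mu>\<in>E. Pr \<mu> y) = y"
proof -
  have "(\<Sum>\<mu>\<in>E. Pr \<mu> y) =
     (\<Sum>j<N. (1 / real N) *\<^sub>R (\<Sum>m<N. cos (2 * pi * real j * real m / real N) *\<^sub>R (L ^^ m) y))"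
    unfolding Pr_def E_def by (rule sum.image_gen[symmetric]) simp
  also have "\<dots> = (1 / real N) *\<^sub>R (\<Sum>m<N. \<Sum>j<N. cos (2 * pi * real j * real m / real N) *\<^sub>R (L ^^ m) y)"
    by (subst sum.swap) (simp add: scaleR_sum_right)
  also have "\<dots> = (1 / real N) *\<^sub>R (\<Sum>m<N. (if m = 0 then real N else 0) *\<^sub>R (L ^^ m) y)"
    by (simp add: sum_cos_multiples flip: scaleR_sum_left)
  also have "\<dots> = (1 / real N) *\<^sub>R (\<Sum>m<N. if m = 0 then real N *\<^sub>R y else 0)"
    by (intro arg_cong[of _ _ "\<lambda>x. (1 / real N) *\<^sub>R x"] sum.cong) auto
  also have "\<dots> = y" using Npos by simp
  finally show ?thesis .
qed

lemma L_Pr: "L (Pr \<mu> y) = Pr \<mu> (L y)"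
  unfolding Pr_def
  by (simp add: linear_sum[OF lin] linear_scale[OF lin] funpow_swap1)

lemma L'_Pr: "L' (Pr \<mu> y) = Pr \<mu> (L' y)"
  by (metis L_Pr L'L LL')

text \<open>\<open>L\<close> and \<open>L'\<close> shift the summation index cyclically in opposite
  directions, and cos (s - d) + cos (s + d) = 2 cos d cos s.\<close>

lemma eig: "L (Pr \<mu> y) + L' (Pr \<mu> y) = \<mu> *\<^sub>R Pr \<mu> y"
proof -
  define c where "c j m = cos (2 * pi * real j * m / real N)" for j :: nat and m :: real
  define P where "P j = (\<Sum>m<N. c j (real m) *\<^sub>R (L ^^ m) y)" for j
  have per: "c j (m + real N) = c j m" for j m
  proof -
    have "2 * pi * real j * (m + real N) / real N = 2 * pi * real j * m / real N + 2 * pi * real j"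
      using Npos by (simp add: field_simps)
    moreover have "cos (x + 2 * pi * real j) = cos x" for x
      using cos_int_2pin[of "int j"] sin_int_2pin[of "int j"] by (simp add: cos_add)
    ultimately show ?thesis unfolding c_def by simp
  qed
  have LP: "L (P j) = (\<Sum>m<N. c j (real m - 1) *\<^sub>R (L ^^ m) y)" for j
  proof -
    have "c j (real N - 1) = c j (- 1)" using per[of j "-1"] by (simp add: algebra_simps)
    then have "(\<Sum>m<N. c j (real (Suc m) - 1) *\<^sub>R (L ^^ Suc m) y) = (\<Sum>m<N. c j (real m - 1) *\<^sub>R (L ^^ m) y)"
      by (intro sum_cyclic_shift) (simp add: LN)
    then show ?thesis by (simp add: P_def linear_sum[OF lin] linear_scale[OF lin])
  qed
  have "L (\<Sum>m<N. c j (real m + 1) *\<^sub>R (L ^^ m) y) = P j" for j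
  proof -
    have "c j (real N) = c j 0" using per[of j 0] by simp
    then have "(\<Sum>m<N. c j (real (Suc m)) *\<^sub>R (L ^^ Suc m) y) = P j"
      unfolding P_def by (intro sum_cyclic_shift) (simp add: LN)
    then show ?thesis by (simp add: linear_sum[OF lin] linear_scale[OF lin] add.commute)
  qed
  then have L'P: "L' (P j) = (\<Sum>m<N. c j (real m + 1) *\<^sub>R (L ^^ m) y)" for j
    by (metis L'L)
  have c2: "c j (m - 1) + c j (m + 1) = (2 * cos (2 * pi * real j / real N)) * c j m" for j m
  proof -
    define s where "s = 2 * pi * real j * m / real N"
    define d where "d = 2 * pi * real j / real N"
    have "c j (m - 1) = cos (s - d)" "c j (m + 1) = cos (s + d)" "c j m = cos s"
      by (simp_all add: c_def s_def d_def ring_distribs diff_divide_distrib add_divide_distrib)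
    then show ?thesis by (simp add: cos_add cos_diff d_def)
  qed
  have LL: "L (P j) + L' (P j) = (2 * cos (2 * pi * real j / real N)) *\<^sub>R P j" for j
    unfolding LP L'P by (simp only: P_def scaleR_sum_right scaleR_scaleR flip: sum.distrib scaleR_left_distrib c2)
  have Pr: "Pr \<mu> y = (\<Sum>j\<in>{j\<in>{..<N}. 2 * cos (2 * pi * real j / real N) = \<mu>}. (1 / real N) *\<^sub>R P j)"
    by (simp add: Pr_def P_def c_def)
  have "L (Pr \<mu> y) + L' (Pr \<mu> y) =
     (\<Sum>j\<in>{j\<in>{..<N}. 2 * cos (2 * pi * real j / real N) = \<mu>}. (1 / real N) *\<^sub>R (L (P j) + L' (P j)))"
    unfolding Pr by (simp add: linear_sum[OF lin] linear_scale[OF lin] linear_sum[OF linear_L']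
        linear_scale[OF linear_L'] sum.distrib scaleR_right_distrib)
  also have "\<dots> = \<mu> *\<^sub>R Pr \<mu> y"
    unfolding Pr scaleR_sum_right LL by (intro sum.cong) auto
  finally show ?thesis .
qed

text \<open>\<open>Pr \<mu>\<close> commutes with \<open>L + L'\<close>, so applying it to an
  eigenvector for \<nu> yields a vector with both eigenvalues. Together with completeness this also
  gives idempotence.\<close>

lemma Pr_orth: "\<mu> \<noteq> \<nu> \<Longrightarrow> Pr \<mu> (Pr \<nu> y) = 0"
proof -
  assume "\<mu> \<noteq> \<nu>"
  have "\<mu> *\<^sub>R Pr \<mu> (Pr \<nu> y) = Pr \<mu> (L (Pr \<nu> y) + L' (Pr \<nu> y))"
    using eig[of \<mu> "Pr \<nu> y"] by (simp add: L_Pr L'_Pr linear_add[OF linear_Pr])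
  also have "\<dots> = \<nu> *\<^sub>R Pr \<mu> (Pr \<nu> y)" by (simp add: eig linear_scale[OF linear_Pr])
  finally show ?thesis using \<open>\<mu> \<noteq> \<nu>\<close> by simp
qed

lemma Pr_idem: "\<mu> \<in> E \<Longrightarrow> Pr \<mu> (Pr \<mu> y) = Pr \<mu> y"
proof -
  assume m: "\<mu> \<in> E"
  have "Pr \<mu> y = (\<Sum>\<nu>\<in>E. Pr \<nu> (Pr \<mu> y))" by (simp add: sum_Pr)
  also have "\<dots> = (\<Sum>\<nu>\<in>E. if \<nu> = \<mu> then Pr \<mu> (Pr \<mu> y) else 0)"
    by (intro sum.cong) (auto simp: Pr_orth)
  also have "\<dots> = Pr \<mu> (Pr \<mu> y)" using m finite_E by simp
  finally show ?thesis by simp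
qed

text \<open>Eigenvalue 2 says that the second differences of the orbit vanish, so
  \<open>(L ^^ n) x\<close> is linear in \<open>n\<close>; periodicity forces the increment to be
  zero.\<close>

lemma L_Pr2: "L (Pr 2 y) = Pr 2 y"
proof -
  define x where "x = Pr 2 y"
  have *: "(L ^^ n) x + (L x - x) = (L ^^ Suc n) x" for n
  proof (induction n)
    case (Suc n)
    have "L ((L ^^ Suc n) x) + L' ((L ^^ Suc n) x) = 2 *\<^sub>R (L ^^ Suc n) x"
    proof -
      have "(L ^^ m) (Pr 2 y) = Pr 2 ((L ^^ m) y)" for m
        by (induction m) (simp_all add: L_Pr)
      then have "(L ^^ Suc n) x = Pr 2 ((L ^^ Suc n) y)" unfolding x_def .
      then show ?thesis by (simp only: eig)
    qed
    then have "(L ^^ Suc (Suc n)) x + (L ^^ n) x = 2 *\<^sub>R (L ^^ Suc n) x" by simp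
    moreover define X0 X1 X2 d where "X0 = (L ^^ n) x" and "X1 = (L ^^ Suc n) x"
      and "X2 = (L ^^ Suc (Suc n)) x" and "d = L x - x"
    ultimately have "X2 + X0 = X1 + X1" "X0 + d = X1" using Suc.IH by (simp_all add: scaleR_2)
    then have "X1 + d = X2" by (metis add.assoc add.commute add_left_cancel)
    then show ?case by (simp only: X1_def X2_def d_def)
  qed simp
  have "(L ^^ n) x = x + real n *\<^sub>R (L x - x)" for n
  proof (induction n)
    case (Suc n)
    show ?case unfolding *[of n, symmetric] Suc by (simp add: algebra_simps)
  qed simp
  from this[of N] have "real N *\<^sub>R (L x - x) = 0" by (simp add: LN)
  then show ?thesis using Npos by (simp add: x_def)
qed

section \<open>Normal form of the affine map about its center\<close>

definition drift :: 'a where "drift = Pr 2 lam"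

text \<open>On the part with eigenvalue \<mu> one has (1 - L)(1 - L') = 2 - \<mu>, so (1 - L') / (2
  - \<mu>) inverts 1 - L away from \<mu> = 2. The sum thus solves (1 - L) center = lam - drift; the
  remaining \<open>drift\<close> lies in the fixed space of \<open>L\<close> and cannot be removed
  by moving the origin.\<close>

definition center :: 'a where
  "center = (\<Sum>\<mu>\<in>E - {2}. (1 / (2 - \<mu>)) *\<^sub>R (Pr \<mu> lam - L' (Pr \<mu> lam)))"

lemma L_drift [simp]: "L drift = drift" and L'_drift [simp]: "L' drift = drift"
  by (simp_all add: drift_def L_Pr2) (metis L'L L_Pr2)

lemma L_center: "L center + lam = center + drift"
proof -
  have "center - L center = (\<Sum>\<mu>\<in>E - {2}. Pr \<mu> lam)"
  proof -
    have "(Pr \<mu> lam - L' (Pr \<mu> lam)) - (L (Pr \<mu> lam) - Pr \<mu> lam) = (2 - \<mu>) *\<^sub>R Pr \<mu> lam" for \<mu>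
      using eig[of \<mu> lam] by (simp add: algebra_simps scaleR_2)
    then have "(1 / (2 - \<mu>)) *\<^sub>R (Pr \<mu> lam - L' (Pr \<mu> lam)) - L ((1 / (2 - \<mu>)) *\<^sub>R (Pr \<mu> lam - L' (Pr \<mu> lam))) = Pr \<mu> lam"
      if "\<mu> \<noteq> 2" for \<mu>
      using that by (simp add: linear_scale[OF lin] linear_diff[OF lin] flip: scaleR_diff_right)
    then show ?thesis
      unfolding center_def by (simp add: linear_sum[OF lin] flip: sum_subtractf)
  qed
  also have "\<dots> = lam - drift"
    using sum_Pr[of lam] finite_E two_in_E by (simp add: sum.remove[of E 2] drift_def algebra_simps)
  finally show ?thesis by (simp add: algebra_simps)
qed

lemma w_center: "\<alpha> \<in> \<Phi> \<Longrightarrow> \<alpha> \<bullet> w (center + y) = \<alpha> \<bullet> (center + (L y + drift))"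
proof -
  assume a: "\<alpha> \<in> \<Phi>"
  have "L (center + y) + lam = (L center + lam) + L y" by (simp add: linear_add[OF lin])
  then have "L (center + y) + lam = center + (L y + drift)" unfolding L_center by simp
  then show ?thesis by (simp only: w[OF a])
qed

lemma w'_center: "\<alpha> \<in> \<Phi> \<Longrightarrow> \<alpha> \<bullet> w' (center + y) = \<alpha> \<bullet> (center + L' (y - drift))"
proof -
  assume a: "\<alpha> \<in> \<Phi>"
  have "center + y - lam = L center + (y - drift)" using L_center by (simp add: algebra_simps)
  then have "L' (center + y - lam) = center + L' (y - drift)"
    by (simp only: linear_add[OF linear_L'] L'L)
  then show ?thesis by (simp only: w'[OF a])
qed

end

section \<open>Walls, conjugation steps and genericity\<close>

definition splits :: "('a \<Rightarrow> real) \<Rightarrow> 'a \<Rightarrow> 'a \<Rightarrow> bool" where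
  "splits h a b \<longleftrightarrow> h a * h b < 0"

definition regular :: "('a \<Rightarrow> real) set \<Rightarrow> 'a \<Rightarrow> bool" where
  "regular H a \<longleftrightarrow> (\<forall>h\<in>H. h a \<noteq> 0)"

definition adjacent :: "('a \<Rightarrow> real) set \<Rightarrow> ('a \<Rightarrow> real) \<Rightarrow> 'a \<Rightarrow> 'a \<Rightarrow> bool" where
  "adjacent H h a b \<longleftrightarrow> splits h a b \<and> (\<forall>h'\<in>H. splits h' a b \<longrightarrow> h' = h \<or> h' = (\<lambda>x. - h x))"

text \<open>For forms of the arrangement this makes the reflection in the wall commute with
  \<open>w\<close>, so that reflecting an alcove does not change the conjugate attached to
  it.\<close>

definition invariant_wall :: "('a \<Rightarrow> 'a) \<Rightarrow> ('a \<Rightarrow> real) \<Rightarrow> bool" where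
  "invariant_wall w h \<longleftrightarrow> (\<forall>x. h (w x) = h x) \<or> (\<forall>x. h (w x) = - h x)"

text \<open>If \<open>x\<close> and \<open>x'\<close> map the fundamental alcove to the alcoves of \<open>a\<close> and \<open>b\<close>, this says that lengths
  add in both factorisations \<open>u y' = y u\<close>, where \<open>u = x\<inverse> x'\<close>, \<open>y = x\<inverse> w x\<close>, \<open>y' = x'\<inverse> w x'\<close>.\<close>

definition additive :: "('a \<Rightarrow> real) set \<Rightarrow> ('a \<Rightarrow> 'a) \<Rightarrow> ('a \<Rightarrow> 'a) \<Rightarrow> 'a \<Rightarrow> 'a \<Rightarrow> bool" where
  "additive H w w' a b \<longleftrightarrow>
     (\<forall>h\<in>H. splits h a b \<longrightarrow> \<not> splits h b (w b) \<and> \<not> splits h a (w' a))"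

text \<open>Both generating steps keep the length of the conjugate and the class of its
  \<open>T\<close> modulo commutators.\<close>

inductive conj_equiv :: "('a \<Rightarrow> real) set \<Rightarrow> ('a \<Rightarrow> 'a) \<Rightarrow> ('a \<Rightarrow> 'a) \<Rightarrow> 'a \<Rightarrow> 'a \<Rightarrow> bool"
  for H w w' where
  ce_additive: "regular H a \<Longrightarrow> regular H b \<Longrightarrow> additive H w w' a b \<Longrightarrow> conj_equiv H w w' a b"
| ce_wall: "regular H a \<Longrightarrow> regular H b \<Longrightarrow> h \<in> H \<Longrightarrow> adjacent H h a b \<Longrightarrow> invariant_wall w h
    \<Longrightarrow> conj_equiv H w w' a b"
| ce_sym: "conj_equiv H w w' a b \<Longrightarrow> conj_equiv H w w' b a"
| ce_trans: "conj_equiv H w w' a b \<Longrightarrow> conj_equiv H w w' b c \<Longrightarrow> conj_equiv H w w' a c"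

text \<open>Both neighbours \<open>w a\<close> and \<open>w' a\<close> lie beyond the wall, and the
  wall is not its own image: crossing it then shortens the conjugate by two.\<close>

definition drops :: "('a \<Rightarrow> real) set \<Rightarrow> ('a \<Rightarrow> 'a) \<Rightarrow> ('a \<Rightarrow> 'a) \<Rightarrow> 'a \<Rightarrow> 'a \<Rightarrow> bool" where
  "drops H w w' a b \<longleftrightarrow> regular H a \<and> regular H b \<and>
     (\<exists>h\<in>H. adjacent H h a b \<and> \<not> invariant_wall w h \<and> splits h a (w a) \<and> splits h a (w' a))"

definition irreducible_pt :: "('a \<Rightarrow> real) set \<Rightarrow> ('a \<Rightarrow> 'a) \<Rightarrow> ('a \<Rightarrow> 'a) \<Rightarrow> 'a \<Rightarrow> bool" where
  "irreducible_pt H w w' a \<longleftrightarrow> (\<forall>b c. conj_equiv H w w' a b \<longrightarrow> \<not> drops H w w' b c)"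

lemma conj_equiv_regular: "conj_equiv H w w' a b \<Longrightarrow> regular H a \<and> regular H b"
  by (induction rule: conj_equiv.induct) auto

lemma irreducible_pt_cong: "conj_equiv H w w' a b \<Longrightarrow> irreducible_pt H w w' a \<Longrightarrow> irreducible_pt H w w' b"
  unfolding irreducible_pt_def by (meson ce_trans)

lemma splits_sym: "splits h a b \<longleftrightarrow> splits h b a"
  by (simp add: splits_def mult.commute)

lemma splits_neg [simp]: "splits (\<lambda>x. - h x) a b \<longleftrightarrow> splits h a b"
  by (simp add: splits_def)

lemma splits_trans:
  assumes "h a \<noteq> 0" "h b \<noteq> 0" "h c \<noteq> 0"
  shows "splits h a c \<longleftrightarrow> (splits h a b \<noteq> splits h b c)"
  using assms unfolding splits_def mult_less_0_iff by linarith

section \<open>General position for countably many affine conditions\<close>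

definition affine_fun :: "('a::real_vector \<Rightarrow> real) \<Rightarrow> bool" where
  "affine_fun g \<longleftrightarrow> (\<exists>l c. linear l \<and> g = (\<lambda>x. l x + c))"

lemma affine_funI: "linear l \<Longrightarrow> (\<And>x. g x = l x + c) \<Longrightarrow> affine_fun g"
  unfolding affine_fun_def by blast

lemma negligible_affine_fun:
  fixes g :: "'a::euclidean_space \<Rightarrow> real"
  assumes "affine_fun g" "g y \<noteq> 0"
  shows "negligible {x. g x = 0}"
proof -
  obtain l c where l: "linear l" and g: "\<And>x. g x = l x + c"
    using assms(1) unfolding affine_fun_def by auto
  define v where "v = adjoint l 1"
  have lv: "l x = v \<bullet> x" for x
    using adjoint_works[OF l, of x 1] by (simp add: v_def inner_commute)
  have "v \<noteq> 0 \<or> - c \<noteq> 0" using assms(2) by (auto simp: g lv)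
  then have "negligible {x. v \<bullet> x = - c}" by (rule negligible_hyperplane)
  then show ?thesis by (rule negligible_subset) (auto simp: g lv)
qed

lemma negligible_countable_UN:
  fixes f :: "'i \<Rightarrow> 'a::euclidean_space set"
  assumes "countable I" "\<And>i. i \<in> I \<Longrightarrow> negligible (f i)"
  shows "negligible (\<Union>i\<in>I. f i)"
  using assms by (simp add: negligible_iff_null_sets null_sets_UN')

text \<open>Source of the affine general-position choices below. Functions that vanish identically
  are tolerated in \<open>G\<close>, since certain combinations of forms may degenerate.\<close>

lemma negligible_nongeneric:
  fixes G :: "('a::euclidean_space \<Rightarrow> real) set"
  assumes "countable G" "\<And>g. g \<in> G \<Longrightarrow> affine_fun g"
  shows "negligible {x. \<exists>g\<in>G. g x = 0 \<and> (\<exists>y. g y \<noteq> 0)}"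
proof -
  have "negligible (\<Union>g\<in>{g\<in>G. \<exists>y. g y \<noteq> 0}. {x. g x = 0})"
    using assms by (intro negligible_countable_UN) (auto intro: negligible_affine_fun)
  then show ?thesis by (rule negligible_subset) auto
qed

lemma open_minus_negligible:
  fixes S :: "'a::euclidean_space set"
  assumes "open S" "a \<in> S" "negligible B"
  shows "\<exists>x\<in>S. x \<notin> B"
  using assms open_not_negligible[of S] negligible_subset[of B S] by blast

text \<open>Local finiteness of parallel hyperplanes: one neighbourhood serves all \<open>k\<close>
  at once, because the open interval from \<lceil>r\<rceil> - 1 to \<lfloor>r\<rfloor> + 1 contains
  no integer except possibly \<open>r\<close> itself.\<close>

lemma eventually_same_side_ints:
  fixes r :: real
  shows "\<forall>\<^sub>F r' in nhds r. \<forall>k::int. r \<noteq> of_int k \<longrightarrow> 0 < (r' - of_int k) * (r - of_int k)"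
proof -
  have "\<forall>\<^sub>F r' in nhds r. r' \<in> {of_int (\<lceil>r\<rceil> - 1)<..<of_int (\<lfloor>r\<rfloor> + 1)}"
    by (rule eventually_nhds_in_open) (simp, simp, linarith)
  then show ?thesis
  proof eventually_elim
    case (elim r')
    show ?case
    proof (intro allI impI)
      fix k :: int
      assume "r \<noteq> of_int k"
      then consider "of_int k < r" | "r < of_int k" by linarith
      then show "0 < (r' - of_int k) * (r - of_int k)"
      proof cases
        case 1
        then have "k \<le> \<lceil>r\<rceil> - 1" by linarith
        then have "of_int k \<le> (of_int (\<lceil>r\<rceil> - 1) :: real)" using of_int_le_iff by blast
        then have "of_int k < r'" using elim by auto
        then show ?thesis using 1 by simp
      next
        case 2
        then have "\<lfloor>r\<rfloor> + 1 \<le> k" by linarith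
        then have "of_int (\<lfloor>r\<rfloor> + 1) \<le> (of_int k :: real)" using of_int_le_iff by blast
        then have "r' < of_int k" using elim by auto
        then show ?thesis using 2 by (simp add: mult_neg_neg)
      qed
    qed
  qed
qed

lemma eventually_same_side:
  fixes \<Phi> :: "'a::real_inner set"
  assumes "finite \<Phi>" "\<And>\<alpha>. \<alpha> \<in> \<Phi> \<Longrightarrow> ((\<lambda>t. \<alpha> \<bullet> p t) \<longlongrightarrow> \<alpha> \<bullet> q) F"
  shows "\<forall>\<^sub>F t in F. \<forall>h\<in>affine_forms \<Phi>. h q \<noteq> 0 \<longrightarrow> 0 < h (p t) * h q"
proof -
  have "\<forall>\<^sub>F t in F. \<forall>\<alpha>\<in>\<Phi>. \<forall>k::int. \<alpha> \<bullet> q \<noteq> of_int k \<longrightarrow> 0 < (\<alpha> \<bullet> p t - of_int k) * (\<alpha> \<bullet> q - of_int k)"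
  proof (intro eventually_ball_finite assms(1) ballI)
    fix \<alpha> assume "\<alpha> \<in> \<Phi>"
    from assms(2)[OF this] eventually_same_side_ints[of "\<alpha> \<bullet> q"]
    show "\<forall>\<^sub>F t in F. \<forall>k::int. \<alpha> \<bullet> q \<noteq> of_int k \<longrightarrow> 0 < (\<alpha> \<bullet> p t - of_int k) * (\<alpha> \<bullet> q - of_int k)"
      unfolding filterlim_iff by blast
  qed
  then show ?thesis by eventually_elim (auto simp: affine_forms_def)
qed

text \<open>Compactness of an interval by bisection, for a relation that is only meaningful on a
  dense set \<open>D\<close> (the times at which a path is regular). The gluing point need not
  belong to \<open>D\<close>, so a nearby element of \<open>D\<close> takes its place.\<close>

lemma local_chain:
  fixes R :: "real \<Rightarrow> real \<Rightarrow> bool"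
  assumes ab: "a \<le> b" "a \<in> D" "b \<in> D"
    and dense: "\<And>x y. x < y \<Longrightarrow> a \<le> x \<Longrightarrow> y \<le> b \<Longrightarrow> \<exists>d\<in>D. x < d \<and> d < y"
    and trans: "\<And>x y z. x \<in> D \<Longrightarrow> y \<in> D \<Longrightarrow> z \<in> D \<Longrightarrow> R x y \<Longrightarrow> R y z \<Longrightarrow> R x z"
    and local: "\<And>t. a \<le> t \<Longrightarrow> t \<le> b \<Longrightarrow>
       \<exists>d>0. \<forall>x\<in>D. \<forall>y\<in>D. a \<le> x \<longrightarrow> x \<le> y \<longrightarrow> y \<le> b \<longrightarrow> \<bar>x - t\<bar> < d \<longrightarrow> \<bar>y - t\<bar> < d \<longrightarrow> R x y"
  shows "R a b"
proof -
  define Q where "Q d x y \<longleftrightarrow> (\<forall>s t. s \<in> D \<longrightarrow> t \<in> D \<longrightarrow> a \<le> s \<longrightarrow> s \<le> t \<longrightarrow> t \<le> b \<longrightarrow>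
      \<bar>s - x\<bar> < d \<longrightarrow> \<bar>t - y\<bar> < d \<longrightarrow> R s t)" for d x y
  define P where "P x y \<longleftrightarrow> (\<exists>d>0. Q d x y)" for x y
  have QD: "R s t" if "Q d x y" "s \<in> D" "t \<in> D" "a \<le> s" "s \<le> t" "t \<le> b" "\<bar>s - x\<bar> < d" "\<bar>t - y\<bar> < d"
    for d x y s t using that unfolding Q_def by simp
  have "a \<le> a \<and> b \<le> b \<longrightarrow> P a b"
    using ab(1)
  proof (induction rule: Bolzano[where P = "\<lambda>x y. a \<le> x \<and> y \<le> b \<longrightarrow> P x y"])
    case (trans x y z)
    show ?case
    proof (intro impI)
      assume xz: "a \<le> x \<and> z \<le> b"
      then have Pxy: "P x y" and Pyz: "P y z" using trans by auto
      show "P x z"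
      proof (cases "x = y \<or> y = z")
        case False
        then have lt: "x < y" "y < z" using trans by auto
        obtain d1 where d1: "d1 > 0" "Q d1 x y" using Pxy unfolding P_def by auto
        obtain d2 where d2: "d2 > 0" "Q d2 y z" using Pyz unfolding P_def by auto
        \<comment> \<open>Half the gaps: every point within \<open>d\<close> of \<open>x\<close>
          then precedes the \<open>u\<close> chosen in \<open>(y - d, y)\<close>, and every point
          within \<open>d\<close> of \<open>z\<close> follows it.\<close>
        define d where "d = min (min d1 d2) (min ((y - x)/2) ((z - y)/2))"
        have d: "d > 0" "d \<le> d1" "d \<le> d2" "d \<le> (y - x)/2" "d \<le> (z - y)/2"
          using d1(1) d2(1) lt unfolding d_def by (simp_all only: min_less_iff_conj min.coboundedI1 min.coboundedI2 min.cobounded1 min.cobounded2) simp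
        have "a \<le> x" "z \<le> b" using xz by auto
        then have yd: "y - d < y" "a \<le> y - d" "y \<le> b" using d lt by (linarith, argo, linarith)
        obtain u where u: "u \<in> D" "y - d < u" "u < y"
          using dense[OF yd] by auto
        have "R s t" if st: "s \<in> D" "t \<in> D" "a \<le> s" "s \<le> t" "t \<le> b" "\<bar>s - x\<bar> < d" "\<bar>t - z\<bar> < d" for s t
        proof (rule assms(5)[of s u t])
          have d': "d + d \<le> y - x" "d + d \<le> z - y" using d(4,5) by (simp_all add: field_simps)
          have "s < x + d" "z - d < t" using st(6,7) by (simp_all add: abs_less_iff)
          then have "s \<le> u" "u \<le> t" using u d' d(1) by linarith+
          moreover have "a \<le> u" "u \<le> b" using u yd by linarith+
          moreover have "\<bar>u - y\<bar> < d" using u by simp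
          ultimately have "a \<le> u" "s \<le> u" "u \<le> t" "u \<le> b" "\<bar>u - y\<bar> < d1" "\<bar>u - y\<bar> < d2" "\<bar>s - x\<bar> < d1" "\<bar>t - z\<bar> < d2"
            using st(6,7) d(2,3) by simp_all
          then show "R s u" "R u t"
            using QD[OF d1(2), of s u] QD[OF d2(2), of u t] st u by simp_all
        qed (use st u in simp_all)
        then have "Q d x z" unfolding Q_def by simp
        then show ?thesis unfolding P_def using d(1) by blast
      qed (use Pxy Pyz in auto)
    qed
  next
    case (local t)
    obtain d where d: "d > 0" and dR: "\<forall>x\<in>D. \<forall>y\<in>D. a \<le> x \<longrightarrow> x \<le> y \<longrightarrow> y \<le> b \<longrightarrow> \<bar>x - t\<bar> < d \<longrightarrow> \<bar>y - t\<bar> < d \<longrightarrow> R x y"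
      using assms(6)[OF local] by auto
    have "P x y" if xy: "x \<le> t" "t \<le> y" "y - x < d / 2" for x y
    proof -
      have "Q (d / 2) x y"
        unfolding Q_def
      proof (intro allI impI)
        fix s u assume su: "s \<in> D" "u \<in> D" "a \<le> s" "s \<le> u" "u \<le> b" "\<bar>s - x\<bar> < d / 2" "\<bar>u - y\<bar> < d / 2"
        then have "\<bar>s - t\<bar> < d" "\<bar>u - t\<bar> < d" using xy by linarith+
        then show "R s u" using dR su by simp
      qed
      then show ?thesis unfolding P_def using d by (intro exI[of _ "d / 2"]) simp
    qed
    then show ?case using d by (intro exI[of _ "d / 2"]) simp
  qed
  then obtain d where "d > 0" "Q d a b" unfolding P_def by auto
  then show ?thesis using QD[of d a b a b] ab by simp
qed

text \<open>At the first time when \<open>f\<close> is not positive it must vanish, and a positive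
  derivative there would make it negative just before.\<close>

lemma no_downcrossing:
  fixes f :: "real \<Rightarrow> real"
  assumes "s < t" "f s > 0" "f t < 0"
    and der: "\<And>z. (f has_real_derivative f' z) (at z)"
    and pos: "\<And>z. s \<le> z \<Longrightarrow> z \<le> t \<Longrightarrow> f z = 0 \<Longrightarrow> f' z > 0"
  shows False
proof -
  have cont: "continuous_on S f" for S
    using der by (meson DERIV_isCont continuous_at_imp_continuous_on)
  define Z where "Z = {s..t} \<inter> f -` {..0}"
  have "closed Z" unfolding Z_def
    by (intro continuous_closed_preimage cont closed_atLeastAtMost closed_atMost)
  moreover have "t \<in> Z" using assms by (simp add: Z_def)
  moreover have bb: "bdd_below Z" by (auto simp: Z_def intro!: bdd_belowI[of _ s])
  ultimately have zZ: "Inf Z \<in> Z" by (intro closed_contains_Inf) auto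
  define z where "z = Inf Z"
  have z: "s \<le> z" "z \<le> t" "f z \<le> 0" using zZ by (auto simp: Z_def z_def)
  then have "s < z" using assms(2) by (cases "s = z") auto
  have before: "f x > 0" if "s \<le> x" "x < z" for x
  proof (rule ccontr)
    assume "\<not> ?thesis"
    then have "x \<in> Z" using that z by (auto simp: Z_def)
    then show False using cInf_lower[OF _ bb] that by (force simp: z_def)
  qed
  have "f z = 0"
  proof (rule ccontr)
    assume "f z \<noteq> 0"
    then have "f z < 0" using z by simp
    then obtain x where "s \<le> x" "x \<le> z" "f x = 0"
      using IVT2'[of f z 0 s] assms(2) z cont by auto
    then show False using before[of x] \<open>f z \<noteq> 0\<close> by (cases "x = z") auto
  qed
  then have "f' z > 0" using pos z by blast
  then obtain d where d: "d > 0" "\<And>h. h > 0 \<Longrightarrow> h < d \<Longrightarrow> f (z - h) < f z"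
    using DERIV_pos_inc_left[OF der] by blast
  define h where "h = min (d / 2) (z - s)"
  have "h > 0" "h < d" "s \<le> z - h" using d \<open>s < z\<close> by (auto simp: h_def min_def)
  then show False using d(2)[of h] before[of "z - h"] \<open>f z = 0\<close> by simp
qed

context periodic_arrangement
begin

section \<open>Pull-back of forms and the crossing of a single wall\<close>

abbreviation "H \<equiv> affine_forms \<Phi>"
abbreviation "eqv \<equiv> conj_equiv H w w'"
abbreviation "irr \<equiv> irreducible_pt H w w'"

lemma form_w: "h \<in> H \<Longrightarrow> (\<lambda>x. h (w x)) \<in> H"
proof -
  assume "h \<in> H"
  then obtain \<alpha> k where h: "h = (\<lambda>x. \<alpha> \<bullet> x - of_int k)" "\<alpha> \<in> \<Phi>" by (rule affine_formsE)
  obtain \<beta> where b: "\<beta> \<in> \<Phi>" "\<And>x. \<beta> \<bullet> x = \<alpha> \<bullet> L x" using pull[OF h(2)] by blast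
  obtain n where n: "\<alpha> \<bullet> lam = of_int n" using lam_int[OF h(2)] by (auto elim: Ints_cases)
  have "(\<lambda>x. h (w x)) = (\<lambda>x. \<beta> \<bullet> x - of_int (k - n))"
    by (simp add: h w[OF h(2)] b(2) inner_add_right n algebra_simps)
  then show ?thesis using b(1) unfolding affine_forms_def by blast
qed

lemma form_w': "h \<in> H \<Longrightarrow> (\<lambda>x. h (w' x)) \<in> H"
proof -
  assume "h \<in> H"
  then obtain \<alpha> k where h: "h = (\<lambda>x. \<alpha> \<bullet> x - of_int k)" "\<alpha> \<in> \<Phi>" by (rule affine_formsE)
  obtain \<beta> where b: "\<beta> \<in> \<Phi>" "\<And>x. \<beta> \<bullet> x = \<alpha> \<bullet> L' x" using pull'[OF h(2)] by blast
  obtain n where n: "\<beta> \<bullet> lam = of_int n" using lam_int[OF b(1)] by (auto elim: Ints_cases)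
  have "(\<lambda>x. h (w' x)) = (\<lambda>x. \<beta> \<bullet> x - of_int (k + n))"
    by (auto simp: h w'[OF h(2)] linear_diff[OF linear_L'] inner_diff_right simp flip: b(2) n)
  then show ?thesis using b(1) unfolding affine_forms_def by blast
qed

lemma form_w'w: "h \<in> H \<Longrightarrow> h (w' (w x)) = h x"
proof -
  assume "h \<in> H"
  then obtain \<alpha> k where h: "h = (\<lambda>x. \<alpha> \<bullet> x - of_int k)" "\<alpha> \<in> \<Phi>" by (rule affine_formsE)
  obtain \<beta> where b: "\<beta> \<in> \<Phi>" "\<And>x. \<beta> \<bullet> x = \<alpha> \<bullet> L' x" using pull'[OF h(2)] by blast
  have "\<beta> \<bullet> (w x - lam) = \<beta> \<bullet> L x" by (simp add: inner_diff_right w[OF b(1)] inner_add_right)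
  then show ?thesis by (simp add: h w'[OF h(2)] flip: b(2)) (simp add: b(2))
qed

lemma forms_proportional:
  assumes "h \<in> H" "h' \<in> H" "\<And>x. h' x = c * h x"
  shows "h' = h \<or> h' = (\<lambda>x. - h x)"
proof -
  obtain \<alpha> k where h: "h = (\<lambda>x. \<alpha> \<bullet> x - of_int k)" "\<alpha> \<in> \<Phi>" using assms by (auto simp: affine_forms_def)
  obtain \<beta> l where h': "h' = (\<lambda>x. \<beta> \<bullet> x - of_int l)" "\<beta> \<in> \<Phi>" using assms by (auto simp: affine_forms_def)
  have l: "of_int l = c * of_int k" using assms(3)[of 0] by (simp add: h h')
  then have "\<beta> \<bullet> x = (c *\<^sub>R \<alpha>) \<bullet> x" for x using assms(3)[of x] by (simp add: h h' algebra_simps)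
  then have b: "\<beta> = c *\<^sub>R \<alpha>" using vector_eq_rdot by blast
  have "\<alpha> \<noteq> 0" using nz h(2) by auto
  from reduced[OF h(2) h'(2) b] have "c = 1 \<or> c = -1"
  proof
    assume "\<beta> = \<alpha>"
    then show ?thesis using b \<open>\<alpha> \<noteq> 0\<close> by (metis scaleR_cancel_right scaleR_one)
  next
    assume "\<beta> = - \<alpha>"
    then show ?thesis using b \<open>\<alpha> \<noteq> 0\<close> by (metis scaleR_cancel_right scaleR_minus1_left)
  qed
  then show ?thesis using assms(3) by auto
qed

lemma invariant_wall_w':
  assumes "h \<in> H" "(\<forall>x. h (w' x) = h x) \<or> (\<forall>x. h (w' x) = - h x)"
  shows "invariant_wall w h"
  using assms(2) unfolding invariant_wall_def by (metis form_w'w[OF assms(1)] minus_minus)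

text \<open>Since only \<open>h\<close> separates \<open>a\<close> from \<open>b\<close> and
  \<open>h\<close> is not invariant, \<open>w a\<close> and \<open>w b\<close> are on the same side
  of \<open>h\<close>, and so are \<open>w' a\<close> and \<open>w' b\<close>. If both images of
  \<open>a\<close> are beyond the wall, this is a drop, contrary to irreducibility; if exactly one
  is, the step is additive in one direction or the other. The remaining case is left to
  \<open>no_up\<close>, which the flow will refute.\<close>

lemma adjacent_step:
  assumes ab: "regular H a" "regular H b" and h: "h \<in> H" "adjacent H h a b" and irr: "irr a"
    and no_up: "\<not> invariant_wall w h \<Longrightarrow> \<not> splits h a (w a) \<Longrightarrow> \<not> splits h a (w' a) \<Longrightarrow> False"
  shows "eqv a b"
proof (cases "invariant_wall w h")
  case True
  then show ?thesis using ce_wall ab h by metis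
next
  case False
  have hab: "splits h a b" using h by (simp add: adjacent_def)
  have only: "h' = h \<or> h' = (\<lambda>x. - h x)" if "h' \<in> H" "splits h' a b" for h'
    using that h by (auto simp: adjacent_def)
  have "\<not> splits (\<lambda>x. h (w x)) a b"
    using only[OF form_w[OF h(1)]] False unfolding invariant_wall_def by metis
  then have nw: "\<not> splits h (w a) (w b)" by (simp add: splits_def)
  have "\<not> splits (\<lambda>x. h (w' x)) a b"
    using only[OF form_w'[OF h(1)]] False invariant_wall_w'[OF h(1)] by metis
  then have nw': "\<not> splits h (w' a) (w' b)" by (simp add: splits_def)
  have nz: "h a \<noteq> 0" "h b \<noteq> 0" "h (w a) \<noteq> 0" "h (w b) \<noteq> 0" "h (w' a) \<noteq> 0" "h (w' b) \<noteq> 0"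
    using ab h(1) form_w[OF h(1)] form_w'[OF h(1)] by (auto simp: regular_def)
  note tr = splits_trans[of h]
  consider "splits h a (w a)" "splits h a (w' a)" | "splits h a (w a)" "\<not> splits h a (w' a)"
    | "\<not> splits h a (w a)" "splits h a (w' a)"
    using no_up[OF False] by blast
  then show ?thesis
  proof cases
    case 1
    have "eqv a a" using ab by (intro ce_additive) (auto simp: additive_def splits_def mult_less_0_iff)
    moreover have "drops H w w' a b" unfolding drops_def using 1 ab h False by blast
    ultimately show ?thesis using irr unfolding irreducible_pt_def by blast
  next
    case 2
    have "\<not> splits h b (w b)"
      using tr[OF nz(2) nz(1) nz(4)] tr[OF nz(1) nz(3) nz(4)] 2 nw hab splits_sym[of h] by blast
    then have "additive H w w' a b" unfolding additive_def using only 2 by fastforce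
    then show ?thesis using ce_additive ab by metis
  next
    case 3
    have "\<not> splits h b (w' b)"
      using tr[OF nz(2) nz(1) nz(6)] tr[OF nz(1) nz(5) nz(6)] 3 nw' hab splits_sym[of h] by blast
    then have "additive H w w' b a" unfolding additive_def using only 3 splits_sym by fastforce
    then show ?thesis using ce_additive ce_sym ab by metis
  qed
qed

lemma same_side_eqv:
  assumes "regular H a" "\<And>h. h \<in> H \<Longrightarrow> 0 < h b * h a"
  shows "eqv a b"
proof -
  have "\<not> splits h a b" if "h \<in> H" for h
    using assms(2)[OF that] by (simp add: splits_def mult.commute)
  moreover have "regular H b" using assms by (force simp: regular_def)
  ultimately show ?thesis using assms(1) by (intro ce_additive) (auto simp: additive_def)
qed

end

section \<open>The flow towards the displacement minimum\<close>

lemma exp_sum_dominant: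
  fixes c :: "real \<Rightarrow> real"
  assumes "finite E" "\<tau> \<in> E" "\<And>\<mu>. \<mu> \<in> E \<Longrightarrow> \<tau> < \<mu> \<Longrightarrow> c \<mu> = 0"
  shows "((\<lambda>t. \<Sum>\<mu>\<in>E. exp ((\<mu> - \<tau>) * t) * c \<mu>) \<longlongrightarrow> c \<tau>) at_top"
proof -
  have "((\<lambda>t. \<Sum>\<mu>\<in>E. exp ((\<mu> - \<tau>) * t) * c \<mu>) \<longlongrightarrow> (\<Sum>\<mu>\<in>E. if \<mu> = \<tau> then c \<tau> else 0)) at_top"
  proof (intro tendsto_sum)
    fix \<mu> assume m: "\<mu> \<in> E"
    consider "\<mu> = \<tau>" | "\<tau> < \<mu>" | "\<mu> < \<tau>" by linarith
    then show "((\<lambda>t. exp ((\<mu> - \<tau>) * t) * c \<mu>) \<longlongrightarrow> (if \<mu> = \<tau> then c \<tau> else 0)) at_top"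
    proof cases
      case 3
      have "filterlim (\<lambda>t. (\<mu> - \<tau>) * t) at_bot at_top"
        using 3 by (intro filterlim_tendsto_neg_mult_at_bot[OF tendsto_const _ filterlim_ident]) simp
      then have "((\<lambda>t. exp ((\<mu> - \<tau>) * t)) \<longlongrightarrow> 0) at_top"
        by (rule filterlim_compose[OF exp_at_bot])
      from tendsto_mult_left_zero[OF this, of "c \<mu>"] show ?thesis using 3 by simp
    qed (use assms(3) m in auto)
  qed
  also have "(\<Sum>\<mu>\<in>E. if \<mu> = \<tau> then c \<tau> else 0) = c \<tau>" using assms by simp
  finally show ?thesis .
qed

context periodic_arrangement
begin

text \<open>The operator exponential of \<open>t (L + L' - 2)\<close>, written in
  eigenprojections.\<close>

definition R :: "real \<Rightarrow> 'a \<Rightarrow> 'a" where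
  "R t y = (\<Sum>\<mu>\<in>E. exp ((\<mu> - 2) * t) *\<^sub>R Pr \<mu> y)"

lemma linear_R: "linear (R t)"
  unfolding R_def by (intro linear_compose_sum ballI linear_compose_scale_right linear_Pr)

lemma Pr_R: "\<mu> \<in> E \<Longrightarrow> Pr \<mu> (R t y) = exp ((\<mu> - 2) * t) *\<^sub>R Pr \<mu> y"
proof -
  assume m: "\<mu> \<in> E"
  have "Pr \<mu> (R t y) = (\<Sum>\<nu>\<in>E. exp ((\<nu> - 2) * t) *\<^sub>R Pr \<mu> (Pr \<nu> y))"
    by (simp add: R_def linear_sum[OF linear_Pr] linear_scale[OF linear_Pr])
  also have "\<dots> = (\<Sum>\<nu>\<in>E. if \<nu> = \<mu> then exp ((\<mu> - 2) * t) *\<^sub>R Pr \<mu> y else 0)"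
    using m by (intro sum.cong) (auto simp: Pr_orth Pr_idem)
  finally show ?thesis using m finite_E by simp
qed

lemma R_inverse: "R (- t) (R t y) = y"
proof -
  have "R (- t) (R t y) = (\<Sum>\<mu>\<in>E. Pr \<mu> y)"
    unfolding R_def[of "- t"] by (intro sum.cong) (auto simp: Pr_R simp flip: exp_add)
  then show ?thesis by (simp add: sum_Pr)
qed

definition flow :: "'a \<Rightarrow> real \<Rightarrow> 'a" where
  "flow x t = center + R t (x - center)"

lemma R_deriv:
  "((\<lambda>t. \<alpha> \<bullet> R t y) has_real_derivative \<alpha> \<bullet> (L (R t y) + L' (R t y) - 2 *\<^sub>R R t y)) (at t)"
proof -
  have "L (R t y) + L' (R t y) = (\<Sum>\<mu>\<in>E. exp ((\<mu> - 2) * t) *\<^sub>R (L (Pr \<mu> y) + L' (Pr \<mu> y)))"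
    by (simp add: R_def linear_sum[OF lin] linear_scale[OF lin] linear_sum[OF linear_L']
        linear_scale[OF linear_L'] scaleR_right_distrib sum.distrib)
  also have "\<dots> - 2 *\<^sub>R R t y = (\<Sum>\<mu>\<in>E. ((\<mu> - 2) * exp ((\<mu> - 2) * t)) *\<^sub>R Pr \<mu> y)"
    unfolding R_def eig scaleR_sum_right sum_subtractf[symmetric]
    by (intro sum.cong) (simp_all add: algebra_simps)
  finally have *: "\<alpha> \<bullet> (L (R t y) + L' (R t y) - 2 *\<^sub>R R t y) =
     (\<Sum>\<mu>\<in>E. ((\<mu> - 2) * exp ((\<mu> - 2) * t)) * (\<alpha> \<bullet> Pr \<mu> y))"
    by (simp add: inner_sum_right)
  have **: "(\<lambda>t. \<alpha> \<bullet> R t y) = (\<lambda>t. \<Sum>\<mu>\<in>E. exp ((\<mu> - 2) * t) * (\<alpha> \<bullet> Pr \<mu> y))"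
    by (simp add: R_def inner_sum_right)
  show ?thesis unfolding * **
    by (intro DERIV_sum) (auto intro!: derivative_eq_intros)
qed

text \<open>The derivative is a nonnegative combination of \<open>h (w p)\<close> and \<open>h (w' p)\<close> on the hyperplane
  \<open>h p = 0\<close>: the flow never leaves a half-space that contains both \<open>w p\<close> and \<open>w' p\<close>.\<close>

lemma flow_deriv:
  assumes "h \<in> H"
  shows "((\<lambda>t. h (flow x t)) has_real_derivative
     h (w (flow x t)) + h (w' (flow x t)) - 2 * h (flow x t)) (at t)"
proof -
  obtain \<alpha> k where h: "h = (\<lambda>x. \<alpha> \<bullet> x - of_int k)" "\<alpha> \<in> \<Phi>" using assms by (auto simp: affine_forms_def)
  define y where "y = R t (x - center)"
  have "h (w (flow x t)) + h (w' (flow x t)) - 2 * h (flow x t) = \<alpha> \<bullet> (L y + L' y - 2 *\<^sub>R y)"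
    unfolding h flow_def y_def[symmetric] w_center[OF h(2)] w'_center[OF h(2)]
    by (simp add: linear_diff[OF linear_L'] inner_simps)
  moreover have "((\<lambda>t. h (flow x t)) has_real_derivative \<alpha> \<bullet> (L y + L' y - 2 *\<^sub>R y)) (at t)"
    unfolding h flow_def inner_add_right y_def
    by (auto intro!: derivative_eq_intros R_deriv)
  ultimately show ?thesis by simp
qed

lemma flow_continuous:
  assumes "\<alpha> \<in> \<Phi>" shows "((\<lambda>t. \<alpha> \<bullet> flow x t) \<longlongrightarrow> \<alpha> \<bullet> flow x t0) (nhds t0)"
proof -
  have "isCont (\<lambda>t. \<alpha> \<bullet> R t (x - center)) t0" by (rule DERIV_isCont[OF R_deriv])
  then have "isCont (\<lambda>t. \<alpha> \<bullet> flow x t) t0" by (simp add: flow_def inner_add_right)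
  then show ?thesis by (simp add: isCont_def tendsto_nhds_iff)
qed

text \<open>Two independent equations cut out a flat of codimension two, and sweeping it along the
  flow adds only one dimension, so the bad starting points form a null set.\<close>

lemma negligible_double_crossing:
  assumes a: "\<alpha> \<in> \<Phi>" and b: "\<beta> \<in> \<Phi>" "\<beta> \<noteq> \<alpha>" "\<beta> \<noteq> - \<alpha>"
  shows "negligible {x. \<exists>t. \<alpha> \<bullet> flow x t = k \<and> \<beta> \<bullet> flow x t = l}"
proof -
  define c where "c = (1 / (\<alpha> \<bullet> \<alpha>)) *\<^sub>R \<alpha>"
  have "\<alpha> \<noteq> 0" using a nz by auto
  then have ac: "\<alpha> \<bullet> c = 1" by (simp add: c_def)
  \<comment> \<open>The time is stored in the coordinate transverse to the first hyperplane:
    \<open>q u\<close> projects \<open>u\<close> to that hyperplane along \<open>c\<close>, and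
    \<open>F\<close> runs the flow backwards from \<open>q u\<close> for the time
    \<open>\<alpha> \<bullet> u - k\<close>. The bad points become a differentiable image of the
    null set \<open>S\<close> in the same space.\<close>
  define q where "q u = u - (\<alpha> \<bullet> u - k) *\<^sub>R c" for u
  define F where "F u = center + R (- (\<alpha> \<bullet> u - k)) (q u - center)" for u
  define S where "S = {u. \<beta> \<bullet> q u - l = 0}"
  have "affine_fun (\<lambda>u. \<beta> \<bullet> q u - l)"
  proof (rule affine_funI)
    show "linear (\<lambda>u. \<beta> \<bullet> u - (\<alpha> \<bullet> u) * (\<beta> \<bullet> c))"
      by (auto intro!: linearI simp: inner_simps algebra_simps)
    show "\<beta> \<bullet> q u - l = \<beta> \<bullet> u - (\<alpha> \<bullet> u) * (\<beta> \<bullet> c) + (k * (\<beta> \<bullet> c) - l)" for u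
      by (simp add: q_def inner_simps algebra_simps)
  qed
  moreover have "\<exists>u. \<beta> \<bullet> q u - l \<noteq> 0"
  proof (rule ccontr)
    assume "\<not> ?thesis"
    then have e: "\<beta> \<bullet> q u = \<beta> \<bullet> q 0" for u by simp
    have "\<beta> \<bullet> u = ((\<beta> \<bullet> c) *\<^sub>R \<alpha>) \<bullet> u" for u
      using e[of u] by (simp add: q_def inner_simps algebra_simps)
    then have "\<beta> = (\<beta> \<bullet> c) *\<^sub>R \<alpha>" using vector_eq_rdot by blast
    then show False using reduced[OF a b(1)] b by blast
  qed
  ultimately have S: "negligible S" unfolding S_def using negligible_affine_fun by blast
  have diff_sum: "(\<lambda>u. \<Sum>\<mu>\<in>E. f \<mu> u) differentiable_on S" if "\<And>\<mu>. f \<mu> differentiable_on S"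
    for f :: "real \<Rightarrow> 'a \<Rightarrow> 'a"
    using that unfolding differentiable_on_def by (auto intro!: differentiable_sum finite_E)
  have "F differentiable_on S"
  proof -
    have "F = (\<lambda>u. center + (\<Sum>\<mu>\<in>E. exp ((\<mu> - 2) * (- (\<alpha> \<bullet> u - k))) *\<^sub>R Pr \<mu> (q u - center)))"
      by (rule ext) (simp only: F_def R_def)
    moreover have "\<dots> differentiable_on S"
    proof (intro differentiable_on_add differentiable_on_const diff_sum differentiable_on_scaleR)
      fix \<mu>
      have "(\<lambda>u. exp ((\<mu> - 2) * (- (\<alpha> \<bullet> u - k)))) differentiable at u within S" for u
        unfolding differentiable_def by (rule exI) (rule derivative_eq_intros refl | simp)+
      then show "(\<lambda>u. exp ((\<mu> - 2) * (- (\<alpha> \<bullet> u - k)))) differentiable_on S"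
        by (simp add: differentiable_on_def)
      have "(\<lambda>u. Pr \<mu> (q u - center)) = (\<lambda>u. Pr \<mu> u - (\<alpha> \<bullet> u) *\<^sub>R Pr \<mu> c + (k *\<^sub>R Pr \<mu> c - Pr \<mu> center))"
        unfolding q_def linear_diff[OF linear_Pr] linear_scale[OF linear_Pr] scaleR_diff_left by (simp add: fun_eq_iff)
      moreover have "linear (\<lambda>u. Pr \<mu> u - (\<alpha> \<bullet> u) *\<^sub>R Pr \<mu> c)"
        by (auto intro!: linearI simp: linear_add[OF linear_Pr] linear_scale[OF linear_Pr] inner_simps algebra_simps)
      ultimately show "(\<lambda>u. Pr \<mu> (q u - center)) differentiable_on S"
        using differentiable_on_add[OF linear_imp_differentiable_on differentiable_on_const] by auto
    qed
    ultimately show ?thesis by simp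
  qed
  then have "negligible (F ` S)" using S by (intro negligible_differentiable_image_negligible) auto
  moreover have "{x. \<exists>t. \<alpha> \<bullet> flow x t = k \<and> \<beta> \<bullet> flow x t = l} \<subseteq> F ` S"
  proof safe
    fix x t assume t: "k = \<alpha> \<bullet> flow x t" "l = \<beta> \<bullet> flow x t"
    define u where "u = flow x t + t *\<^sub>R c"
    have au: "\<alpha> \<bullet> u - k = t" by (simp add: u_def inner_add_right ac t)
    then have qu: "q u = flow x t" by (simp add: q_def u_def)
    have "F u = x" unfolding F_def au qu by (simp add: flow_def R_inverse)
    moreover have "u \<in> S" by (simp add: S_def qu t)
    ultimately show "x \<in> F ` S" by blast
  qed
  ultimately show ?thesis by (rule negligible_subset)
qed

text \<open>Everything that can decide the final side of a hyperplane: its value at the limit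
  \<open>center + Pr 2 y\<close>, and the coefficient of each exponential rate.\<close>

definition lead_funs :: "('a \<Rightarrow> real) set" where
  "lead_funs = (\<lambda>(\<alpha>, k::int) y. \<alpha> \<bullet> (center + Pr 2 y) - of_int k) ` (\<Phi> \<times> UNIV)
     \<union> (\<lambda>(\<alpha>, \<mu>) y. \<alpha> \<bullet> Pr \<mu> y) ` (\<Phi> \<times> E)"

definition generic :: "'a \<Rightarrow> bool" where
  "generic y \<longleftrightarrow> (\<forall>g\<in>lead_funs. g y = 0 \<longrightarrow> (\<forall>x. g x = 0))"

definition top_eig :: "'a \<Rightarrow> real" where
  "top_eig \<alpha> = Max {\<mu>\<in>E. \<exists>x. \<alpha> \<bullet> Pr \<mu> x \<noteq> 0}"

text \<open>For generic \<open>y\<close> this is the leading term of \<open>\<alpha> \<bullet> (center + R t y) - k\<close> as \<open>t\<close> tends to infinity.\<close>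

definition lead :: "'a \<Rightarrow> int \<Rightarrow> 'a \<Rightarrow> real" where
  "lead \<alpha> k = (if \<exists>x. \<alpha> \<bullet> (center + Pr 2 x) \<noteq> of_int k
     then (\<lambda>y. \<alpha> \<bullet> (center + Pr 2 y) - of_int k) else (\<lambda>y. \<alpha> \<bullet> Pr (top_eig \<alpha>) y))"

text \<open>For generic \<open>y\<close> the alcove of \<open>a\<close> is the one in which the flow
  line through \<open>center + y\<close> finally stays.\<close>

definition good :: "'a \<Rightarrow> 'a \<Rightarrow> bool" where
  "good a y \<longleftrightarrow> (\<forall>\<alpha>\<in>\<Phi>. \<forall>k. 0 < (\<alpha> \<bullet> a - of_int k) * lead \<alpha> k y)"

lemma top_eig:
  assumes "\<alpha> \<in> \<Phi>"
  shows "top_eig \<alpha> \<in> E" "\<exists>x. \<alpha> \<bullet> Pr (top_eig \<alpha>) x \<noteq> 0"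
    and "\<And>\<mu> x. \<mu> \<in> E \<Longrightarrow> top_eig \<alpha> < \<mu> \<Longrightarrow> \<alpha> \<bullet> Pr \<mu> x = 0"
proof -
  define M where "M = {\<mu>\<in>E. \<exists>x. \<alpha> \<bullet> Pr \<mu> x \<noteq> 0}"
  have fM: "finite M" using finite_E by (simp add: M_def)
  have "M \<noteq> {}"
  proof
    assume "M = {}"
    then have "\<alpha> \<bullet> (\<Sum>\<mu>\<in>E. Pr \<mu> \<alpha>) = 0" by (auto simp: M_def inner_sum_right)
    then show False using assms nz by (simp add: sum_Pr)
  qed
  then have "top_eig \<alpha> \<in> M" unfolding top_eig_def M_def[symmetric] using fM by simp
  then show "top_eig \<alpha> \<in> E" "\<exists>x. \<alpha> \<bullet> Pr (top_eig \<alpha>) x \<noteq> 0" by (auto simp: M_def)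
  fix \<mu> x assume "\<mu> \<in> E" "top_eig \<alpha> < \<mu>"
  then show "\<alpha> \<bullet> Pr \<mu> x = 0"
    using Max_ge[OF fM, of \<mu>] unfolding top_eig_def M_def[symmetric] by (auto simp: M_def)
qed

lemma lead_in: "\<alpha> \<in> \<Phi> \<Longrightarrow> lead \<alpha> k \<in> lead_funs"
  unfolding lead_def lead_funs_def using top_eig(1)[of \<alpha>] by (force simp: image_iff)

lemma lead_nz: "\<alpha> \<in> \<Phi> \<Longrightarrow> \<exists>x. lead \<alpha> k x \<noteq> 0"
  using top_eig(2)[of \<alpha>] by (auto simp: lead_def)

lemma generic_lead: "generic y \<Longrightarrow> \<alpha> \<in> \<Phi> \<Longrightarrow> lead \<alpha> k y \<noteq> 0"
  using lead_in lead_nz unfolding generic_def by blast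

lemma affine_lead_funs: "g \<in> lead_funs \<Longrightarrow> affine_fun g"
proof -
  assume "g \<in> lead_funs"
  then consider \<alpha> and k :: int where "g = (\<lambda>y. \<alpha> \<bullet> (center + Pr 2 y) - of_int k)"
    | \<alpha> \<mu> where "g = (\<lambda>y. \<alpha> \<bullet> Pr \<mu> y)" unfolding lead_funs_def by auto
  then show ?thesis
  proof cases
    case 1
    show ?thesis unfolding 1
      by (rule affine_funI[of "\<lambda>y. \<alpha> \<bullet> Pr 2 y" _ "\<alpha> \<bullet> center - of_int k"])
        (auto intro!: linearI simp: linear_add[OF linear_Pr] linear_scale[OF linear_Pr] inner_simps)
  next
    case 2
    show ?thesis unfolding 2
      by (rule affine_funI[of "\<lambda>y. \<alpha> \<bullet> Pr \<mu> y" _ 0])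
        (auto intro!: linearI simp: linear_add[OF linear_Pr] linear_scale[OF linear_Pr] inner_simps)
  qed
qed

lemma countable_lead_funs: "countable lead_funs"
  unfolding lead_funs_def using fin finite_E
  by (intro countable_Un countable_image countable_SIGMA) (auto intro: countable_finite)

lemma R_tendsto: "((\<lambda>t. \<alpha> \<bullet> R t y) \<longlongrightarrow> \<alpha> \<bullet> Pr 2 y) at_top"
proof -
  have "((\<lambda>t. \<Sum>\<mu>\<in>E. exp ((\<mu> - 2) * t) * (\<alpha> \<bullet> Pr \<mu> y)) \<longlongrightarrow> \<alpha> \<bullet> Pr 2 y) at_top"
    using finite_E two_in_E E_le by (intro exp_sum_dominant) force+
  then show ?thesis by (simp add: R_def inner_sum_right)
qed

text \<open>If the hyperplane does not contain the whole minimal displacement set, the limit point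
  is off it and decides, uniformly in \<open>k\<close>. Otherwise
  \<open>\<alpha> \<bullet> center = k\<close>, and the sign is that of
  \<open>\<alpha> \<bullet> R t y\<close>, governed by the largest eigenvalue on which
  \<open>\<alpha>\<close> does not vanish.\<close>

lemma eventually_good:
  assumes "generic y"
  shows "\<forall>\<^sub>F t in at_top. good (center + R t y) y"
  unfolding good_def
proof (intro eventually_ball_finite fin ballI)
  fix \<alpha> assume a: "\<alpha> \<in> \<Phi>"
  define r where "r = \<alpha> \<bullet> (center + Pr 2 y)"
  have "((\<lambda>t. \<alpha> \<bullet> (center + R t y)) \<longlongrightarrow> r) at_top"
    unfolding r_def inner_add_right by (intro tendsto_add tendsto_const R_tendsto)
  then have ev1: "\<forall>\<^sub>F t in at_top. \<forall>k::int. r \<noteq> of_int k \<longrightarrow>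
      0 < (\<alpha> \<bullet> (center + R t y) - of_int k) * (r - of_int k)"
    using eventually_same_side_ints[of r] unfolding filterlim_iff by blast
  define \<tau> where "\<tau> = top_eig \<alpha>"
  have ev2: "\<forall>\<^sub>F t in at_top. \<alpha> \<bullet> Pr \<tau> y \<noteq> 0 \<longrightarrow> 0 < (\<alpha> \<bullet> R t y) * (\<alpha> \<bullet> Pr \<tau> y)"
  proof (cases "\<alpha> \<bullet> Pr \<tau> y = 0")
    case False
    have "((\<lambda>t. \<Sum>\<mu>\<in>E. exp ((\<mu> - \<tau>) * t) * (\<alpha> \<bullet> Pr \<mu> y)) \<longlongrightarrow> \<alpha> \<bullet> Pr \<tau> y) at_top"
      unfolding \<tau>_def using finite_E top_eig[OF a] by (intro exp_sum_dominant) auto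
    then have "((\<lambda>t. (\<Sum>\<mu>\<in>E. exp ((\<mu> - \<tau>) * t) * (\<alpha> \<bullet> Pr \<mu> y)) * (\<alpha> \<bullet> Pr \<tau> y)) \<longlongrightarrow>
        (\<alpha> \<bullet> Pr \<tau> y) * (\<alpha> \<bullet> Pr \<tau> y)) at_top" by (intro tendsto_mult tendsto_const)
    moreover have "0 < (\<alpha> \<bullet> Pr \<tau> y) * (\<alpha> \<bullet> Pr \<tau> y)"
      using False by (metis not_real_square_gt_zero)
    ultimately have "\<forall>\<^sub>F t in at_top. 0 < (\<Sum>\<mu>\<in>E. exp ((\<mu> - \<tau>) * t) * (\<alpha> \<bullet> Pr \<mu> y)) * (\<alpha> \<bullet> Pr \<tau> y)"
      by (rule order_tendstoD(1))
    then show ?thesis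
    proof eventually_elim
      case (elim t)
      have "(\<Sum>\<mu>\<in>E. exp ((\<mu> - \<tau>) * t) * (\<alpha> \<bullet> Pr \<mu> y)) = exp ((2 - \<tau>) * t) * (\<alpha> \<bullet> R t y)"
        unfolding R_def inner_sum_right sum_distrib_left
        by (intro sum.cong) (auto simp: algebra_simps simp flip: exp_add)
      with elim have "0 < exp ((2 - \<tau>) * t) * ((\<alpha> \<bullet> R t y) * (\<alpha> \<bullet> Pr \<tau> y))" by (simp add: mult.assoc)
      then show ?case by (simp add: zero_less_mult_iff)
    qed
  qed simp
  from ev1 ev2 show "\<forall>\<^sub>F t in at_top. \<forall>k. 0 < (\<alpha> \<bullet> (center + R t y) - of_int k) * lead \<alpha> k y"
  proof eventually_elim
    case (elim t)
    show ?case
    proof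
      fix k
      have nz: "lead \<alpha> k y \<noteq> 0" by (rule generic_lead[OF assms a])
      show "0 < (\<alpha> \<bullet> (center + R t y) - of_int k) * lead \<alpha> k y"
      proof (cases "\<exists>x. \<alpha> \<bullet> (center + Pr 2 x) \<noteq> of_int k")
        case True
        then have "lead \<alpha> k y = r - of_int k" by (simp add: lead_def r_def)
        then show ?thesis using elim(1) nz by auto
      next
        case False
        then have l: "lead \<alpha> k y = \<alpha> \<bullet> Pr \<tau> y" unfolding lead_def \<tau>_def by simp
        have "\<alpha> \<bullet> center = of_int k" using False[simplified, rule_format, of 0] by (simp add: linear_0[OF linear_Pr])
        then show ?thesis using elim(2) nz unfolding l by (simp add: inner_add_right)
      qed
    qed
  qed
qed

lemma good_regular:
  assumes "good a y" shows "regular H a"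
  unfolding regular_def
proof
  fix h assume "h \<in> H"
  then obtain \<alpha> k where h: "h = (\<lambda>x. \<alpha> \<bullet> x - of_int k)" "\<alpha> \<in> \<Phi>" by (rule affine_formsE)
  then have "0 < h a * lead \<alpha> k y" using assms unfolding good_def h(1) by blast
  then show "h a \<noteq> 0" by auto
qed

text \<open>A generic point of the alcove of \<open>a\<close> is transported by the flow. Near each
  time at most one hyperplane is met, so each local passage is a single adjacent step, and
  compactness of the time interval chains these steps.\<close>

lemma eqv_good:
  assumes a: "regular H a" "irr a"
  shows "\<exists>y b. generic y \<and> good b y \<and> eqv a b"
proof -
  \<comment> \<open>Three kinds of starting points to avoid: \<open>B1\<close> makes the path
    regular at rational times (rational to keep the conditions countable), \<open>B2\<close> keeps
    it from meeting two hyperplanes at once, \<open>B3\<close> makes the leading terms of the limit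
    nonzero.\<close>
  define B1 where "B1 = (\<lambda>(t, \<alpha>, k::int) x. \<alpha> \<bullet> flow x t - of_int k) ` (\<rat> \<times> \<Phi> \<times> UNIV)"
  define B2 where "B2 = (\<Union>(\<alpha>, \<beta>, k::int, l::int)\<in>{(\<alpha>, \<beta>, k, l). \<alpha> \<in> \<Phi> \<and> \<beta> \<in> \<Phi> \<and> \<beta> \<noteq> \<alpha> \<and> \<beta> \<noteq> - \<alpha>}.
      {x. \<exists>t. \<alpha> \<bullet> flow x t = of_int k \<and> \<beta> \<bullet> flow x t = of_int l})"
  define B3 where "B3 = (\<lambda>g x. g (x - center)) ` lead_funs"
  have shift: "affine_fun (\<lambda>x. g (A (x - center)) )" if g: "affine_fun g" and A: "linear A" for g :: "'a \<Rightarrow> real" and A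
  proof -
    obtain l c where l: "linear l" "\<And>x. g x = l x + c" using g unfolding affine_fun_def by auto
    have "linear (\<lambda>x. l (A x))" using linear_compose[OF A l(1)] by (simp add: o_def)
    then show ?thesis
      by (rule affine_funI[where c = "c - l (A center)"]) (simp add: l linear_diff[OF A] linear_diff[OF l(1)])
  qed
  have n1: "negligible {x. \<exists>g\<in>B1. g x = 0 \<and> (\<exists>y. g y \<noteq> 0)}"
  proof (rule negligible_nongeneric)
    show "countable B1" unfolding B1_def using fin
      by (intro countable_image countable_SIGMA countable_rat) (auto intro: countable_finite)
    fix g assume "g \<in> B1"
    then obtain t \<alpha> and k :: int where g: "g = (\<lambda>x. \<alpha> \<bullet> flow x t - of_int k)" by (auto simp: B1_def)
    have "affine_fun (\<lambda>u. \<alpha> \<bullet> (center + u) - of_int k)"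
      by (rule affine_funI[of "\<lambda>u. \<alpha> \<bullet> u" _ "\<alpha> \<bullet> center - of_int k"])
        (auto intro!: linearI simp: inner_simps)
    from shift[OF this linear_R[of t]] show "affine_fun g" by (simp add: g flow_def)
  qed
  have n2: "negligible B2" unfolding B2_def
  proof (rule negligible_countable_UN)
    have "countable (\<Phi> \<times> \<Phi> \<times> (UNIV :: int set) \<times> (UNIV :: int set))"
      using fin by (intro countable_SIGMA) (auto intro: countable_finite)
    then show "countable {(\<alpha>, \<beta>, k::int, l::int). \<alpha> \<in> \<Phi> \<and> \<beta> \<in> \<Phi> \<and> \<beta> \<noteq> \<alpha> \<and> \<beta> \<noteq> - \<alpha>}"
      by (rule countable_subset[rotated]) auto
  qed (auto intro: negligible_double_crossing)
  have n3: "negligible {x. \<exists>g\<in>B3. g x = 0 \<and> (\<exists>y. g y \<noteq> 0)}"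
  proof (rule negligible_nongeneric)
    show "countable B3" unfolding B3_def using countable_lead_funs by (rule countable_image)
    fix g assume "g \<in> B3"
    then show "affine_fun g" using shift[OF affine_lead_funs linear_id] by (auto simp: B3_def)
  qed
  define S where "S = {x. \<forall>h\<in>H. h a \<noteq> 0 \<longrightarrow> 0 < h x * h a}"
  have "\<forall>\<^sub>F x in nhds a. x \<in> S"
    unfolding S_def mem_Collect_eq by (rule eventually_same_side[OF fin]) (intro tendsto_inner tendsto_const filterlim_ident)
  then obtain S' where S': "open S'" "a \<in> S'" "S' \<subseteq> S" unfolding eventually_nhds by auto
  obtain x where x: "x \<in> S'" and nx: "x \<notin> {x. \<exists>g\<in>B1. g x = 0 \<and> (\<exists>y. g y \<noteq> 0)} \<union> B2 \<union> {x. \<exists>g\<in>B3. g x = 0 \<and> (\<exists>y. g y \<noteq> 0)}"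
    using open_minus_negligible[OF S'(1,2) negligible_Un[OF negligible_Un[OF n1 n2] n3]] by blast
  have nx1: "\<forall>g\<in>B1. g x = 0 \<longrightarrow> (\<forall>u. g u = 0)" and nx2: "x \<notin> B2"
    and nx3: "\<forall>g\<in>B3. g x = 0 \<longrightarrow> (\<forall>u. g u = 0)"
    using nx by simp_all
  have ax: "eqv a x"
    using x S'(3) a(1) by (intro same_side_eqv) (auto simp: S_def regular_def)
  define p where "p = flow x"
  define y where "y = x - center"
  have "generic y"
    unfolding generic_def
  proof (intro ballI impI allI)
    fix g u assume g: "g \<in> lead_funs" "g y = 0"
    then have "(\<lambda>x. g (x - center)) \<in> B3" "(\<lambda>x. g (x - center)) x = 0" by (auto simp: B3_def y_def)
    then have "(\<lambda>x. g (x - center)) (u + center) = 0" using nx3 by fast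
    then show "g u = 0" by simp
  qed
  have preg: "regular H (p t)" if "t \<in> \<rat>" for t
    unfolding regular_def
  proof
    fix h assume "h \<in> H"
    then obtain \<alpha> k where h: "h = (\<lambda>x. \<alpha> \<bullet> x - of_int k)" "\<alpha> \<in> \<Phi>" by (rule affine_formsE)
    define g where "g = (\<lambda>x. \<alpha> \<bullet> flow x t - of_int k)"
    have "g \<in> B1" unfolding B1_def g_def using that h by force
    moreover have "\<exists>u. g u \<noteq> 0"
    proof -
      have gu: "g (center + R (- t) u) = \<alpha> \<bullet> (center + u) - of_int k" for u
        using R_inverse[of "- t" u] by (simp add: g_def flow_def)
      have "\<alpha> \<noteq> 0" using h nz by auto
      then have "g (center + R (- t) \<alpha>) \<noteq> g (center + R (- t) 0)" unfolding gu by (simp add: inner_add_right)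
      then show ?thesis by metis
    qed
    ultimately have "g x \<noteq> 0" using nx1 by fast
    then show "h (p t) \<noteq> 0" by (simp add: g_def h p_def)
  qed
  have single: "h' = h \<or> h' = (\<lambda>x. - h x)" if hh: "h \<in> H" "h' \<in> H" "h (p t) = 0" "h' (p t) = 0" for h h' t
  proof -
    obtain \<alpha> k where h: "h = (\<lambda>x. \<alpha> \<bullet> x - of_int k)" "\<alpha> \<in> \<Phi>" using hh(1) by (auto simp: affine_forms_def)
    obtain \<beta> l where h': "h' = (\<lambda>x. \<beta> \<bullet> x - of_int l)" "\<beta> \<in> \<Phi>" using hh(2) by (auto simp: affine_forms_def)
    have pt: "\<alpha> \<bullet> flow x t = of_int k" "\<beta> \<bullet> flow x t = of_int l"
      using hh(3,4) unfolding h(1) h'(1) p_def by simp_all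
    have "\<beta> = \<alpha> \<or> \<beta> = - \<alpha>"
    proof (rule ccontr)
      assume "\<not> ?thesis"
      then have "(\<alpha>, \<beta>, k, l) \<in> {(\<alpha>, \<beta>, k, l). \<alpha> \<in> \<Phi> \<and> \<beta> \<in> \<Phi> \<and> \<beta> \<noteq> \<alpha> \<and> \<beta> \<noteq> - \<alpha>}"
        using h(2) h'(2) by simp
      then have "x \<in> B2" unfolding B2_def by (rule UN_I) (use pt in auto)
      then show False using nx2 by simp
    qed
    then show ?thesis
    proof
      assume "\<beta> = \<alpha>" then show ?thesis using pt by (simp add: h h')
    next
      assume b: "\<beta> = - \<alpha>"
      then have "of_int l = - (of_int k :: real)" using pt by simp
      then show ?thesis using b by (simp add: h h' fun_eq_iff)
    qed
  qed
  have "\<forall>\<^sub>F t in at_top. good (center + R t y) y \<and> (0::real) \<le> t"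
    using eventually_good[OF \<open>generic y\<close>] eventually_ge_at_top[of 0] by eventually_elim simp
  then obtain T0 where T0: "\<And>t. t \<ge> T0 \<Longrightarrow> good (center + R t y) y \<and> 0 \<le> t"
    unfolding eventually_at_top_linorder by blast
  \<comment> \<open>Rounded up to a natural number so that the end time is rational, like all times
    of the chain.\<close>
  define T where "T = real (nat \<lceil>T0\<rceil>)"
  have "T0 \<le> T" by (simp add: T_def) linarith
  have T: "good (p T) y" "0 \<le> T" "T \<in> \<rat>"
    using T0[OF \<open>T0 \<le> T\<close>] by (auto simp: p_def flow_def y_def T_def)
  \<comment> \<open>Irreducibility is put into the chained relation because every step needs it at
    its own start, where the preceding equivalence supplies it.\<close>
  have "irr (p 0) \<longrightarrow> eqv (p 0) (p T)"
  proof (rule local_chain[where D = \<rat>, OF T(2) _ T(3)])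
    fix x y :: real assume "x < y"
    then show "\<exists>d\<in>\<rat>. x < d \<and> d < y" using Rats_dense_in_real by blast
  next
    fix x y z
    assume "irr (p x) \<longrightarrow> eqv (p x) (p y)" "irr (p y) \<longrightarrow> eqv (p y) (p z)"
    then show "irr (p x) \<longrightarrow> eqv (p x) (p z)" using irreducible_pt_cong ce_trans by metis
  next
    fix t0
    have "\<forall>\<^sub>F t in nhds t0. \<forall>h\<in>H. h (p t0) \<noteq> 0 \<longrightarrow> 0 < h (p t) * h (p t0)"
      unfolding p_def by (rule eventually_same_side[OF fin flow_continuous])
    then obtain d where d: "d > 0" "\<And>t h. \<bar>t - t0\<bar> < d \<Longrightarrow> h \<in> H \<Longrightarrow> h (p t0) \<noteq> 0 \<Longrightarrow> 0 < h (p t) * h (p t0)"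
      unfolding eventually_nhds_metric dist_real_def by blast
    have same: "0 < h (p t) * h (p s)" if "\<bar>t - t0\<bar> < d" "\<bar>s - t0\<bar> < d" "h \<in> H" "h (p t0) \<noteq> 0" for t s h
      using d(2)[OF that(1,3,4)] d(2)[OF that(2,3,4)] by (auto simp: zero_less_mult_iff)
    have "eqv (p s) (p t)" if st: "s \<in> \<rat>" "t \<in> \<rat>" "s \<le> t" "\<bar>s - t0\<bar> < d" "\<bar>t - t0\<bar> < d" "irr (p s)" for s t
    proof (cases "\<exists>h\<in>H. splits h (p s) (p t)")
      case False
      then have "additive H w w' (p s) (p t)" by (auto simp: additive_def)
      then show ?thesis using ce_additive preg st by metis
    next
      case True
      then obtain h where h: "h \<in> H" "splits h (p s) (p t)" by blast
      have zero: "h' (p t0) = 0" if "h' \<in> H" "splits h' (p s) (p t)" for h'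
        using same[OF st(4,5) that(1)] that(2) by (auto simp: splits_def)
      have adj: "adjacent H h (p s) (p t)"
        unfolding adjacent_def using h zero single[of h _ t0] by blast
      show ?thesis
      proof (rule adjacent_step[OF preg[OF st(1)] preg[OF st(2)] h(1) adj st(6)])
        assume ni: "\<not> invariant_wall w h" and nw: "\<not> splits h (p s) (w (p s))"
          and nw': "\<not> splits h (p s) (w' (p s))"
        \<comment> \<open>If this vanished, the pulled-back form would vanish at \<open>p t0\<close>
          together with \<open>h\<close>; as only one hyperplane passes through that point, the wall
          would be invariant.\<close>
        have wz: "h (w (p t0)) \<noteq> 0"
          using single[OF h(1) form_w[OF h(1)] zero[OF h]] ni unfolding invariant_wall_def by metis
        have w'z: "h (w' (p t0)) \<noteq> 0"
          using single[OF h(1) form_w'[OF h(1)] zero[OF h]] ni invariant_wall_w'[OF h(1)] by metis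
        have hs: "h (p s) \<noteq> 0" using preg[OF st(1)] h(1) by (auto simp: regular_def)
        \<comment> \<open>On the whole interval both images stay on the side of \<open>p s\<close>.
          Hence the derivative of \<open>h (p s) * h (p z)\<close> is positive wherever this product
          vanishes, and it cannot go from positive to negative.\<close>
        have sw: "0 < h (w (p z)) * h (p s)" "0 < h (w' (p z)) * h (p s)" if "s \<le> z" "z \<le> t" for z
        proof -
          have zd: "\<bar>z - t0\<bar> < d" using that st by linarith
          show "0 < h (w (p z)) * h (p s)"
            using same[OF zd st(4) form_w[OF h(1)] wz] nw hs
            by (auto simp: splits_def zero_less_mult_iff not_less zero_le_mult_iff)
          show "0 < h (w' (p z)) * h (p s)"
            using same[OF zd st(4) form_w'[OF h(1)] w'z] nw' hs
            by (auto simp: splits_def zero_less_mult_iff not_less zero_le_mult_iff)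
        qed
        have "s \<noteq> t" using h(2) by (auto simp: splits_def mult_less_0_iff)
        then have "s < t" using st(3) by simp
        moreover have "0 < h (p s) * h (p s)" using hs by (metis not_real_square_gt_zero)
        moreover have "h (p s) * h (p t) < 0" using h(2) by (simp add: splits_def)
        moreover have "((\<lambda>z. h (p s) * h (p z)) has_real_derivative
            h (p s) * (h (w (p z)) + h (w' (p z)) - 2 * h (p z))) (at z)" for z
          unfolding p_def by (rule DERIV_cmult[OF flow_deriv[OF h(1)]])
        moreover have "0 < h (p s) * (h (w (p z)) + h (w' (p z)) - 2 * h (p z))"
          if "s \<le> z" "z \<le> t" "h (p s) * h (p z) = 0" for z
          using sw[OF that(1,2)] that(3) hs by (simp add: algebra_simps)
        ultimately show False by (rule no_downcrossing)
      qed
    qed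
    then show "\<exists>d>0. \<forall>x\<in>\<rat>. \<forall>y\<in>\<rat>. 0 \<le> x \<longrightarrow> x \<le> y \<longrightarrow> y \<le> T \<longrightarrow> \<bar>x - t0\<bar> < d \<longrightarrow> \<bar>y - t0\<bar> < d \<longrightarrow>
        irr (p x) \<longrightarrow> eqv (p x) (p y)"
      using d(1) by blast
  qed simp
  moreover have "p 0 = x" by (simp add: p_def flow_def R_def sum_Pr)
  ultimately have "eqv x (p T)" using irreducible_pt_cong[OF ax a(2)] by simp
  then show ?thesis using \<open>generic y\<close> T(1) ce_trans[OF ax] by blast
qed

end

section \<open>Comparison of good alcoves\<close>

lemma pos_mult_trans: "0 < a * c \<Longrightarrow> 0 < b * c \<Longrightarrow> 0 < a * b" for a b c :: real
  unfolding zero_less_mult_iff by linarith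

lemma scaled_square_nonneg: "0 < c \<Longrightarrow> \<not> a * (c * a) < 0" for a c :: real
proof -
  assume "0 < c"
  then have "0 \<le> c * (a * a)" by (rule mult_nonneg_nonneg[OF less_imp_le zero_le_square])
  also have "\<dots> = a * (c * a)" by simp
  finally show ?thesis by linarith
qed

lemma pos_mult_opp: "0 < b * c \<Longrightarrow> a * b < 0 \<Longrightarrow> 0 < a * - c" for a b c :: real
  unfolding zero_less_mult_iff mult_less_0_iff by linarith

context periodic_arrangement
begin

text \<open>\<open>w\<close> and its inverse in coordinates about \<open>center\<close>, here as
  honest maps and not merely up to root pairings.\<close>

definition we :: "'a \<Rightarrow> 'a" where "we y = L y + drift"
definition we' :: "'a \<Rightarrow> 'a" where "we' y = L' (y - drift)"

lemma we_we' [simp]: "we (we' y) = y" by (simp add: we_def we'_def)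

lemma Pr2_drift [simp]: "Pr 2 drift = drift"
  by (simp add: drift_def Pr_idem two_in_E)

lemma Pr_drift: "\<mu> \<noteq> 2 \<Longrightarrow> Pr \<mu> drift = 0"
  by (simp add: drift_def Pr_orth)

lemma L'_Pr2: "L' (Pr 2 y) = Pr 2 y"
  by (metis L'L L_Pr2)

lemma Pr2_we: "Pr 2 (we y) = Pr 2 y + drift"
  by (simp add: we_def linear_add[OF linear_Pr] flip: L_Pr) (simp add: L_Pr2)

lemma Pr2_we': "Pr 2 (we' y) = Pr 2 y - drift"
  by (simp add: we'_def linear_diff[OF linear_Pr] linear_diff[OF linear_L'] flip: L'_Pr)
    (simp add: L'_Pr2)

text \<open>The choice made in \<open>lead\<close> is equivariant. Its branch depends on whether the
  form is constant on \<open>center\<close> plus the range of \<open>Pr 2\<close>, a set matched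
  with itself by the action; in the second branch this constancy makes \<open>drift\<close>
  invisible, and the leading eigenvalue is unchanged because the projections commute with
  \<open>L\<close>.\<close>

lemma lead_w:
  assumes a: "\<alpha> \<in> \<Phi>" and b: "\<And>x. \<beta> \<bullet> x = \<alpha> \<bullet> L x" and n: "\<alpha> \<bullet> lam = of_int n"
  shows "lead \<beta> (k - n) y = lead \<alpha> k (we y)"
proof -
  have first: "\<beta> \<bullet> (center + Pr 2 u) - of_int (k - n) = \<alpha> \<bullet> (center + Pr 2 (we u)) - of_int k" for u
  proof -
    have "L (center + Pr 2 u) + lam = center + Pr 2 (we u)"
      using L_center by (simp add: Pr2_we linear_add[OF lin] L_Pr2 add.commute add.left_commute)
    then have "\<alpha> \<bullet> L (center + Pr 2 u) + \<alpha> \<bullet> lam = \<alpha> \<bullet> (center + Pr 2 (we u))"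
      by (metis inner_add_right)
    then show ?thesis by (simp add: b n)
  qed
  have cond: "(\<exists>x. \<beta> \<bullet> (center + Pr 2 x) \<noteq> of_int (k - n)) \<longleftrightarrow> (\<exists>x. \<alpha> \<bullet> (center + Pr 2 x) \<noteq> of_int k)"
  proof -
    have "\<beta> \<bullet> (center + Pr 2 x) \<noteq> of_int (k - n) \<longleftrightarrow> \<alpha> \<bullet> (center + Pr 2 (we x)) \<noteq> of_int k" for x
      using first[of x] by linarith
    then show ?thesis by (metis we_we')
  qed
  have bP: "\<beta> \<bullet> Pr \<mu> x = \<alpha> \<bullet> Pr \<mu> (L x)" for \<mu> x by (simp add: b L_Pr)
  have "(\<exists>x. \<beta> \<bullet> Pr \<mu> x \<noteq> 0) \<longleftrightarrow> (\<exists>x. \<alpha> \<bullet> Pr \<mu> x \<noteq> 0)" for \<mu>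
    unfolding bP by (metis LL')
  then have top: "top_eig \<beta> = top_eig \<alpha>" by (simp add: top_eig_def)
  show ?thesis
  proof (cases "\<exists>x. \<alpha> \<bullet> (center + Pr 2 x) \<noteq> of_int k")
    case True
    then show ?thesis using cond first by (simp add: lead_def)
  next
    case False
    have "\<alpha> \<bullet> Pr 2 drift = 0"
      using False[simplified, rule_format, of 0] False[simplified, rule_format, of drift]
      by (simp add: linear_0[OF linear_Pr] inner_add_right)
    then have "\<alpha> \<bullet> Pr \<mu> drift = 0" for \<mu> by (cases "\<mu> = 2") (auto simp: Pr_drift)
    then have "\<alpha> \<bullet> Pr \<mu> (we y) = \<beta> \<bullet> Pr \<mu> y" for \<mu>
      by (simp add: bP we_def linear_add[OF linear_Pr] inner_add_right)
    then show ?thesis using False cond unfolding lead_def top by simp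
  qed
qed

lemma good_w:
  assumes "good a y" shows "good (w a) (we y)"
  unfolding good_def
proof (intro ballI allI)
  fix \<alpha> k assume a: "\<alpha> \<in> \<Phi>"
  obtain \<beta> where b: "\<beta> \<in> \<Phi>" "\<And>x. \<beta> \<bullet> x = \<alpha> \<bullet> L x" using pull[OF a] by blast
  obtain n where n: "\<alpha> \<bullet> lam = of_int n" using lam_int[OF a] by (auto elim: Ints_cases)
  have "\<alpha> \<bullet> w a - of_int k = \<beta> \<bullet> a - of_int (k - n)" by (simp add: w[OF a] b(2) inner_add_right n)
  then show "0 < (\<alpha> \<bullet> w a - of_int k) * lead \<alpha> k (we y)"
    using assms b(1) unfolding good_def lead_w[OF a b(2) n, symmetric] by metis
qed

lemma good_w':
  assumes "good a y" shows "good (w' a) (we' y)"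
  unfolding good_def
proof (intro ballI allI)
  fix \<alpha> k assume a: "\<alpha> \<in> \<Phi>"
  obtain \<beta> where b: "\<beta> \<in> \<Phi>" "\<And>x. \<beta> \<bullet> x = \<alpha> \<bullet> L' x" using pull'[OF a] by blast
  obtain n where n: "\<beta> \<bullet> lam = of_int n" using lam_int[OF b(1)] by (auto elim: Ints_cases)
  have "\<alpha> \<bullet> x = \<beta> \<bullet> L x" for x by (simp add: b(2))
  from lead_w[OF b(1) this n, of "k + n" "we' y"] have "lead \<alpha> k (we' y) = lead \<beta> (k + n) y" by simp
  moreover have "\<alpha> \<bullet> w' a - of_int k = \<beta> \<bullet> a - of_int (k + n)"
    by (simp add: w'[OF a] inner_diff_right n flip: b(2))
  ultimately show "0 < (\<alpha> \<bullet> w' a - of_int k) * lead \<alpha> k (we' y)"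
    using assms b(1) unfolding good_def by metis
qed

text \<open>For the limit forms the eigenvalue is 2, because the two drifts cancel; for the others
  it is inherited from the projection. At a zero of \<open>g\<close> it gives opposite values at
  \<open>we q\<close> and \<open>we' q\<close>.\<close>

lemma lead_funs_eig:
  assumes "g \<in> lead_funs"
  shows "\<exists>\<mu>. \<forall>y. g (we y) + g (we' y) = \<mu> * g y"
  using assms unfolding lead_funs_def
proof (elim UnE imageE, goal_cases)
  case (1 p)
  obtain \<alpha> and k :: int where "p = (\<alpha>, k)" by (cases p)
  with 1 show ?case by (intro exI[of _ 2]) (simp add: Pr2_we Pr2_we' inner_simps)
next
  case (2 p)
  obtain \<alpha> \<mu> where p: "p = (\<alpha>, \<mu>)" by (cases p)
  have "\<alpha> \<bullet> Pr \<mu> (we y) + \<alpha> \<bullet> Pr \<mu> (we' y) = \<mu> * (\<alpha> \<bullet> Pr \<mu> y)" for y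
  proof -
    have "Pr \<mu> (we y) + Pr \<mu> (we' y) = Pr \<mu> (L y) + Pr \<mu> (L' y)"
      by (simp add: we_def we'_def linear_add[OF linear_Pr] linear_diff[OF linear_Pr] linear_diff[OF linear_L'])
    also have "\<dots> = \<mu> *\<^sub>R Pr \<mu> y" using eig[of \<mu> y] by (simp add: L_Pr L'_Pr)
    finally show ?thesis by (simp flip: inner_add_right)
  qed
  with 2 p show ?case by auto
qed

lemma lead_we_in:
  assumes "\<alpha> \<in> \<Phi>" shows "(\<lambda>y. lead \<alpha> k (we y)) \<in> lead_funs"
proof -
  obtain \<beta> where b: "\<beta> \<in> \<Phi>" "\<And>x. \<beta> \<bullet> x = \<alpha> \<bullet> L x" using pull[OF assms] by blast
  obtain n where n: "\<alpha> \<bullet> lam = of_int n" using lam_int[OF assms] by (auto elim: Ints_cases)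
  have "(\<lambda>y. lead \<alpha> k (we y)) = lead \<beta> (k - n)"
    using lead_w[OF assms b(2) n] by (simp add: fun_eq_iff)
  then show ?thesis using lead_in[OF b(1)] by simp
qed

lemma lead_we'_in:
  assumes "\<alpha> \<in> \<Phi>" shows "(\<lambda>y. lead \<alpha> k (we' y)) \<in> lead_funs"
proof -
  obtain \<beta> where b: "\<beta> \<in> \<Phi>" "\<And>x. \<beta> \<bullet> x = \<alpha> \<bullet> L' x" using pull'[OF assms] by blast
  obtain n where n: "\<beta> \<bullet> lam = of_int n" using lam_int[OF b(1)] by (auto elim: Ints_cases)
  have "\<alpha> \<bullet> x = \<beta> \<bullet> L x" for x by (simp add: b(2))
  from lead_w[OF b(1) this n, of "k + n"] have "(\<lambda>y. lead \<alpha> k (we' y)) = lead \<beta> (k + n)"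
    by (simp add: fun_eq_iff)
  then show ?thesis using lead_in[OF b(1)] by simp
qed

lemma good_same_side:
  assumes "good a y1" "good b y2" "\<And>\<alpha> k. \<alpha> \<in> \<Phi> \<Longrightarrow> 0 < lead \<alpha> k y1 * lead \<alpha> k y2"
  shows "eqv a b"
proof (rule same_side_eqv[OF good_regular[OF assms(1)]])
  fix h assume "h \<in> H"
  then obtain \<alpha> k where h: "h = (\<lambda>x. \<alpha> \<bullet> x - of_int k)" "\<alpha> \<in> \<Phi>" by (rule affine_formsE)
  have ha: "0 < h a * lead \<alpha> k y1" and hb: "0 < h b * lead \<alpha> k y2"
    using assms(1,2) h(2) unfolding good_def h(1) by blast+
  have "0 < lead \<alpha> k y2 * lead \<alpha> k y1" using assms(3)[OF h(2), of k] by (simp only: mult.commute)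
  then show "0 < h b * h a" by (rule pos_mult_trans[OF hb pos_mult_trans[OF ha]])
qed

lemma good_exists: "generic y \<Longrightarrow> \<exists>a. good a y"
  using eventually_happens'[OF trivial_limit_at_top_linorder eventually_good] by blast

text \<open>-2 is the least possible eigenvalue, so nothing is left below the leading
  component.\<close>

lemma minus2_form:
  assumes "\<alpha> \<in> \<Phi>" "top_eig \<alpha> = -2"
  shows "\<alpha> \<bullet> u = \<alpha> \<bullet> Pr (-2) u"
proof -
  define r where "r = \<alpha> \<bullet> Pr (-2) u"
  have "\<alpha> \<bullet> Pr \<mu> u = (if \<mu> = -2 then r else 0)" if "\<mu> \<in> E" for \<mu>
    using top_eig(3)[OF assms(1) that, of u] E_ge[OF that] assms(2) by (auto simp: r_def)
  then have "(\<Sum>\<mu>\<in>E. \<alpha> \<bullet> Pr \<mu> u) = r"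
    using finite_E top_eig(1)[OF assms(1)] assms(2) by simp
  then show ?thesis by (simp add: sum_Pr r_def flip: inner_sum_right)
qed

text \<open>The only way \<open>w\<close> can reverse a wall through a generic crossing point.\<close>

lemma reversed_wall:
  assumes a: "\<alpha> \<in> \<Phi>" and c: "c < 0" "\<And>y. lead \<alpha> k (we y) = c * lead \<alpha> k y"
    and q: "lead \<alpha> k q = 0"
  shows "top_eig \<alpha> = -2" "lead \<alpha> k = (\<lambda>y. \<alpha> \<bullet> y)" "\<alpha> \<bullet> center = of_int k"
    "\<And>x. \<alpha> \<bullet> w x - of_int k = - (\<alpha> \<bullet> x - of_int k)"
proof -
  define \<tau> where "\<tau> = top_eig \<alpha>"
  \<comment> \<open>Otherwise \<open>we\<close> merely adds the constant
    \<open>\<alpha> \<bullet> drift\<close> to the leading form. The zero \<open>q\<close> shows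
    that the constant is 0, and then a negative factor \<open>c\<close> kills the form
    altogether.\<close>
  have lev: "\<alpha> \<bullet> (center + Pr 2 x) = of_int k" for x
  proof (rule ccontr)
    assume n: "\<not> ?thesis"
    then have l: "lead \<alpha> k = (\<lambda>y. \<alpha> \<bullet> (center + Pr 2 y) - of_int k)" by (auto simp: lead_def)
    have "lead \<alpha> k (we y) = lead \<alpha> k y + \<alpha> \<bullet> drift" for y by (simp add: l Pr2_we inner_simps)
    then have *: "(c - 1) * lead \<alpha> k y = \<alpha> \<bullet> drift" for y using c(2)[of y] by (simp add: algebra_simps)
    from *[of q] q have "\<alpha> \<bullet> drift = 0" by simp
    then have "lead \<alpha> k x = 0" using *[of x] c(1) by simp
    then show False using n by (simp add: l)
  qed
  then have l: "lead \<alpha> k = (\<lambda>y. \<alpha> \<bullet> Pr \<tau> y)" by (simp add: lead_def \<tau>_def)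
  show ac: "\<alpha> \<bullet> center = of_int k" using lev[of 0] by (simp add: linear_0[OF linear_Pr])
  have a2: "\<alpha> \<bullet> Pr 2 x = 0" for x using lev[of x] ac by (simp add: inner_add_right)
  then have ad: "\<alpha> \<bullet> Pr \<mu> drift = 0" for \<mu> by (cases "\<mu> = 2") (use a2 in \<open>auto simp: Pr_drift simp del: Pr2_drift\<close>)
  have cL: "\<alpha> \<bullet> Pr \<tau> (L y) = c * (\<alpha> \<bullet> Pr \<tau> y)" for y
    using c(2)[of y] ad[of \<tau>] by (simp add: l we_def linear_add[OF linear_Pr] inner_add_right)
  have cn: "\<alpha> \<bullet> Pr \<tau> ((L ^^ n) y) = c ^ n * (\<alpha> \<bullet> Pr \<tau> y)" for n y
    by (induction n) (simp_all add: cL)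
  obtain u where u: "\<alpha> \<bullet> Pr \<tau> u \<noteq> 0" using top_eig(2)[OF a] unfolding \<tau>_def by blast
  \<comment> \<open>The leading form is an eigenform of \<open>L\<close> with real factor
    \<open>c\<close>, and \<open>L\<close> has finite order; being negative, \<open>c\<close> is
    -1.\<close>
  have "c ^ N = 1" using cn[of N u] u by (simp add: LN)
  then have "\<bar>c\<bar> ^ N = 1" by (simp flip: power_abs)
  then have "\<bar>c\<bar> = 1" using Npos power_eq_iff_eq_base[of N "\<bar>c\<bar>" 1] by simp
  then have c1: "c = -1" using c(1) by simp
  have cL': "\<alpha> \<bullet> Pr \<tau> (L' y) = - (\<alpha> \<bullet> Pr \<tau> y)" for y using cL[of "L' y"] c1 by simp
  have "\<tau> * (\<alpha> \<bullet> Pr \<tau> u) = \<alpha> \<bullet> (L (Pr \<tau> u) + L' (Pr \<tau> u))" by (simp add: eig)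
  also have "\<dots> = -2 * (\<alpha> \<bullet> Pr \<tau> u)" by (simp add: L_Pr L'_Pr inner_add_right cL cL' c1)
  finally have \<tau>2: "\<tau> = -2" using mult_right_cancel[OF u] by blast
  then show t2: "top_eig \<alpha> = -2" by (simp add: \<tau>_def)
  show l2: "lead \<alpha> k = (\<lambda>y. \<alpha> \<bullet> y)"
    unfolding l \<tau>2 using minus2_form[OF a t2] by (simp add: fun_eq_iff)
  fix x
  define y where "y = x - center"
  have x: "x = center + y" by (simp add: y_def)
  have "\<alpha> \<bullet> w x = of_int k + (\<alpha> \<bullet> L y + \<alpha> \<bullet> drift)" unfolding x w_center[OF a] by (simp add: inner_add_right ac)
  also have "\<alpha> \<bullet> drift = 0" using ad[of 2] by simp
  also have "\<alpha> \<bullet> L y = - (\<alpha> \<bullet> y)"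
    using cL[of y] c1 minus2_form[OF a t2, of y] minus2_form[OF a t2, of "L y"] unfolding \<tau>2 by simp
  finally show "\<alpha> \<bullet> w x - of_int k = - (\<alpha> \<bullet> x - of_int k)" by (simp add: x inner_add_right ac)
qed

text \<open>Proportional leading forms do not in general come from the same hyperplane. Here they
  do: a vector with eigenvalue -2 distinguishes \<alpha> from every form with another leading
  eigenvalue or with nonconstant values at the limit, and at -2 the leading form is the whole
  root.\<close>

lemma proportional_to_reversed:
  assumes a: "\<alpha> \<in> \<Phi>" "top_eig \<alpha> = -2" "lead \<alpha> k = (\<lambda>y. \<alpha> \<bullet> y)" "\<alpha> \<bullet> center = of_int k"
    and b: "\<beta> \<in> \<Phi>" and c: "c \<noteq> 0" "\<And>u. lead \<beta> l u = c * lead \<alpha> k u"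
  shows "\<beta> \<bullet> x - of_int l = c * (\<alpha> \<bullet> x - of_int k)"
proof -
  obtain u0 where u0: "\<alpha> \<bullet> Pr (-2) u0 \<noteq> 0" using top_eig(2)[OF a(1)] a(2) by auto
  have l0: "lead \<beta> l 0 = 0" using c(2)[of 0] by (simp add: a(3))
  have l1: "lead \<beta> l (Pr (-2) u0) \<noteq> 0" using c(2)[of "Pr (-2) u0"] c(1) u0 by (simp add: a(3))
  have lev: "\<beta> \<bullet> (center + Pr 2 x) = of_int l" for x
  proof (rule ccontr)
    assume "\<not> ?thesis"
    then have l: "lead \<beta> l = (\<lambda>y. \<beta> \<bullet> (center + Pr 2 y) - of_int l)" by (auto simp: lead_def)
    have "Pr 2 (Pr (-2) u0) = Pr 2 0" by (simp add: Pr_orth linear_0[OF linear_Pr])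
    then show False using l0 l1 by (simp add: l)
  qed
  then have l: "lead \<beta> l = (\<lambda>y. \<beta> \<bullet> Pr (top_eig \<beta>) y)" by (simp add: lead_def)
  have "top_eig \<beta> = -2"
  proof (rule ccontr)
    assume "top_eig \<beta> \<noteq> -2"
    then show False using l1 by (simp add: l Pr_orth)
  qed
  then have "\<beta> \<bullet> u = lead \<beta> l u" for u using minus2_form[OF b, of u] by (simp add: l)
  then have bu: "\<beta> \<bullet> u = c * (\<alpha> \<bullet> u)" for u using c(2)[of u] by (simp add: a(3))
  have "\<beta> \<bullet> center = of_int l" using lev[of 0] by (simp add: linear_0[OF linear_Pr])
  then have "of_int l = c * of_int k" using bu[of center] a(4) by simp
  then show ?thesis using bu[of x] by (simp add: algebra_simps)
qed

text \<open>The equation says that \<open>g1\<close> and \<open>g2\<close> vanish at the same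
  parameter of the line through \<open>y\<close> and \<open>x\<close>; this shall happen only to
  proportional forms.\<close>

definition pair_generic :: "'a \<Rightarrow> 'a \<Rightarrow> bool" where
  "pair_generic y x \<longleftrightarrow> (\<forall>g1\<in>lead_funs. \<forall>g2\<in>lead_funs.
     g1 y * g2 x = g2 y * g1 x \<longrightarrow> (\<forall>u. g1 y * g2 u = g2 y * g1 u))"

text \<open>At a crossing point \<open>q\<close> all leading forms that vanish are proportional to a single \<open>g0\<close>, and
  \<open>g0 (we q) + g0 (we' q)\<close> is a multiple of \<open>g0 q = 0\<close>: so \<open>we q\<close> and \<open>we' q\<close> lie on
  opposite sides of the wall, or the wall is preserved.\<close>

lemma crossing:
  assumes yst: "generic ys" "generic yt" and ab: "good a ys" "good b yt"
    and near: "\<And>g. g \<in> lead_funs \<Longrightarrow> g q \<noteq> 0 \<Longrightarrow> 0 < g ys * g q \<and> 0 < g yt * g q"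
    and propor: "\<And>g g'. g \<in> lead_funs \<Longrightarrow> g' \<in> lead_funs \<Longrightarrow> g q = 0 \<Longrightarrow> g' q = 0 \<Longrightarrow>
        \<exists>x. g x \<noteq> 0 \<Longrightarrow> \<exists>x. g' x \<noteq> 0 \<Longrightarrow> \<exists>c. c \<noteq> 0 \<and> (\<forall>u. g' u = c * g u)"
  shows "eqv a b"
proof (cases "\<forall>\<alpha>\<in>\<Phi>. \<forall>k. 0 < lead \<alpha> k ys * lead \<alpha> k yt")
  case True
  then show ?thesis using good_same_side[OF ab] by blast
next
  case False
  then obtain \<alpha>0 k0 where a0: "\<alpha>0 \<in> \<Phi>" and n0: "\<not> 0 < lead \<alpha>0 k0 ys * lead \<alpha>0 k0 yt" by blast
  define g0 where "g0 = lead \<alpha>0 k0"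
  have g0in: "g0 \<in> lead_funs" unfolding g0_def by (rule lead_in[OF a0])
  have g0nz: "\<exists>x. g0 x \<noteq> 0" unfolding g0_def by (rule lead_nz[OF a0])
  have nzst: "g0 ys \<noteq> 0" "g0 yt \<noteq> 0"
    using generic_lead[OF yst(1) a0] generic_lead[OF yst(2) a0] by (auto simp: g0_def)
  have opp: "g0 ys * g0 yt < 0" using n0 nzst unfolding g0_def by (metis linorder_neqE_linordered_idom mult_eq_0_iff)
  have q0: "g0 q = 0"
  proof (rule ccontr)
    assume "g0 q \<noteq> 0"
    then show False using near[OF g0in] opp unfolding zero_less_mult_iff mult_less_0_iff by linarith
  qed
  have reg: "regular H a" "regular H b" using ab good_regular by auto
  have wa: "good (w a) (we ys)" "good (w' a) (we' ys)" "good (w b) (we yt)" "good (w' b) (we' yt)"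
    using ab good_w good_w' by auto
  have sgn: "splits h u v \<longleftrightarrow> lead \<alpha> k yu * lead \<alpha> k yv < 0"
    if "h = (\<lambda>x. \<alpha> \<bullet> x - of_int k)" "\<alpha> \<in> \<Phi>" "good u yu" "good v yv" for h \<alpha> k u v yu yv
  proof -
    have "0 < h u * lead \<alpha> k yu" "0 < h v * lead \<alpha> k yv"
      using that unfolding good_def that(1) by blast+
    then show ?thesis unfolding splits_def zero_less_mult_iff mult_less_0_iff by linarith
  qed
  have wall: "\<exists>\<alpha> k c. h = (\<lambda>x. \<alpha> \<bullet> x - of_int k) \<and> \<alpha> \<in> \<Phi> \<and> c \<noteq> 0 \<and> (\<forall>u. lead \<alpha> k u = c * g0 u)"
    if hh: "h \<in> H" "splits h a b" for h
  proof -
    obtain \<alpha> k where h: "h = (\<lambda>x. \<alpha> \<bullet> x - of_int k)" "\<alpha> \<in> \<Phi>" using hh(1) by (auto simp: affine_forms_def)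
    have "lead \<alpha> k ys * lead \<alpha> k yt < 0" using sgn[OF h ab] hh by simp
    then have "lead \<alpha> k q = 0"
      using near[OF lead_in[OF h(2)], of k] unfolding zero_less_mult_iff mult_less_0_iff by linarith
    then show ?thesis
      using propor[OF g0in lead_in[OF h(2)] q0 _ g0nz lead_nz[OF h(2)], of k] h by blast
  qed
  \<comment> \<open>All walls between \<open>a\<close> and \<open>b\<close> have leading forms
    proportional to \<open>g0\<close>, and the square \<open>c * c\<close> removes the orientation;
    \<open>g0\<close> alone decides every separation in question.\<close>
  have split_w: "splits h u v \<longleftrightarrow> g0 yu * g0 yv < 0"
    if "h \<in> H" "splits h a b" "good u yu" "good v yv" for h u v yu yv
  proof -
    obtain \<alpha> k c where h: "h = (\<lambda>x. \<alpha> \<bullet> x - of_int k)" "\<alpha> \<in> \<Phi>" "c \<noteq> 0" "\<forall>u. lead \<alpha> k u = c * g0 u"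
      using wall[OF \<open>h \<in> H\<close> \<open>splits h a b\<close>] by blast
    have "splits h u v \<longleftrightarrow> (c * c) * (g0 yu * g0 yv) < 0"
      using sgn[OF h(1,2) \<open>good u yu\<close> \<open>good v yv\<close>] h(4) by (simp add: mult_ac)
    moreover have "0 < c * c" using h(3) by (metis not_real_square_gt_zero)
    ultimately show ?thesis by (simp add: mult_less_0_iff)
  qed
  have addI: "eqv a b" if "\<not> g0 yt * g0 (we yt) < 0" "\<not> g0 ys * g0 (we' ys) < 0"
    using that split_w ab wa reg by (intro ce_additive) (auto simp: additive_def)
  have addI': "eqv a b" if "\<not> g0 ys * g0 (we ys) < 0" "\<not> g0 yt * g0 (we' yt) < 0"
  proof -
    have "additive H w w' b a"
      unfolding additive_def using that split_w ab wa splits_sym by metis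
    then show ?thesis using ce_additive reg ce_sym by metis
  qed
  have gw: "(\<lambda>y. g0 (we y)) \<in> lead_funs" "(\<lambda>y. g0 (we' y)) \<in> lead_funs"
    unfolding g0_def by (rule lead_we_in[OF a0], rule lead_we'_in[OF a0])
  obtain \<mu> where "\<forall>y. g0 (we y) + g0 (we' y) = \<mu> * g0 y" using lead_funs_eig[OF g0in] by blast
  then have e: "g0 (we' q) = - g0 (we q)" using q0 by (metis add_eq_0_iff mult_zero_right)
  show ?thesis
  proof (cases "g0 (we q) = 0")
    case False
    \<comment> \<open>Near \<open>q\<close> the images under \<open>we\<close> lie on the side of
      \<open>we q\<close>, those under \<open>we'\<close> on the other. Which of \<open>yt\<close>
      and \<open>ys\<close> is on the side of \<open>we q\<close> fixes the direction in which the
      step is additive.\<close>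
    have n1: "0 < g0 (we ys) * g0 (we q)" "0 < g0 (we yt) * g0 (we q)" using near[OF gw(1) False] by auto
    have n2: "0 < g0 (we' ys) * - g0 (we q)" "0 < g0 (we' yt) * - g0 (we q)"
      using near[OF gw(2)] False unfolding e by auto
    show ?thesis
    proof (cases "0 < g0 yt * g0 (we q)")
      case True
      then have "0 < g0 ys * - g0 (we q)" using opp by (rule pos_mult_opp)
      then have "0 < g0 yt * g0 (we yt)" "0 < g0 ys * g0 (we' ys)"
        using pos_mult_trans[OF True n1(2)] pos_mult_trans[OF _ n2(1)] by blast+
      then show ?thesis using addI by (meson less_asym)
    next
      case F: False
      have "g0 yt * g0 (we q) \<noteq> 0" using nzst(2) False by simp
      then have t: "0 < g0 yt * - g0 (we q)" using F by (simp add: not_less order.strict_iff_order)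
      then have "0 < g0 ys * - (- g0 (we q))" using opp by (rule pos_mult_opp)
      then have "0 < g0 ys * g0 (we ys)" "0 < g0 yt * g0 (we' yt)"
        using pos_mult_trans[OF _ n1(1)] pos_mult_trans[OF t n2(2)] by auto
      then show ?thesis using addI' by (meson less_asym)
    qed
  next
    \<comment> \<open>Now \<open>we\<close> preserves the zero set of \<open>g0\<close>. A positive
      factor keeps the sides, and the step is additive; a negative one exchanges them, and the
      crossing is a reflection commuting with \<open>w\<close>.\<close>
    case True
    have "\<exists>x. g0 (we x) \<noteq> 0" using g0nz by (metis we_we')
    then obtain c where c: "c \<noteq> 0" "\<And>u. g0 (we u) = c * g0 u"
      using propor[OF g0in gw(1) q0 True g0nz] by blast
    have c': "g0 u = c * g0 (we' u)" for u using c(2)[of "we' u"] by simp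
    show ?thesis
    proof (cases "c > 0")
      case True
      have "\<not> g0 yt * g0 (we yt) < 0"
        using scaled_square_nonneg[OF True] c(2)[of yt] by metis
      moreover have "\<not> g0 ys * g0 (we' ys) < 0"
        using scaled_square_nonneg[OF True] c'[of ys] mult.commute by metis
      ultimately show ?thesis by (rule addI)
    next
      case False
      then have cneg: "c < 0" using c(1) by simp
      note rev = reversed_wall[OF a0 cneg c(2)[unfolded g0_def] q0[unfolded g0_def]]
      define h0 where "h0 = (\<lambda>x. \<alpha>0 \<bullet> x - of_int k0)"
      have h0H: "h0 \<in> H" using a0 unfolding h0_def affine_forms_def by blast
      have "splits h0 a b" using sgn[OF h0_def a0 ab] opp by (simp add: g0_def)
      moreover have "h = h0 \<or> h = (\<lambda>x. - h0 x)" if hh: "h \<in> H" "splits h a b" for h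
      proof -
        obtain \<alpha> k c where h: "h = (\<lambda>x. \<alpha> \<bullet> x - of_int k)" "\<alpha> \<in> \<Phi>" "c \<noteq> 0" "\<forall>u. lead \<alpha> k u = c * g0 u"
          using wall[OF hh] by blast
        have "h x = c * h0 x" for x
          unfolding h(1) h0_def
          by (rule proportional_to_reversed[OF a0 rev(1,2,3) h(2,3)]) (simp add: h(4) g0_def)
        then show ?thesis using forms_proportional[OF h0H hh(1)] by blast
      qed
      ultimately have "adjacent H h0 a b" unfolding adjacent_def by blast
      moreover have "invariant_wall w h0" unfolding invariant_wall_def h0_def using rev(4) by blast
      ultimately show ?thesis using ce_wall[OF reg h0H] by blast
    qed
  qed
qed

section \<open>Segments in the space of limit parameters\<close>

lemma lead_funs_segment:
  assumes "g \<in> lead_funs"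
  shows "g ((1 - s) *\<^sub>R y + s *\<^sub>R x) = (1 - s) * g y + s * g x"
proof -
  obtain l c where l: "linear l" "\<And>x. g x = l x + c"
    using affine_lead_funs[OF assms] unfolding affine_fun_def by auto
  have "g ((1 - s) *\<^sub>R y + s *\<^sub>R x) = (1 - s) * l y + s * l x + c"
    by (simp only: l(2) linear_add[OF l(1)] linear_scale[OF l(1)] real_scaleR_def)
  then show ?thesis by (simp add: l(2) algebra_simps)
qed

text \<open>The segment joins the parameters, not the alcoves; \<open>pt s\<close> picks any point
  of the alcove described by \<open>Y s\<close>, and these alcoves can be far apart in space for
  nearby \<open>s\<close> without harm, since \<open>crossing\<close> compares them through leading
  forms only.\<close>

lemma eqv_pair_generic:
  assumes gen: "generic y" "generic x" and pg: "pair_generic y x" and ab: "good a y" "good b x"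
  shows "eqv a b"
proof -
  define Y where "Y s = (1 - s) *\<^sub>R y + s *\<^sub>R x" for s
  have gY: "g (Y s) = (1 - s) * g y + s * g x" if "g \<in> lead_funs" for g s
    unfolding Y_def by (rule lead_funs_segment[OF that])
  define D where "D = {s. generic (Y s)}"
  define pt where "pt s = (SOME a. good a (Y s))" for s
  have pt: "good (pt s) (Y s)" if "s \<in> D" for s
    unfolding pt_def using good_exists[of "Y s"] that by (auto simp: D_def intro: someI_ex)
  have Y01: "Y 0 = y" "Y 1 = x" by (simp_all add: Y_def)
  have D01: "0 \<in> D" "1 \<in> D" using gen by (auto simp: D_def Y01)
  have "eqv (pt 0) (pt 1)"
  proof (rule local_chain[where R = "\<lambda>s t. eqv (pt s) (pt t)", OF _ D01])
    fix s t :: real assume "s < t"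
    \<comment> \<open>A leading form that is nonzero at \<open>y\<close> has at most one zero on the
      segment, and there are countably many forms; so \<open>D\<close> meets every open
      interval.\<close>
    have "- D \<subseteq> (\<Union>g\<in>{g\<in>lead_funs. g y \<noteq> 0}. {s. g (Y s) = 0})"
      using gen(1) unfolding D_def generic_def by fastforce
    moreover have "countable {s. g (Y s) = 0}" if g: "g \<in> lead_funs" "g y \<noteq> 0" for g
    proof -
      have "{s. g (Y s) = 0} \<subseteq> {g y / (g y - g x)}"
      proof safe
        fix s assume "g (Y s) = 0"
        then have e: "s * (g y - g x) = g y" using gY[OF g(1)] by (simp add: algebra_simps)
        then have "g y - g x \<noteq> 0" using g(2) by auto
        then show "s = g y / (g y - g x)" using e by (simp add: field_simps)
      qed
      then show ?thesis using countable_subset by blast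
    qed
    then have "countable (\<Union>g\<in>{g\<in>lead_funs. g y \<noteq> 0}. {s. g (Y s) = 0})"
      using countable_lead_funs by (intro countable_UN) auto
    ultimately have "countable (- D)" by (rule countable_subset)
    then have "\<not> {s<..<t} \<subseteq> - D"
      using uncountable_open_interval[of s t] \<open>s < t\<close> countable_subset by blast
    then show "\<exists>d\<in>D. s < d \<and> d < t" by auto
  next
    fix s0 :: real
    define q where "q = Y s0"
    have tg: "((\<lambda>s. g (Y s)) \<longlongrightarrow> g (Y s0)) (nhds s0)" if "g \<in> lead_funs" for g
      unfolding gY[OF that] by (intro tendsto_intros filterlim_ident)
    \<comment> \<open>Infinitely many leading forms arise from the integers \<open>k\<close>. They
      are forms of \<open>H\<close> at the point \<open>center + Pr 2 (Y s)\<close>, so local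
      finiteness handles them; the others are finite in number.\<close>
    have "\<forall>\<^sub>F s in nhds s0. \<forall>h\<in>H. h (center + Pr 2 q) \<noteq> 0 \<longrightarrow> 0 < h (center + Pr 2 (Y s)) * h (center + Pr 2 q)"
    proof (rule eventually_same_side[OF fin])
      fix \<alpha> assume "\<alpha> \<in> \<Phi>"
      then have "(\<lambda>y. \<alpha> \<bullet> (center + Pr 2 y) - of_int 0) \<in> lead_funs" unfolding lead_funs_def by force
      from tg[OF this] show "((\<lambda>s. \<alpha> \<bullet> (center + Pr 2 (Y s))) \<longlongrightarrow> \<alpha> \<bullet> (center + Pr 2 q)) (nhds s0)"
        by (simp add: q_def)
    qed
    moreover have "\<forall>\<^sub>F s in nhds s0. \<forall>(\<alpha>, \<mu>)\<in>\<Phi> \<times> E. \<alpha> \<bullet> Pr \<mu> q \<noteq> 0 \<longrightarrow> 0 < (\<alpha> \<bullet> Pr \<mu> (Y s)) * (\<alpha> \<bullet> Pr \<mu> q)"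
    proof (intro eventually_ball_finite)
      show "finite (\<Phi> \<times> E)" using fin finite_E by simp
      show "\<forall>p\<in>\<Phi> \<times> E. \<forall>\<^sub>F s in nhds s0. case p of (\<alpha>, \<mu>) \<Rightarrow> \<alpha> \<bullet> Pr \<mu> q \<noteq> 0 \<longrightarrow> 0 < (\<alpha> \<bullet> Pr \<mu> (Y s)) * (\<alpha> \<bullet> Pr \<mu> q)"
      proof safe
        fix \<alpha> \<mu> assume "\<alpha> \<in> \<Phi>" "\<mu> \<in> E"
        then have g: "(\<lambda>y. \<alpha> \<bullet> Pr \<mu> y) \<in> lead_funs" unfolding lead_funs_def by force
        show "\<forall>\<^sub>F s in nhds s0. \<alpha> \<bullet> Pr \<mu> q \<noteq> 0 \<longrightarrow> 0 < (\<alpha> \<bullet> Pr \<mu> (Y s)) * (\<alpha> \<bullet> Pr \<mu> q)"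
        proof (cases "\<alpha> \<bullet> Pr \<mu> q = 0")
          case False
          have "((\<lambda>s. (\<alpha> \<bullet> Pr \<mu> (Y s)) * (\<alpha> \<bullet> Pr \<mu> q)) \<longlongrightarrow> (\<alpha> \<bullet> Pr \<mu> q) * (\<alpha> \<bullet> Pr \<mu> q)) (nhds s0)"
            using tg[OF g] by (intro tendsto_mult tendsto_const) (simp add: q_def)
          moreover have "0 < (\<alpha> \<bullet> Pr \<mu> q) * (\<alpha> \<bullet> Pr \<mu> q)" using False by (metis not_real_square_gt_zero)
          ultimately have "\<forall>\<^sub>F s in nhds s0. 0 < (\<alpha> \<bullet> Pr \<mu> (Y s)) * (\<alpha> \<bullet> Pr \<mu> q)" by (rule order_tendstoD(1))
          then show ?thesis by eventually_elim simp
        qed simp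
      qed
    qed
    ultimately have "\<forall>\<^sub>F s in nhds s0. \<forall>g\<in>lead_funs. g q \<noteq> 0 \<longrightarrow> 0 < g (Y s) * g q"
    proof eventually_elim
      case (elim s)
      show ?case
      proof (intro ballI impI)
        fix g assume g: "g \<in> lead_funs" "g q \<noteq> 0"
        from g(1) consider \<alpha> and k :: int where "\<alpha> \<in> \<Phi>" "g = (\<lambda>y. \<alpha> \<bullet> (center + Pr 2 y) - of_int k)"
          | \<alpha> \<mu> where "\<alpha> \<in> \<Phi>" "\<mu> \<in> E" "g = (\<lambda>y. \<alpha> \<bullet> Pr \<mu> y)" unfolding lead_funs_def by auto
        then show "0 < g (Y s) * g q"
        proof cases
          case 1
          then have "(\<lambda>x. \<alpha> \<bullet> x - of_int k) \<in> H" unfolding affine_forms_def by blast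
          from bspec[OF elim(1) this] show ?thesis using g(2) by (simp add: 1(2))
        next
          case 2
          from bspec[OF elim(2), of "(\<alpha>, \<mu>)"] show ?thesis using g(2) 2 by simp
        qed
      qed
    qed
    then obtain d where d: "d > 0" and dg: "\<forall>s. \<bar>s - s0\<bar> < d \<longrightarrow> (\<forall>g\<in>lead_funs. g q \<noteq> 0 \<longrightarrow> 0 < g (Y s) * g q)"
      unfolding eventually_nhds_metric dist_real_def by blast
    have "eqv (pt s) (pt t)" if st: "s \<in> D" "t \<in> D" "\<bar>s - s0\<bar> < d" "\<bar>t - s0\<bar> < d" for s t
    proof (rule crossing[where q = q])
      show "generic (Y s)" "generic (Y t)" using st by (auto simp: D_def)
      show "good (pt s) (Y s)" "good (pt t) (Y t)" using pt st by auto
      show "0 < g (Y s) * g q \<and> 0 < g (Y t) * g q" if "g \<in> lead_funs" "g q \<noteq> 0" for g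
        using dg st that by simp
      fix g g' assume g: "g \<in> lead_funs" "g' \<in> lead_funs" "g q = 0" "g' q = 0" "\<exists>x. g x \<noteq> 0" "\<exists>x. g' x \<noteq> 0"
      have nz: "g y \<noteq> 0" "g' y \<noteq> 0" using gen(1) g unfolding generic_def by metis+
      have z: "(1 - s0) * g y + s0 * g x = 0" "(1 - s0) * g' y + s0 * g' x = 0"
        using g gY by (auto simp: q_def)
      have "s0 \<noteq> 0" using z(1) nz(1) by auto
      \<comment> \<open>Eliminating \<open>s0\<close> from the two equations in \<open>z\<close>
        gives the hypothesis of \<open>pair_generic\<close>, which spreads it to the whole
        space.\<close>
      have "s0 * (g y * g' x) = g y * (s0 * g' x)" by simp
      also have "\<dots> = g y * - ((1 - s0) * g' y)" using z(2) by (metis add_eq_0_iff)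
      also have "\<dots> = g' y * - ((1 - s0) * g y)" by simp
      also have "\<dots> = g' y * (s0 * g x)" using z(1) by (metis add_eq_0_iff)
      finally have "s0 * (g y * g' x) = s0 * (g' y * g x)" by simp
      then have "g y * g' x = g' y * g x" using \<open>s0 \<noteq> 0\<close> by simp
      then have "\<forall>u. g y * g' u = g' y * g u" using pg g(1,2) unfolding pair_generic_def by blast
      then have "\<forall>u. g' u = (g' y / g y) * g u" using nz by (simp add: field_simps)
      moreover have "g' y / g y \<noteq> 0" using nz by simp
      ultimately show "\<exists>c. c \<noteq> 0 \<and> (\<forall>u. g' u = c * g u)" by blast
    qed
    then show "\<exists>d>0. \<forall>s\<in>D. \<forall>t\<in>D. 0 \<le> s \<longrightarrow> s \<le> t \<longrightarrow> t \<le> 1 \<longrightarrow> \<bar>s - s0\<bar> < d \<longrightarrow> \<bar>t - s0\<bar> < d \<longrightarrow> eqv (pt s) (pt t)"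
      using d by blast
  next
    fix r s t assume "eqv (pt r) (pt s)" "eqv (pt s) (pt t)"
    then show "eqv (pt r) (pt t)" by (rule ce_trans)
  qed simp
  moreover have "eqv a (pt 0)"
    by (rule good_same_side[OF ab(1) pt[OF D01(1), unfolded Y01]])
      (metis generic_lead[OF gen(1)] not_real_square_gt_zero)
  moreover have "eqv (pt 1) b"
    by (rule good_same_side[OF pt[OF D01(2), unfolded Y01] ab(2)])
      (metis generic_lead[OF gen(2)] not_real_square_gt_zero)
  ultimately show ?thesis using ce_trans by metis
qed

lemma negligible_not_pair_generic:
  "negligible {x. \<not> pair_generic y x}"
proof -
  define G where "G = (\<lambda>(g1, g2) u. g1 y * g2 u - g2 y * g1 u) ` (lead_funs \<times> lead_funs)"
  have "negligible {x. \<exists>g\<in>G. g x = 0 \<and> (\<exists>u. g u \<noteq> 0)}"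
  proof (rule negligible_nongeneric)
    show "countable G" unfolding G_def using countable_lead_funs by (intro countable_image countable_SIGMA)
    fix g assume "g \<in> G"
    then obtain g1 g2 where g: "g1 \<in> lead_funs" "g2 \<in> lead_funs" "g = (\<lambda>u. g1 y * g2 u - g2 y * g1 u)"
      by (auto simp: G_def)
    obtain l1 c1 where l1: "linear l1" "\<And>x. g1 x = l1 x + c1"
      using affine_lead_funs[OF g(1)] unfolding affine_fun_def by auto
    obtain l2 c2 where l2: "linear l2" "\<And>x. g2 x = l2 x + c2"
      using affine_lead_funs[OF g(2)] unfolding affine_fun_def by auto
    show "affine_fun g"
    proof (rule affine_funI)
      show "linear (\<lambda>u. g1 y * l2 u - g2 y * l1 u)"
        by (auto intro!: linearI simp: linear_add[OF l1(1)] linear_add[OF l2(1)] linear_scale[OF l1(1)]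
            linear_scale[OF l2(1)] algebra_simps)
      show "g x = (g1 y * l2 x - g2 y * l1 x) + (g1 y * c2 - g2 y * c1)" for x
        unfolding g(3) l1(2)[of x] l2(2)[of x] by (simp add: algebra_simps)
    qed
  qed
  then show ?thesis
  proof (rule negligible_subset)
    show "{x. \<not> pair_generic y x} \<subseteq> {x. \<exists>g\<in>G. g x = 0 \<and> (\<exists>u. g u \<noteq> 0)}"
    proof
      fix x assume "x \<in> {x. \<not> pair_generic y x}"
      then obtain g1 g2 u where g: "g1 \<in> lead_funs" "g2 \<in> lead_funs" "g1 y * g2 x = g2 y * g1 x"
          "g1 y * g2 u \<noteq> g2 y * g1 u" unfolding pair_generic_def by blast
      define g where "g = (\<lambda>u. g1 y * g2 u - g2 y * g1 u)"
      have "g \<in> G" unfolding G_def g_def using g(1,2) by force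
      moreover have "g x = 0" "g u \<noteq> 0" using g(3,4) by (auto simp: g_def)
      ultimately show "x \<in> {x. \<exists>g\<in>G. g x = 0 \<and> (\<exists>u. g u \<noteq> 0)}" by blast
    qed
  qed
qed

text \<open>The two generic parameters found by the flow need not be in general position to each
  other; a third one, generic relative to both, connects them.\<close>

theorem irreducible_conj_equiv:
  assumes "regular H a" "regular H b" "irr a" "irr b"
  shows "eqv a b"
proof -
  obtain y1 a' where 1: "generic y1" "good a' y1" "eqv a a'" using eqv_good assms by blast
  obtain y2 b' where 2: "generic y2" "good b' y2" "eqv b b'" using eqv_good assms by blast
  have "negligible ({x. \<exists>g\<in>lead_funs. g x = 0 \<and> (\<exists>u. g u \<noteq> 0)} \<union> {x. \<not> pair_generic y1 x} \<union> {x. \<not> pair_generic y2 x})"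
    by (intro negligible_Un negligible_not_pair_generic negligible_nongeneric countable_lead_funs affine_lead_funs)
  from open_minus_negligible[OF open_UNIV UNIV_I this] obtain x
    where x: "\<forall>g\<in>lead_funs. g x = 0 \<longrightarrow> (\<forall>u. g u = 0)" "pair_generic y1 x" "pair_generic y2 x" by auto
  have gx: "generic x" unfolding generic_def using x(1) by blast
  obtain c where c: "good c x" using good_exists[OF gx] by blast
  have "eqv a' c" "eqv b' c"
    using eqv_pair_generic[OF 1(1) gx x(2) 1(2) c] eqv_pair_generic[OF 2(1) gx x(3) 2(2) c] by auto
  then show ?thesis using 1(3) 2(3) by (meson ce_sym ce_trans)
qed

end

section \<open>Root data and the extended affine Weyl group\<close>

lemma lattice_inner_Ints: "x \<in> lattice \<Longrightarrow> y \<in> lattice \<Longrightarrow> x \<bullet> y \<in> \<int>"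
  unfolding inner_vec_def by (auto simp: lattice_def intro!: Ints_sum)

lemma lattice_add: "x \<in> lattice \<Longrightarrow> y \<in> lattice \<Longrightarrow> x + y \<in> lattice"
  and lattice_diff: "x \<in> lattice \<Longrightarrow> y \<in> lattice \<Longrightarrow> x - y \<in> lattice"
  and lattice_scale: "x \<in> lattice \<Longrightarrow> c \<in> \<int> \<Longrightarrow> c *\<^sub>R x \<in> lattice"
  and lattice_zero: "0 \<in> lattice"
  by (auto simp: lattice_def)

lemma finite_ints_between: "finite {k::int. a < of_int k \<and> of_int k < b}" for a b :: real
proof (rule finite_subset)
  show "{k::int. a < of_int k \<and> of_int k < b} \<subseteq> {\<lfloor>a\<rfloor>..\<lceil>b\<rceil>}" by (auto simp: floor_le_iff le_ceiling_iff; linarith)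
qed simp

locale weyl_datum =
  fixes \<Phi> :: "(real^'n) set" and cor :: "real^'n \<Rightarrow> real^'n" and z :: "real^'n"
    and \<Omega> :: "(real^'n \<Rightarrow> real^'n) set"
  assumes rd: "root_datum \<Phi> cor"
    and zreg: "\<forall>\<alpha>\<in>\<Phi>. \<alpha> \<bullet> z \<noteq> 0"
    and dg: "diagram_group \<Phi> cor z \<Omega>"
begin

abbreviation "H \<equiv> affine_forms \<Phi>"
abbreviation "W \<equiv> ext_affine_weyl \<Phi> cor \<Omega>"
abbreviation "pos \<equiv> posroots \<Phi> z"

lemma fin: "finite \<Phi>" using rd by (simp add: root_datum_def)
lemma root_lattice: "\<alpha> \<in> \<Phi> \<Longrightarrow> \<alpha> \<in> lattice" using rd by (auto simp: root_datum_def)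
lemma cor_lattice: "\<alpha> \<in> \<Phi> \<Longrightarrow> cor \<alpha> \<in> lattice" using rd by (auto simp: root_datum_def)
lemma pair2: "\<alpha> \<in> \<Phi> \<Longrightarrow> \<alpha> \<bullet> cor \<alpha> = 2" using rd by (auto simp: root_datum_def)
lemma root_refl: "\<alpha> \<in> \<Phi> \<Longrightarrow> \<beta> \<in> \<Phi> \<Longrightarrow> \<beta> - (\<beta> \<bullet> cor \<alpha>) *\<^sub>R \<alpha> \<in> \<Phi>"
  using rd by (auto simp: root_datum_def)
lemma cor_refl: "\<alpha> \<in> \<Phi> \<Longrightarrow> x \<in> cor ` \<Phi> \<Longrightarrow> refl_lin cor \<alpha> x \<in> cor ` \<Phi>"
  using rd unfolding root_datum_def by blast
lemma no_double: "\<alpha> \<in> \<Phi> \<Longrightarrow> 2 *\<^sub>R \<alpha> \<notin> \<Phi>" using rd by (auto simp: root_datum_def)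

lemma neg: "\<alpha> \<in> \<Phi> \<Longrightarrow> - \<alpha> \<in> \<Phi>"
  using root_refl[of \<alpha> \<alpha>] by (simp add: pair2 scaleR_2)

lemma nz: "0 \<notin> \<Phi>" using pair2[of 0] by auto

text \<open>\<open>2 * c\<close> and \<open>2 / c\<close> are pairings of roots with coroots, hence
  integers with product 4. Apart from 1 and -1 this leaves factors 2 and 1/2 up to sign, excluded by
  \<open>no_double\<close>.\<close>

lemma reduced:
  assumes "\<alpha> \<in> \<Phi>" "\<beta> \<in> \<Phi>" "\<beta> = c *\<^sub>R \<alpha>"
  shows "\<beta> = \<alpha> \<or> \<beta> = - \<alpha>"
proof -
  have c0: "c \<noteq> 0" using assms nz by auto
  have \<alpha>: "\<alpha> = (1 / c) *\<^sub>R \<beta>" using assms(3) c0 by simp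
  have "2 * c \<in> \<int>"
    using lattice_inner_Ints[OF root_lattice[OF assms(2)] cor_lattice[OF assms(1)]]
    by (simp add: assms(3) pair2[OF assms(1)] mult.commute)
  then obtain m where m: "2 * c = of_int m" by (auto elim: Ints_cases)
  have "2 / c \<in> \<int>"
    using lattice_inner_Ints[OF root_lattice[OF assms(1)] cor_lattice[OF assms(2)]]
    unfolding \<alpha> by (simp add: pair2[OF assms(2)])
  then obtain n where n: "2 / c = of_int n" by (auto elim: Ints_cases)
  have "(2 * c) * (2 / c) = 4" using c0 by simp
  then have "of_int (m * n) = (of_int 4 :: real)" by (simp add: m n)
  then have mn: "m * n = 4" by linarith
  then have "m dvd 4" by (metis dvd_triv_left)
  then have "\<bar>m\<bar> \<le> 4" using dvd_imp_le_int[of 4 m] by simp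
  moreover have "m \<noteq> 3" "m \<noteq> -3" "m \<noteq> 0"
  proof -
    show "m \<noteq> 3"
    proof
      assume "m = 3"
      then have "3 * n = 4" using mn by simp
      then show False by presburger
    qed
    show "m \<noteq> -3"
    proof
      assume "m = -3"
      then have "-3 * n = 4" using mn by simp
      then show False by presburger
    qed
    show "m \<noteq> 0" using mn by auto
  qed
  ultimately have "m = 2 \<or> m = -2 \<or> m = 4 \<or> m = -4 \<or> m = 1 \<or> m = -1" by presburger
  then consider "c = 1" | "c = -1" | "c = 2" | "c = -2" | "c = 1 / 2" | "c = - (1 / 2)" using m by fastforce
  then show ?thesis
  proof cases
    case 3
    then show ?thesis using no_double assms by auto
  next
    case 4
    then have "- \<beta> = 2 *\<^sub>R \<alpha>" using assms(3) by simp
    then show ?thesis using no_double[OF assms(1)] neg[OF assms(2)] by auto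
  next
    case 5
    have "\<alpha> = 2 *\<^sub>R \<beta>" using \<alpha> unfolding 5 by simp
    then show ?thesis using no_double[OF assms(2)] assms(1) by auto
  next
    case 6
    have "\<alpha> = - (2 *\<^sub>R \<beta>)" using \<alpha> unfolding 6 by simp
    then have "- \<alpha> = 2 *\<^sub>R \<beta>" by simp
    then show ?thesis using no_double[OF assms(2)] neg[OF assms(1)] by auto
  qed (use assms(3) in auto)
qed

lemma linear_refl: "linear (refl_lin cor \<alpha>)"
  by (auto intro!: linearI simp: refl_lin_def inner_simps algebra_simps)

lemma refl_refl: "\<alpha> \<in> \<Phi> \<Longrightarrow> refl_lin cor \<alpha> (refl_lin cor \<alpha> x) = x"
  by (simp add: refl_lin_def inner_simps pair2 algebra_simps)

lemma inner_refl: "f \<bullet> refl_lin cor \<alpha> x = (f - (f \<bullet> cor \<alpha>) *\<^sub>R \<alpha>) \<bullet> x"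
  by (simp add: refl_lin_def inner_simps)

section \<open>Coroots are determined by their roots\<close>

definition cform :: "real^'n \<Rightarrow> real^'n \<Rightarrow> real" where
  "cform f g = (\<Sum>x\<in>cor ` \<Phi>. (f \<bullet> x) * (g \<bullet> x))"

text \<open>The reflection in \<beta> permutes the coroots, so reindexing the sum shows that
  \<open>cform\<close> is invariant. The outcome is the usual formula for the pairing with a coroot,
  2 (f, \<beta>) / (\<beta>, \<beta>), valid for every \<open>f\<close> and not only for
  roots.\<close>

lemma cform_root:
  assumes b: "\<beta> \<in> \<Phi>"
  shows "2 * cform f \<beta> = (f \<bullet> cor \<beta>) * cform \<beta> \<beta>" "0 < cform \<beta> \<beta>"
proof -
  let ?s = "refl_lin cor \<beta>"
  have bij: "bij_betw ?s (cor ` \<Phi>) (cor ` \<Phi>)"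
    by (rule bij_betwI[where g = ?s]) (use cor_refl[OF b] refl_refl[OF b] in auto)
  have "cform f \<beta> = (\<Sum>x\<in>cor ` \<Phi>. (f \<bullet> ?s x) * (\<beta> \<bullet> ?s x))"
    unfolding cform_def by (rule sum.reindex_bij_betw[OF bij, symmetric])
  also have "\<dots> = (\<Sum>x\<in>cor ` \<Phi>. - ((f \<bullet> x) * (\<beta> \<bullet> x)) + (f \<bullet> cor \<beta>) * ((\<beta> \<bullet> x) * (\<beta> \<bullet> x)))"
    by (intro sum.cong) (auto simp: refl_lin_def inner_simps pair2[OF b] algebra_simps)
  also have "\<dots> = - cform f \<beta> + (f \<bullet> cor \<beta>) * cform \<beta> \<beta>"
    by (simp only: cform_def sum.distrib sum_negf sum_distrib_left)
  finally show "2 * cform f \<beta> = (f \<bullet> cor \<beta>) * cform \<beta> \<beta>" by simp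
  have "(\<beta> \<bullet> cor \<beta>) * (\<beta> \<bullet> cor \<beta>) \<le> cform \<beta> \<beta>"
    unfolding cform_def using fin b by (intro member_le_sum) auto
  then show "0 < cform \<beta> \<beta>" by (simp add: pair2[OF b])
qed

text \<open>Through \<open>cform\<close> the difference of the coroots is represented by a
  combination \<rho> of the two roots. As roots do not see the difference, \<rho> is isotropic for a
  semidefinite form, hence vanishes on all coroots, and so the difference pairs to zero with
  everything.\<close>

lemma coroot_separated:
  assumes g: "\<gamma> \<in> \<Phi>" "\<gamma>' \<in> \<Phi>" and d: "\<And>\<beta>. \<beta> \<in> \<Phi> \<Longrightarrow> \<beta> \<bullet> cor \<gamma>' = \<beta> \<bullet> cor \<gamma>"
  shows "cor \<gamma>' = cor \<gamma>"
proof -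
  define \<rho> where "\<rho> = (2 / cform \<gamma>' \<gamma>') *\<^sub>R \<gamma>' - (2 / cform \<gamma> \<gamma>) *\<^sub>R \<gamma>"
  have rho: "f \<bullet> (cor \<gamma>' - cor \<gamma>) = (\<Sum>x\<in>cor ` \<Phi>. (f \<bullet> x) * (\<rho> \<bullet> x))" for f
  proof -
    have "f \<bullet> cor \<beta> = (2 / cform \<beta> \<beta>) * cform f \<beta>" if "\<beta> \<in> \<Phi>" for \<beta>
      using cform_root(1)[OF that, of f] cform_root(2)[OF that] by (simp add: field_simps)
    then have "f \<bullet> (cor \<gamma>' - cor \<gamma>) = (2 / cform \<gamma>' \<gamma>') * cform f \<gamma>' - (2 / cform \<gamma> \<gamma>) * cform f \<gamma>"
      using g by (simp add: inner_diff_right)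
    also have "\<dots> = (\<Sum>x\<in>cor ` \<Phi>. (f \<bullet> x) * (\<rho> \<bullet> x))"
      unfolding cform_def[of f] sum_distrib_left sum_subtractf[symmetric] \<rho>_def
      by (intro sum.cong) (simp_all add: inner_simps algebra_simps)
    finally show ?thesis .
  qed
  have "\<rho> \<bullet> (cor \<gamma>' - cor \<gamma>) = 0" using g d by (simp add: \<rho>_def inner_simps)
  then have "(\<Sum>x\<in>cor ` \<Phi>. (\<rho> \<bullet> x) * (\<rho> \<bullet> x)) = 0" by (simp add: rho)
  then have "\<forall>x\<in>cor ` \<Phi>. \<rho> \<bullet> x = 0" using fin by (subst (asm) sum_nonneg_eq_0_iff) auto
  then have "f \<bullet> (cor \<gamma>' - cor \<gamma>) = 0" for f unfolding rho by (intro sum.neutral) auto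
  then have "(cor \<gamma>' - cor \<gamma>) \<bullet> (cor \<gamma>' - cor \<gamma>) = 0" by blast
  then show ?thesis by simp
qed

text \<open>Two reflections in the same root differ by a transvection of the finite set of roots.\<close>

lemma coroot_unique:
  assumes g: "\<gamma> \<in> \<Phi>" and d: "\<delta> \<in> cor ` \<Phi>" "\<gamma> \<bullet> \<delta> = 2" and r: "\<And>\<beta>. \<beta> \<in> \<Phi> \<Longrightarrow> \<beta> - (\<beta> \<bullet> \<delta>) *\<^sub>R \<gamma> \<in> \<Phi>"
  shows "\<delta> = cor \<gamma>"
proof -
  obtain \<gamma>' where g': "\<gamma>' \<in> \<Phi>" "\<delta> = cor \<gamma>'" using d by blast
  define e where "e = \<delta> - cor \<gamma>"
  have ge: "\<gamma> \<bullet> e = 0" using d(2) pair2[OF g] by (simp add: e_def inner_diff_right)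
  have step: "\<beta> + (\<beta> \<bullet> e) *\<^sub>R \<gamma> \<in> \<Phi>" if "\<beta> \<in> \<Phi>" for \<beta>
  proof -
    have "\<beta> + (\<beta> \<bullet> e) *\<^sub>R \<gamma> = (\<beta> - (\<beta> \<bullet> \<delta>) *\<^sub>R \<gamma>) - ((\<beta> - (\<beta> \<bullet> \<delta>) *\<^sub>R \<gamma>) \<bullet> cor \<gamma>) *\<^sub>R \<gamma>"
      by (simp add: vec_eq_iff e_def inner_simps pair2[OF g] algebra_simps)
    then show ?thesis using root_refl[OF g r[OF that]] by (simp only:)
  qed
  have "\<beta> \<bullet> e = 0" if b: "\<beta> \<in> \<Phi>" for \<beta>
  proof (rule ccontr)
    assume ne: "\<beta> \<bullet> e \<noteq> 0"
    \<comment> \<open>A nontrivial transvection would have an infinite orbit in \<Phi>.\<close>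
    have it: "\<beta> + (real n * (\<beta> \<bullet> e)) *\<^sub>R \<gamma> \<in> \<Phi>" for n
    proof (induction n)
      case (Suc n)
      from step[OF Suc] show ?case by (simp add: inner_simps ge algebra_simps)
    qed (use b in simp)
    have "\<gamma> \<noteq> 0" using g nz by auto
    then have "inj (\<lambda>n. \<beta> + (real n * (\<beta> \<bullet> e)) *\<^sub>R \<gamma>)" using ne by (intro injI) simp
    then have "infinite (range (\<lambda>n. \<beta> + (real n * (\<beta> \<bullet> e)) *\<^sub>R \<gamma>))" by (rule range_inj_infinite)
    moreover have "range (\<lambda>n. \<beta> + (real n * (\<beta> \<bullet> e)) *\<^sub>R \<gamma>) \<subseteq> \<Phi>" by (intro image_subsetI it)
    ultimately show False using fin finite_subset by metis
  qed
  then have "\<beta> \<bullet> cor \<gamma>' = \<beta> \<bullet> cor \<gamma>" if "\<beta> \<in> \<Phi>" for \<beta>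
    using that by (simp add: e_def g' inner_diff_right)
  then show ?thesis using coroot_separated[OF g g'(1)] g'(2) by simp
qed

text \<open>The root datum states stability of the set of coroots, not compatibility of
  \<open>cor\<close> with reflections. The latter follows from uniqueness: conjugating the
  reflection in \<alpha> by the one in \<beta> gives a reflection of \<Phi> in the reflected
  root.\<close>

lemma cor_reflect:
  assumes a: "\<alpha> \<in> \<Phi>" and b: "\<beta> \<in> \<Phi>"
  shows "cor (\<alpha> - (\<alpha> \<bullet> cor \<beta>) *\<^sub>R \<beta>) = refl_lin cor \<beta> (cor \<alpha>)"
proof -
  let ?g = "\<alpha> - (\<alpha> \<bullet> cor \<beta>) *\<^sub>R \<beta>" and ?d = "refl_lin cor \<beta> (cor \<alpha>)"
  have "?d = cor ?g"
  proof (rule coroot_unique)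
    show "?g \<in> \<Phi>" by (rule root_refl[OF b a])
    show "?d \<in> cor ` \<Phi>" using cor_refl[OF b] a by blast
    show "?g \<bullet> ?d = 2" by (simp add: refl_refl[OF b] pair2[OF a] flip: inner_refl)
    fix \<xi> assume x: "\<xi> \<in> \<Phi>"
    define \<xi>' where "\<xi>' = \<xi> - (\<xi> \<bullet> cor \<beta>) *\<^sub>R \<beta>"
    define \<xi>'' where "\<xi>'' = \<xi>' - (\<xi>' \<bullet> cor \<alpha>) *\<^sub>R \<alpha>"
    have "\<xi>' \<in> \<Phi>" unfolding \<xi>'_def by (rule root_refl[OF b x])
    then have "\<xi>'' \<in> \<Phi>" unfolding \<xi>''_def by (rule root_refl[OF a])
    then have "\<xi>'' - (\<xi>'' \<bullet> cor \<beta>) *\<^sub>R \<beta> \<in> \<Phi>" by (rule root_refl[OF b])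
    also have "\<xi>'' - (\<xi>'' \<bullet> cor \<beta>) *\<^sub>R \<beta> = \<xi> - (\<xi> \<bullet> ?d) *\<^sub>R ?g"
      unfolding \<xi>''_def \<xi>'_def refl_lin_def by (simp add: inner_simps pair2[OF b] algebra_simps)
    finally show "\<xi> - (\<xi> \<bullet> ?d) *\<^sub>R ?g \<in> \<Phi>" .
  qed
  then show ?thesis by simp
qed

lemma cor_neg: "\<alpha> \<in> \<Phi> \<Longrightarrow> cor (- \<alpha>) = - cor \<alpha>"
  using cor_reflect[of \<alpha> \<alpha>] by (simp add: pair2 refl_lin_def scaleR_2)

section \<open>The linear group and its affine extension\<close>

abbreviation "G \<equiv> lin_group \<Phi> cor \<Omega>"

lemma diag: "\<sigma> \<in> \<Omega> \<Longrightarrow> diagram_aut \<Phi> cor z \<sigma>" using dg by (simp add: diagram_group_def)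

text \<open>In a finite set closed under composition the powers of \<sigma> repeat; cancelling by
  injectivity exhibits the inverse as a power.\<close>

lemma diag_inverse:
  assumes s: "\<sigma> \<in> \<Omega>" shows "\<exists>\<tau>\<in>\<Omega>. \<sigma> \<circ> \<tau> = id \<and> \<tau> \<circ> \<sigma> = id"
proof -
  have pow: "\<sigma> ^^ n \<in> \<Omega>" for n
  proof (induction n)
    case 0
    then show ?case using dg unfolding diagram_group_def funpow.simps by blast
  next
    case (Suc n)
    then show ?case using dg s unfolding diagram_group_def funpow.simps by blast
  qed
  have bij: "bij \<sigma>" using diag[OF s] by (simp add: diagram_aut_def)
  have "finite (range (\<lambda>n. \<sigma> ^^ n))" using pow dg finite_subset[of "range (\<lambda>n. \<sigma> ^^ n)" \<Omega>] by (auto simp: diagram_group_def)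
  then have "\<not> inj (\<lambda>n. \<sigma> ^^ n)" using finite_imageD by fastforce
  then obtain i j where "i \<noteq> j" "\<sigma> ^^ i = \<sigma> ^^ j" by (auto simp: inj_def)
  then obtain i j where ij: "i < j" "\<sigma> ^^ i = \<sigma> ^^ j" by (metis linorder_neqE_nat)
  have "(\<sigma> ^^ i) ((\<sigma> ^^ (j - i)) x) = (\<sigma> ^^ i) x" for x
    using ij funpow_add[of i "j - i" \<sigma>] by (simp add: fun_eq_iff)
  moreover have "inj (\<sigma> ^^ i)" using bij by (simp add: bij_is_inj inj_fn)
  ultimately have e: "(\<sigma> ^^ (j - i)) x = x" for x by (simp add: inj_eq)
  obtain m where m: "j - i = Suc m" using ij by (metis Suc_diff_Suc)
  show ?thesis
  proof (intro bexI conjI)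
    show "\<sigma> ^^ m \<in> \<Omega>" by (rule pow)
    show "\<sigma> \<circ> \<sigma> ^^ m = id" using e by (simp add: m fun_eq_iff)
    show "\<sigma> ^^ m \<circ> \<sigma> = id" using e by (simp add: m fun_eq_iff funpow_swap1)
  qed
qed

lemma G_comp: "g \<in> G \<Longrightarrow> g' \<in> G \<Longrightarrow> g \<circ> g' \<in> G"
  by (induction rule: lin_group.induct) (auto simp: comp_assoc intro: lin_group.intros)

lemma refl_in_G: "\<alpha> \<in> \<Phi> \<Longrightarrow> refl_lin cor \<alpha> \<in> G"
  using lg_refl[OF _ lg_id] by fastforce

lemma diag_in_G: "\<sigma> \<in> \<Omega> \<Longrightarrow> \<sigma> \<in> G"
  using lg_diag[OF _ lg_id] by fastforce

lemma G_inverse: "g \<in> G \<Longrightarrow> \<exists>g'\<in>G. g \<circ> g' = id \<and> g' \<circ> g = id"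
proof (induction rule: lin_group.induct)
  case lg_id
  show ?case using lin_group.lg_id by (intro bexI[of _ id]) auto
next
  case (lg_refl \<alpha> g)
  then obtain g' where g': "g' \<in> G" "g \<circ> g' = id" "g' \<circ> g = id" by blast
  have "g' \<circ> refl_lin cor \<alpha> \<in> G" using G_comp g' refl_in_G lg_refl by blast
  then show ?case
    using g' refl_refl[OF lg_refl(1)] by (intro bexI[of _ "g' \<circ> refl_lin cor \<alpha>"]) (auto simp: fun_eq_iff)
next
  case (lg_diag \<sigma> g)
  then obtain g' where g': "g' \<in> G" "g \<circ> g' = id" "g' \<circ> g = id" by blast
  obtain \<tau> where t: "\<tau> \<in> \<Omega>" "\<sigma> \<circ> \<tau> = id" "\<tau> \<circ> \<sigma> = id" using diag_inverse[OF lg_diag(1)] by blast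
  have "g' \<circ> \<tau> \<in> G" using G_comp g' diag_in_G t by blast
  then show ?case
    using g' t by (intro bexI[of _ "g' \<circ> \<tau>"]) (auto simp: fun_eq_iff)
qed

text \<open>The clause on coroots is what makes conjugation carry reflections to reflections; for a
  generating reflection it is \<open>cor_reflect\<close>.\<close>

lemma G_props:
  assumes "g \<in> G"
  shows "linear g \<and> (\<forall>x\<in>lattice. g x \<in> lattice) \<and>
     (\<forall>\<alpha>\<in>\<Phi>. \<exists>\<beta>\<in>\<Phi>. (\<forall>x. \<beta> \<bullet> g x = \<alpha> \<bullet> x) \<and> cor \<beta> = g (cor \<alpha>))"
  using assms
proof (induction rule: lin_group.induct)
  case lg_id
  show ?case using linear_id[unfolded id_def] by (auto simp: id_def)
next
  case (lg_refl \<xi> g)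
  have "linear (refl_lin cor \<xi> \<circ> g)" using lg_refl linear_compose linear_refl by blast
  moreover have "refl_lin cor \<xi> x \<in> lattice" if "x \<in> lattice" for x
    unfolding refl_lin_def using lg_refl(1)
    by (intro lattice_diff lattice_scale cor_lattice lattice_inner_Ints[OF root_lattice that] that)
  moreover have "\<exists>\<gamma>\<in>\<Phi>. (\<forall>x. \<gamma> \<bullet> (refl_lin cor \<xi> \<circ> g) x = \<alpha> \<bullet> x) \<and> cor \<gamma> = (refl_lin cor \<xi> \<circ> g) (cor \<alpha>)"
    if a: "\<alpha> \<in> \<Phi>" for \<alpha>
  proof -
    obtain \<beta> where b: "\<beta> \<in> \<Phi>" "\<And>x. \<beta> \<bullet> g x = \<alpha> \<bullet> x" "cor \<beta> = g (cor \<alpha>)" using lg_refl a by blast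
    show ?thesis
    proof (intro bexI conjI allI)
      show "\<beta> - (\<beta> \<bullet> cor \<xi>) *\<^sub>R \<xi> \<in> \<Phi>" by (rule root_refl[OF lg_refl(1) b(1)])
      show "(\<beta> - (\<beta> \<bullet> cor \<xi>) *\<^sub>R \<xi>) \<bullet> (refl_lin cor \<xi> \<circ> g) x = \<alpha> \<bullet> x" for x
        by (simp add: refl_refl[OF lg_refl(1)] b(2) flip: inner_refl)
      show "cor (\<beta> - (\<beta> \<bullet> cor \<xi>) *\<^sub>R \<xi>) = (refl_lin cor \<xi> \<circ> g) (cor \<alpha>)"
        by (simp add: cor_reflect[OF b(1) lg_refl(1)] b(3))
    qed
  qed
  ultimately show ?case using lg_refl by (simp add: o_def)
next
  case (lg_diag \<sigma> g)
  have s: "linear \<sigma>" "\<sigma> ` lattice = lattice"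
    and sr: "\<forall>\<alpha>\<in>\<Phi>. \<exists>\<beta>\<in>\<Phi>. (\<forall>x. \<beta> \<bullet> \<sigma> x = \<alpha> \<bullet> x) \<and> cor \<beta> = \<sigma> (cor \<alpha>)"
    using diag[OF lg_diag(1)] unfolding diagram_aut_def by blast+
  have "linear (\<sigma> \<circ> g)" using lg_diag s linear_compose by blast
  moreover have "\<forall>x\<in>lattice. (\<sigma> \<circ> g) x \<in> lattice" using lg_diag s(2) by auto
  moreover have "\<exists>\<gamma>\<in>\<Phi>. (\<forall>x. \<gamma> \<bullet> (\<sigma> \<circ> g) x = \<alpha> \<bullet> x) \<and> cor \<gamma> = (\<sigma> \<circ> g) (cor \<alpha>)" if a: "\<alpha> \<in> \<Phi>" for \<alpha>
  proof -
    obtain \<beta> where b: "\<beta> \<in> \<Phi>" "\<And>x. \<beta> \<bullet> g x = \<alpha> \<bullet> x" "cor \<beta> = g (cor \<alpha>)" using lg_diag a by blast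
    obtain \<gamma> where c: "\<gamma> \<in> \<Phi>" "\<And>x. \<gamma> \<bullet> \<sigma> x = \<beta> \<bullet> x" "cor \<gamma> = \<sigma> (cor \<beta>)" using sr b(1) by blast
    show ?thesis using b c by (intro bexI[of _ \<gamma>]) auto
  qed
  ultimately show ?case by (simp add: o_def)
qed

lemma WE:
  assumes "w \<in> W"
  obtains g t where "g \<in> G" "t \<in> lattice" "w = (\<lambda>x. g x + t)"
  using assms unfolding ext_affine_weyl_def by blast

lemma WI: "g \<in> G \<Longrightarrow> t \<in> lattice \<Longrightarrow> (\<lambda>x. g x + t) \<in> W"
  unfolding ext_affine_weyl_def by blast

lemma W_id: "id \<in> W"
  using WI[OF lg_id lattice_zero] by (simp add: id_def)

lemma W_comp: assumes "u \<in> W" "w \<in> W" shows "u \<circ> w \<in> W"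
proof -
  obtain g t where u: "g \<in> G" "t \<in> lattice" "u = (\<lambda>x. g x + t)" using assms(1) by (rule WE)
  obtain g' t' where w: "g' \<in> G" "t' \<in> lattice" "w = (\<lambda>x. g' x + t')" using assms(2) by (rule WE)
  have "u \<circ> w = (\<lambda>x. (g \<circ> g') x + (g t' + t))"
    using linear_add[of g] G_props[OF u(1)] by (simp add: u w fun_eq_iff)
  moreover have "g t' + t \<in> lattice" using G_props[OF u(1)] w(2) u(2) lattice_add by blast
  ultimately show ?thesis using WI[OF G_comp[OF u(1) w(1)]] by metis
qed

lemma W_inverse: assumes "w \<in> W" shows "bij w" "inv w \<in> W"
proof -
  obtain g t where w: "g \<in> G" "t \<in> lattice" "w = (\<lambda>x. g x + t)" using assms by (rule WE)
  obtain g' where g': "g' \<in> G" "g \<circ> g' = id" "g' \<circ> g = id" using G_inverse[OF w(1)] by blast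
  define u where "u = (\<lambda>x. g' x + - g' t)"
  have lin: "linear g'" "\<forall>x\<in>lattice. g' x \<in> lattice" using G_props[OF g'(1)] by auto
  have "- g' t \<in> lattice" using lin w(2) lattice_diff[OF lattice_zero] by fastforce
  then have uW: "u \<in> W" unfolding u_def by (rule WI[OF g'(1)])
  have gg: "g (g' x) = x" "g' (g x) = x" for x using g' by (auto simp: fun_eq_iff)
  have "u (w x) = x" for x by (simp add: u_def w linear_add[OF lin(1)] gg)
  moreover have "w (u x) = x" for x
    using G_props[OF w(1)] by (simp add: u_def w linear_diff gg)
  ultimately have "bij w" "inv w = u"
    using o_bij[of u w] inv_equality[of u w] by (auto simp: fun_eq_iff)
  then show "bij w" "inv w \<in> W" using uW by auto
qed

lemma W_inv [simp]: "w \<in> W \<Longrightarrow> inv w (w x) = x" "w \<in> W \<Longrightarrow> w (inv w x) = x"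
  using W_inverse(1)[of w] by (simp_all add: bij_is_inj bij_is_surj surj_f_inv_f)

section \<open>Action on hyperplanes and reflections\<close>

lemma form_push:
  assumes "w \<in> W" "\<alpha> \<in> \<Phi>"
  shows "\<exists>\<beta>\<in>\<Phi>. \<exists>l. (\<forall>x. \<beta> \<bullet> w x - of_int l = \<alpha> \<bullet> x - of_int k) \<and>
     w \<circ> aff_refl cor \<alpha> k = aff_refl cor \<beta> l \<circ> w"
proof -
  obtain g t where w: "g \<in> G" "t \<in> lattice" "w = (\<lambda>x. g x + t)" using assms(1) by (rule WE)
  obtain \<beta> where b: "\<beta> \<in> \<Phi>" "\<And>x. \<beta> \<bullet> g x = \<alpha> \<bullet> x" "cor \<beta> = g (cor \<alpha>)"
    using G_props[OF w(1)] assms(2) by blast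
  obtain n where n: "\<beta> \<bullet> t = of_int n"
    using lattice_inner_Ints[OF root_lattice[OF b(1)] w(2)] by (auto elim: Ints_cases)
  have e: "\<beta> \<bullet> w x - of_int (k + n) = \<alpha> \<bullet> x - of_int k" for x
    by (simp add: w inner_add_right b(2) n)
  have "linear g" using G_props[OF w(1)] by blast
  then have "w (aff_refl cor \<alpha> k x) = aff_refl cor \<beta> (k + n) (w x)" for x
    unfolding aff_refl_def e by (simp add: w linear_diff linear_scale b(3))
  then show ?thesis using b(1) e by (intro bexI[of _ \<beta>] exI[of _ "k + n"]) (auto simp: fun_eq_iff)
qed

lemma form_pull: assumes "w \<in> W" "h \<in> H" shows "(\<lambda>x. h (w x)) \<in> H"
proof -
  obtain \<alpha> k where h: "h = (\<lambda>x. \<alpha> \<bullet> x - of_int k)" "\<alpha> \<in> \<Phi>" using assms(2) by (rule affine_formsE)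
  obtain \<beta> l where b: "\<beta> \<in> \<Phi>" "\<And>x. \<beta> \<bullet> inv w x - of_int l = \<alpha> \<bullet> x - of_int k"
    using form_push[OF W_inverse(2)[OF assms(1)] h(2), of k] by blast
  have "(\<lambda>x. h (w x)) = (\<lambda>x. \<beta> \<bullet> x - of_int l)"
  proof
    fix x
    show "h (w x) = \<beta> \<bullet> x - of_int l" using b(2)[of "w x"] W_inv(1)[OF assms(1), of x] by (simp add: h)
  qed
  then show ?thesis using b(1) unfolding affine_forms_def by blast
qed

lemma aff_refl_W: assumes "\<alpha> \<in> \<Phi>" shows "aff_refl cor \<alpha> k \<in> W"
proof -
  have "aff_refl cor \<alpha> k = (\<lambda>x. refl_lin cor \<alpha> x + of_int k *\<^sub>R cor \<alpha>)"
    by (simp add: aff_refl_def refl_lin_def fun_eq_iff algebra_simps)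
  then show ?thesis
    using WI[OF refl_in_G[OF assms] lattice_scale[OF cor_lattice[OF assms]], of "of_int k"] by simp
qed

lemma aff_refl_form: "\<alpha> \<in> \<Phi> \<Longrightarrow> \<alpha> \<bullet> aff_refl cor \<alpha> k x - of_int k = - (\<alpha> \<bullet> x - of_int k)"
  by (simp add: aff_refl_def inner_simps pair2)

lemma aff_refl_involution: "\<alpha> \<in> \<Phi> \<Longrightarrow> aff_refl cor \<alpha> k (aff_refl cor \<alpha> k x) = x"
  by (simp add: vec_eq_iff aff_refl_def inner_simps pair2 algebra_simps)

text \<open>Conjugation by \<open>w\<close> yields the reflection in the image hyperplane. That
  image is the same hyperplane, possibly with opposite sign, and the sign cancels because
  \<open>cor\<close> is odd.\<close>

lemma aff_refl_commute:
  assumes w: "w \<in> W" and a: "\<alpha> \<in> \<Phi>" and i: "invariant_wall w (\<lambda>x. \<alpha> \<bullet> x - of_int k)"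
  shows "w \<circ> aff_refl cor \<alpha> k = aff_refl cor \<alpha> k \<circ> w"
proof -
  obtain \<beta> l where b: "\<beta> \<in> \<Phi>" "\<And>x. \<beta> \<bullet> w x - of_int l = \<alpha> \<bullet> x - of_int k"
      "w \<circ> aff_refl cor \<alpha> k = aff_refl cor \<beta> l \<circ> w"
    using form_push[OF w a] by blast
  obtain e where e: "e = 1 \<or> e = (-1::real)" and we: "\<And>x. \<alpha> \<bullet> w x - of_int k = e * (\<alpha> \<bullet> x - of_int k)"
  proof (cases "\<forall>x. \<alpha> \<bullet> w x - of_int k = \<alpha> \<bullet> x - of_int k")
    case True
    then show thesis by (intro that[of 1]) auto
  next
    case False
    then have "\<forall>x. \<alpha> \<bullet> w x - of_int k = - (\<alpha> \<bullet> x - of_int k)" using i unfolding invariant_wall_def by blast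
    then show thesis by (intro that[of "-1"]) auto
  qed
  have bl: "\<beta> \<bullet> y - of_int l = e * (\<alpha> \<bullet> y - of_int k)" for y
  proof -
    have "\<beta> \<bullet> w (inv w y) - of_int l = e * (\<alpha> \<bullet> w (inv w y) - of_int k)"
      unfolding b(2) we using e by auto
    then show ?thesis unfolding W_inv(2)[OF w] .
  qed
  have l: "of_int l = e * of_int k" using bl[of 0] by simp
  then have "\<beta> \<bullet> y = (e *\<^sub>R \<alpha>) \<bullet> y" for y using bl[of y] by (simp add: algebra_simps)
  then have "\<beta> = e *\<^sub>R \<alpha>" using vector_eq_rdot by blast
  then have "cor \<beta> = e *\<^sub>R cor \<alpha>" using e cor_neg[OF a] by auto
  then have "aff_refl cor \<beta> l = aff_refl cor \<alpha> k"
    unfolding aff_refl_def bl using e by auto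
  then show ?thesis using b(3) by simp
qed

end

section \<open>Alcoves and lengths\<close>

definition split_set :: "('a \<Rightarrow> real) set \<Rightarrow> 'a \<Rightarrow> 'a \<Rightarrow> ('a \<Rightarrow> real) set" where
  "split_set H p q = {h\<in>H. splits h p q}"

lemma split_set_sym: "split_set H p q = split_set H q p"
  by (auto simp: split_set_def splits_sym)

lemma finite_split_set: "finite \<Phi> \<Longrightarrow> finite (split_set (affine_forms \<Phi>) p q)"
proof -
  assume f: "finite \<Phi>"
  define K where "K = (SIGMA \<alpha>:\<Phi>. {k::int. min (\<alpha> \<bullet> p) (\<alpha> \<bullet> q) < of_int k \<and> of_int k < max (\<alpha> \<bullet> p) (\<alpha> \<bullet> q)})"
  have "finite K" unfolding K_def using f finite_ints_between by (intro finite_SigmaI) auto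
  moreover have "split_set (affine_forms \<Phi>) p q \<subseteq> (\<lambda>(\<alpha>, k) x. \<alpha> \<bullet> x - of_int k) ` K"
    unfolding split_set_def affine_forms_def splits_def K_def
  proof clarify
    fix \<alpha> and k :: int assume a: "\<alpha> \<in> \<Phi>" and s: "(\<alpha> \<bullet> p - of_int k) * (\<alpha> \<bullet> q - of_int k) < 0"
    from s have "min (\<alpha> \<bullet> p) (\<alpha> \<bullet> q) < of_int k \<and> of_int k < max (\<alpha> \<bullet> p) (\<alpha> \<bullet> q)"
      by (auto simp: mult_less_0_iff)
    then show "(\<lambda>x. \<alpha> \<bullet> x - of_int k) \<in> (\<lambda>(\<alpha>, k) x. \<alpha> \<bullet> x - of_int k) `
        (SIGMA \<alpha>:\<Phi>. {k::int. min (\<alpha> \<bullet> p) (\<alpha> \<bullet> q) < of_int k \<and> of_int k < max (\<alpha> \<bullet> p) (\<alpha> \<bullet> q)})"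
      using a by (intro image_eqI[of _ _ "(\<alpha>, k)"]) auto
  qed
  ultimately show ?thesis using finite_surj by blast
qed

context weyl_datum
begin

text \<open>Twice the number of separating hyperplanes, as each is counted with both signs.\<close>

abbreviation dist_H :: "real^'n \<Rightarrow> real^'n \<Rightarrow> nat" where
  "dist_H p q \<equiv> card (split_set H p q)"

lemma form_neg: "h \<in> H \<Longrightarrow> (\<lambda>x. - h x) \<in> H"
proof -
  assume "h \<in> H"
  then obtain \<alpha> k where h: "h = (\<lambda>x. \<alpha> \<bullet> x - of_int k)" "\<alpha> \<in> \<Phi>" by (rule affine_formsE)
  have "(\<lambda>x. - h x) = (\<lambda>x. (- \<alpha>) \<bullet> x - of_int (- k))" by (simp add: h fun_eq_iff)
  then show ?thesis using neg[OF h(2)] unfolding affine_forms_def by blast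
qed

lemma forms_inj: "(\<lambda>x. \<alpha> \<bullet> x - of_int k) = (\<lambda>x. \<beta> \<bullet> x - of_int l) \<Longrightarrow> \<alpha> = \<beta> \<and> k = l" for \<alpha> \<beta> :: "real^'n"
proof -
  assume e: "(\<lambda>x. \<alpha> \<bullet> x - of_int k) = (\<lambda>x. \<beta> \<bullet> x - of_int l)"
  from fun_cong[OF e, of 0] have "k = l" by simp
  then have "\<alpha> \<bullet> x = \<beta> \<bullet> x" for x using fun_cong[OF e, of x] by simp
  then show ?thesis using \<open>k = l\<close> vector_eq_rdot by blast
qed

lemma regular_image:
  assumes "w \<in> W" "regular H p" shows "regular H (w p)"
  unfolding regular_def
proof
  fix h assume "h \<in> H"
  from form_pull[OF assms(1) this] have "(\<lambda>x. h (w x)) p \<noteq> 0" using assms(2) unfolding regular_def by (rule bspec[rotated])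
  then show "h (w p) \<noteq> 0" .
qed

lemma dist_H_image:
  assumes w: "w \<in> W" shows "dist_H (w p) (w q) = dist_H p q"
proof (rule bij_betw_same_card[OF bij_betwI])
  show "(\<lambda>h x. h (w x)) \<in> split_set H (w p) (w q) \<rightarrow> split_set H p q"
    using form_pull[OF w] by (auto simp: split_set_def splits_def)
  show "(\<lambda>h x. h (inv w x)) \<in> split_set H p q \<rightarrow> split_set H (w p) (w q)"
    using form_pull[OF W_inverse(2)[OF w]] w by (auto simp: split_set_def splits_def)
qed (simp_all add: W_inv[OF w])

text \<open>A hyperplane separates the ends of a path exactly when one of the two legs crosses it
  and the other does not, so distances add if none is crossed twice.\<close>

lemma dist_H_additive:
  assumes r: "regular H p" "regular H q" "regular H r"
    and d: "\<And>h. h \<in> H \<Longrightarrow> splits h p q \<Longrightarrow> \<not> splits h q r"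
  shows "dist_H p r = dist_H p q + dist_H q r"
proof -
  have "splits h p r \<longleftrightarrow> splits h p q \<noteq> splits h q r" if "h \<in> H" for h
    using r that by (intro splits_trans) (auto simp: regular_def)
  then have "split_set H p r = split_set H p q \<union> split_set H q r" "split_set H p q \<inter> split_set H q r = {}"
    using d by (auto simp: split_set_def)
  then show ?thesis by (simp add: card_Un_disjoint finite_split_set fin)
qed

lemma dist_H_cong:
  assumes r: "regular H p" "regular H p'" "regular H q" "regular H q'"
    and e: "split_set H p p' = {}" "split_set H q q' = {}"
  shows "split_set H p q = split_set H p' q'"
proof -
  have "splits h p q \<longleftrightarrow> splits h p' q'" if h: "h \<in> H" for h
  proof -
    have z: "h p \<noteq> 0" "h p' \<noteq> 0" "h q \<noteq> 0" "h q' \<noteq> 0" using r h by (auto simp: regular_def)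
    show ?thesis
      using splits_trans[of h p p' q, OF z(1,2,3)] splits_trans[of h p' q' q, OF z(2) z(4) z(3)] e h
      unfolding split_set_def using splits_sym[of h q q'] by blast
  qed
  then show ?thesis by (auto simp: split_set_def)
qed

lemma adjacent_split_set:
  assumes "h \<in> H" "adjacent H h p q"
  shows "split_set H p q = {h, \<lambda>x. - h x}" "dist_H p q = 2"
proof -
  show s: "split_set H p q = {h, \<lambda>x. - h x}"
    using assms form_neg by (auto simp: split_set_def adjacent_def)
  have "h p \<noteq> 0" using assms(2) by (auto simp: adjacent_def splits_def)
  then have "h \<noteq> (\<lambda>x. - h x)" by (metis neg_equal_zero)
  then show "dist_H p q = 2" by (simp add: s)
qed

lemma adjacent_dist:
  assumes h: "h \<in> H" "adjacent H h p r" and reg: "regular H p" "regular H r" "regular H q"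
  shows "splits h p q \<Longrightarrow> dist_H p q = dist_H r q + 2"
    and "\<not> splits h p q \<Longrightarrow> dist_H r q = dist_H p q + 2"
proof -
  have only: "h' = h \<or> h' = (\<lambda>x. - h x)" if "h' \<in> H" "splits h' p r" for h'
    using that h by (auto simp: adjacent_def)
  have hpr: "splits h p r" using h by (simp add: adjacent_def)
  have z: "h p \<noteq> 0" "h q \<noteq> 0" "h r \<noteq> 0" using reg h by (auto simp: regular_def)
  have t: "splits h p q \<longleftrightarrow> \<not> splits h r q" using splits_trans[of h p r q, OF z(1,3,2)] hpr by blast
  { assume "splits h p q"
    then have "dist_H p q = dist_H p r + dist_H r q"
      using only t by (intro dist_H_additive reg) fastforce
    then show "dist_H p q = dist_H r q + 2" using adjacent_split_set[OF h] by simp }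
  { assume "\<not> splits h p q"
    moreover have "splits h' p q \<longleftrightarrow> splits h p q" if "h' \<in> H" "splits h' r p" for h'
      using only[of h'] that splits_sym[of h' r p] by auto
    ultimately have "dist_H r q = dist_H r p + dist_H p q"
      by (intro dist_H_additive reg) blast
    then show "dist_H r q = dist_H p q + 2" using adjacent_split_set[OF h] split_set_sym[of H r p] by simp }
qed

section \<open>The base alcove and the length function\<close>

definition base_pt :: "real^'n" where
  "base_pt = (1 / (1 + (\<Sum>\<alpha>\<in>\<Phi>. \<bar>\<alpha> \<bullet> z\<bar>))) *\<^sub>R z"

lemma base_in: "base_pt \<in> fund_alcove \<Phi> z"
  unfolding fund_alcove_def
proof (intro CollectI ballI)
  fix \<alpha> assume a: "\<alpha> \<in> pos"
  then have az: "0 < \<alpha> \<bullet> z" "\<alpha> \<in> \<Phi>" by (auto simp: posroots_def)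
  \<comment> \<open>The extra 1 in the denominator of \<open>base_pt\<close> turns this bound into a
    strict one and keeps the denominator positive.\<close>
  have "\<bar>\<alpha> \<bullet> z\<bar> \<le> (\<Sum>\<alpha>\<in>\<Phi>. \<bar>\<alpha> \<bullet> z\<bar>)" using fin az by (intro member_le_sum) auto
  then show "0 < \<alpha> \<bullet> base_pt \<and> \<alpha> \<bullet> base_pt < 1"
    using az by (simp add: base_pt_def field_simps)
qed

lemma pos_or_neg: "\<alpha> \<in> \<Phi> \<Longrightarrow> \<alpha> \<in> pos \<or> - \<alpha> \<in> pos"
  using zreg neg[of \<alpha>] unfolding posroots_def by (cases "0 < \<alpha> \<bullet> z") (auto simp: linorder_neq_iff)

lemma pos_not_neg: "\<alpha> \<in> pos \<Longrightarrow> - \<alpha> \<notin> pos"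
  by (auto simp: posroots_def)

lemma alcove_side:
  assumes x: "x \<in> fund_alcove \<Phi> z" "y \<in> fund_alcove \<Phi> z" and h: "h \<in> H" shows "0 < h x * h y"
proof -
  have main: "0 < (\<alpha> \<bullet> x - of_int k) * (\<alpha> \<bullet> y - of_int k)" if "\<alpha> \<in> pos" for \<alpha> and k :: int
  proof -
    have v: "0 < \<alpha> \<bullet> x" "\<alpha> \<bullet> x < 1" "0 < \<alpha> \<bullet> y" "\<alpha> \<bullet> y < 1" using x that by (auto simp: fund_alcove_def)
    have "k \<le> 0 \<or> 1 \<le> k" by linarith
    then have "of_int k \<le> (0::real) \<or> 1 \<le> (of_int k :: real)" by simp
    then show ?thesis using v by (elim disjE) (auto intro: mult_pos_pos mult_neg_neg)
  qed
  obtain \<alpha> k where h: "h = (\<lambda>x. \<alpha> \<bullet> x - of_int k)" "\<alpha> \<in> \<Phi>" by (rule affine_formsE[OF h])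
  from pos_or_neg[OF h(2)] show ?thesis
  proof
    assume "\<alpha> \<in> pos" then show ?thesis using main by (simp add: h)
  next
    assume "- \<alpha> \<in> pos"
    from main[OF this, of "- k"] have "0 < (- (\<alpha> \<bullet> x - of_int k)) * (- (\<alpha> \<bullet> y - of_int k))" by simp
    then show ?thesis by (simp only: h minus_mult_minus)
  qed
qed

lemma base_regular: "regular H base_pt"
  unfolding regular_def
proof
  fix h assume "h \<in> H"
  then show "h base_pt \<noteq> 0" using alcove_side[OF base_in base_in, of h] by auto
qed

text \<open>No hyperplane meets the fundamental alcove, so separating alcoves is the same as
  separating base points. \<open>len\<close> uses positive roots only; the negatives repeat the same
  hyperplanes, whence the factor 2.\<close>

lemma len_dist:
  assumes w: "w \<in> W" shows "2 * len \<Phi> z w = dist_H base_pt (w base_pt)"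
proof -
  let ?A = "fund_alcove \<Phi> z"
  define f where "f = (\<lambda>(\<alpha>::real^'n, k::int) x. \<alpha> \<bullet> x - of_int k)"
  define P where "P = {(\<alpha>, k). \<alpha> \<in> pos \<and> splits (f (\<alpha>, k)) base_pt (w base_pt)}"
  have sep: "separates ?A (w ` ?A) \<alpha> k \<longleftrightarrow> splits (f (\<alpha>, k)) base_pt (w base_pt)" if a: "\<alpha> \<in> pos" for \<alpha> k
  proof -
    let ?h = "f (\<alpha>, k)"
    have hH: "?h \<in> H" using a unfolding f_def affine_forms_def posroots_def by auto
    have s1: "0 < ?h x * ?h base_pt" if "x \<in> ?A" for x using alcove_side[OF that base_in hH] .
    have s2: "0 < ?h (w x) * ?h (w base_pt)" if "x \<in> ?A" for x
      using alcove_side[OF that base_in form_pull[OF w hH]] .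
    show ?thesis
    proof
      assume "separates ?A (w ` ?A) \<alpha> k"
      then have "(\<alpha> \<bullet> base_pt < of_int k \<and> of_int k < \<alpha> \<bullet> w base_pt) \<or> (of_int k < \<alpha> \<bullet> base_pt \<and> \<alpha> \<bullet> w base_pt < of_int k)"
        unfolding separates_def using base_in by blast
      then show "splits ?h base_pt (w base_pt)" by (auto simp: f_def splits_def mult_less_0_iff)
    next
      assume "splits ?h base_pt (w base_pt)"
      then consider "?h base_pt < 0" "0 < ?h (w base_pt)" | "0 < ?h base_pt" "?h (w base_pt) < 0"
        by (auto simp: splits_def mult_less_0_iff)
      then show "separates ?A (w ` ?A) \<alpha> k"
      proof cases
        case 1
        then have "\<forall>x\<in>?A. ?h x < 0" "\<forall>x\<in>?A. 0 < ?h (w x)"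
          using s1 s2 by (auto simp: zero_less_mult_iff)
        then show ?thesis unfolding separates_def f_def by auto
      next
        case 2
        then have "\<forall>x\<in>?A. 0 < ?h x" "\<forall>x\<in>?A. ?h (w x) < 0"
          using s1 s2 by (auto simp: zero_less_mult_iff)
        then show ?thesis unfolding separates_def f_def by auto
      qed
    qed
  qed
  have lP: "len \<Phi> z w = card P"
    unfolding len_def P_def by (intro arg_cong[of _ _ card] Collect_cong) (auto simp: sep)
  have inj: "inj_on f P"
  proof (rule inj_onI)
    fix p q assume e: "f p = f q"
    obtain \<alpha> k \<beta> l where pq: "p = (\<alpha>, k)" "q = (\<beta>, l)" by (cases p, cases q)
    show "p = q" using forms_inj[of \<alpha> k \<beta> l] e unfolding pq f_def prod.case by blast
  qed
  have injn: "inj_on (\<lambda>p x. - f p x) P"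
  proof (rule inj_onI)
    fix p q assume "p \<in> P" "q \<in> P" "(\<lambda>x. - f p x) = (\<lambda>x. - f q x)"
    then have "- f p x = - f q x" for x by meson
    then have "f p = f q" by (intro ext) simp
    then show "p = q" using inj \<open>p \<in> P\<close> \<open>q \<in> P\<close> by (simp add: inj_on_eq_iff)
  qed
  have negf: "(\<lambda>x. - f (\<alpha>, k) x) = f (- \<alpha>, - k)" for \<alpha> k by (simp add: f_def fun_eq_iff)
  have fH: "\<alpha> \<in> \<Phi> \<Longrightarrow> f (\<alpha>, k) \<in> H" for \<alpha> k by (auto simp: f_def affine_forms_def)
  have un: "split_set H base_pt (w base_pt) = f ` P \<union> (\<lambda>p x. - f p x) ` P"
  proof
    show "split_set H base_pt (w base_pt) \<subseteq> f ` P \<union> (\<lambda>p x. - f p x) ` P"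
    proof
      fix h assume h: "h \<in> split_set H base_pt (w base_pt)"
      then obtain \<alpha> k where hf: "h = f (\<alpha>, k)" "\<alpha> \<in> \<Phi>" by (force simp: split_set_def f_def elim: affine_formsE)
      have sp: "splits h base_pt (w base_pt)" using h by (simp add: split_set_def)
      from pos_or_neg[OF hf(2)] show "h \<in> f ` P \<union> (\<lambda>p x. - f p x) ` P"
      proof
        assume "\<alpha> \<in> pos"
        then have "(\<alpha>, k) \<in> P" using sp by (simp add: P_def hf)
        then show ?thesis using hf by blast
      next
        assume n: "- \<alpha> \<in> pos"
        have "h = (\<lambda>x. - f (- \<alpha>, - k) x)" by (simp add: negf hf)
        moreover have "splits (f (- \<alpha>, - k)) base_pt (w base_pt)"
          using sp unfolding hf(1) by (simp only: negf[symmetric] splits_neg)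
        then have "(- \<alpha>, - k) \<in> P" using n by (simp add: P_def)
        ultimately show ?thesis by blast
      qed
    qed
    show "f ` P \<union> (\<lambda>p x. - f p x) ` P \<subseteq> split_set H base_pt (w base_pt)"
    proof -
      have "f p \<in> split_set H base_pt (w base_pt) \<and> (\<lambda>x. - f p x) \<in> split_set H base_pt (w base_pt)"
        if p: "p \<in> P" for p
      proof -
        obtain \<alpha> k where "p = (\<alpha>, k)" by (cases p)
        then have "f p \<in> H" "splits (f p) base_pt (w base_pt)" using p fH by (simp_all add: P_def posroots_def)
        then show ?thesis using form_neg by (simp add: split_set_def)
      qed
      then show ?thesis by blast
    qed
  qed
  have disj: "f ` P \<inter> (\<lambda>p x. - f p x) ` P = {}"
  proof -
    have "f (\<alpha>, k) \<noteq> (\<lambda>x. - f (\<beta>, l) x)" if "\<alpha> \<in> pos" "\<beta> \<in> pos" for \<alpha> \<beta> k l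
    proof
      assume "f (\<alpha>, k) = (\<lambda>x. - f (\<beta>, l) x)"
      then have "f (\<alpha>, k) = f (- \<beta>, - l)" by (simp only: negf)
      then have "\<alpha> = - \<beta>" using forms_inj[of \<alpha> k "- \<beta>" "- l"] by (simp add: f_def)
      then show False using that pos_not_neg by blast
    qed
    then have "f p \<noteq> (\<lambda>x. - f q x)" if "p \<in> P" "q \<in> P" for p q
      using that by (cases p, cases q) (simp add: P_def)
    then show ?thesis by blast
  qed
  have "finite (f ` P)" "finite ((\<lambda>p x. - f p x) ` P)"
    using un finite_split_set[OF fin, of base_pt "w base_pt"] by auto
  then have "dist_H base_pt (w base_pt) = card (f ` P) + card ((\<lambda>p x. - f p x) ` P)"
    unfolding un using disj by (rule card_Un_disjoint)
  then show ?thesis by (simp add: lP card_image inj injn)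
qed

lemma len_conj_dist:
  assumes "x \<in> W" "y \<in> W"
  shows "2 * len \<Phi> z (inv x \<circ> y) = dist_H (x base_pt) (y base_pt)"
proof -
  have "2 * len \<Phi> z (inv x \<circ> y) = dist_H base_pt (inv x (y base_pt))"
    using len_dist[OF W_comp[OF W_inverse(2)[OF assms(1)] assms(2)]] by simp
  also have "\<dots> = dist_H (x base_pt) (x (inv x (y base_pt)))" by (rule dist_H_image[OF assms(1), symmetric])
  finally show ?thesis using assms by simp
qed

section \<open>Walls of alcoves and transitivity on alcoves\<close>

lemma forms_proportional:
  assumes "h \<in> H" "h' \<in> H" "\<And>x. h' x = c * h x"
  shows "h' = h \<or> h' = (\<lambda>x. - h x)"
proof -
  \<comment> \<open>The arrangement with trivial \<open>w\<close> suffices, because the claim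
    concerns the forms alone.\<close>
  have "periodic_arrangement \<Phi> id 0 1 id id"
    by unfold_locales (use fin nz neg reduced linear_id in auto)
  then show ?thesis using assms by (rule periodic_arrangement.forms_proportional)
qed

text \<open>The wall is the first one crossed on the segment from \<open>p\<close> to a point
  \<open>q'\<close> of the alcove of \<open>q\<close>; \<open>q'\<close> is generic so that this
  wall is crossed alone, and \<open>r\<close> lies just behind it.\<close>

lemma exists_adjacent:
  assumes reg: "regular H p" "regular H q" and ne: "split_set H p q \<noteq> {}"
  shows "\<exists>h\<in>H. \<exists>r. regular H r \<and> splits h p q \<and> adjacent H h p r"
proof -
  \<comment> \<open>A zero of such a function at \<open>q'\<close> means that \<open>h1\<close> and
    \<open>h2\<close> are crossed at the same parameter.\<close>
  define B where "B = (\<lambda>(h1, h2) u. h1 p * h2 u - h2 p * h1 u) ` (H \<times> H)"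
  have cH: "countable H"
  proof -
    have "H = (\<lambda>(\<alpha>, k::int) x. \<alpha> \<bullet> x - of_int k) ` (\<Phi> \<times> UNIV)" by (auto simp: affine_forms_def)
    then show ?thesis using fin by (auto intro: countable_finite)
  qed
  have "negligible {x. \<exists>g\<in>B. g x = 0 \<and> (\<exists>u. g u \<noteq> 0)}"
  proof (rule negligible_nongeneric)
    show "countable B" unfolding B_def using cH by (intro countable_image countable_SIGMA)
    fix g assume "g \<in> B"
    then obtain h1 h2 where g: "h1 \<in> H" "h2 \<in> H" "g = (\<lambda>u. h1 p * h2 u - h2 p * h1 u)" by (auto simp: B_def)
    obtain \<alpha> k where h1: "h1 = (\<lambda>x. \<alpha> \<bullet> x - of_int k)" "\<alpha> \<in> \<Phi>" by (rule affine_formsE[OF g(1)])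
    obtain \<beta> l where h2: "h2 = (\<lambda>x. \<beta> \<bullet> x - of_int l)" "\<beta> \<in> \<Phi>" by (rule affine_formsE[OF g(2)])
    show "affine_fun g"
    proof (rule affine_funI)
      show "linear (\<lambda>u. h1 p * (\<beta> \<bullet> u) - h2 p * (\<alpha> \<bullet> u))"
        by (auto intro!: linearI simp: inner_simps algebra_simps)
      show "g x = (h1 p * (\<beta> \<bullet> x) - h2 p * (\<alpha> \<bullet> x)) + (h2 p * of_int k - h1 p * of_int l)" for x
        unfolding g(3) by (simp add: h1 h2 algebra_simps)
    qed
  qed
  moreover have "\<forall>\<^sub>F x in nhds q. \<forall>h\<in>H. h q \<noteq> 0 \<longrightarrow> 0 < h x * h q"
    by (rule eventually_same_side[OF fin]) (intro tendsto_inner tendsto_const filterlim_ident)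
  then obtain S where S: "open S" "q \<in> S" "\<forall>x\<in>S. \<forall>h\<in>H. h q \<noteq> 0 \<longrightarrow> 0 < h x * h q"
    unfolding eventually_nhds by blast
  ultimately obtain q' where q': "q' \<in> S" and "q' \<notin> {x. \<exists>g\<in>B. g x = 0 \<and> (\<exists>u. g u \<noteq> 0)}"
    using open_minus_negligible[OF S(1,2)] by meson
  then have gen: "\<forall>g\<in>B. g q' = 0 \<longrightarrow> (\<forall>u. g u = 0)" by simp
  have qq: "0 < h q' * h q" if "h \<in> H" for h using S(3) q' reg(2) that by (auto simp: regular_def)
  have qz: "h q' \<noteq> 0" "h p \<noteq> 0" if "h \<in> H" for h using qq[OF that] reg(1) that by (auto simp: regular_def)
  have sq: "splits h p q' \<longleftrightarrow> splits h p q" if "h \<in> H" for h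
    using qq[OF that] unfolding splits_def zero_less_mult_iff mult_less_0_iff by linarith
  have par: "h2 = h1 \<or> h2 = (\<lambda>x. - h1 x)" if hh: "h1 \<in> H" "h2 \<in> H" "h1 p * h2 q' = h2 p * h1 q'" for h1 h2
  proof -
    have "(\<lambda>u. h1 p * h2 u - h2 p * h1 u) \<in> B" unfolding B_def using hh(1,2) by force
    from bspec[OF gen this] have "h1 p * h2 u = h2 p * h1 u" for u using hh(3) by simp
    then have "h2 u = (h2 p / h1 p) * h1 u" for u using qz(2)[OF hh(1)] by (simp add: field_simps)
    then show ?thesis by (rule forms_proportional[OF hh(1,2)])
  qed
  define S1 where "S1 = split_set H p q"
  \<comment> \<open>The parameter at which the segment from \<open>p\<close> to \<open>q'\<close>
    crosses the wall \<open>h\<close>.\<close>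
  define t where "t h = h p / (h p - h q')" for h :: "real^'n \<Rightarrow> real"
  have fS: "finite S1" unfolding S1_def by (rule finite_split_set[OF fin])
  have S1: "h \<in> H" "h p * h q' < 0" if "h \<in> S1" for h
    using that sq unfolding S1_def split_set_def splits_def by auto
  have t01: "0 < t h" "t h < 1" and nzd: "h p - h q' \<noteq> 0" if "h \<in> S1" for h
    using S1(2)[OF that] by (auto simp: t_def mult_less_0_iff field_simps)
  obtain h0 where h0: "h0 \<in> S1" "\<And>h. h \<in> S1 \<Longrightarrow> t h0 \<le> t h"
    using ex_min_if_finite[of "t ` S1"] fS ne unfolding S1_def[symmetric]
    by (metis (no_types, opaque_lifting) arg_min_if_finite(1) arg_min_if_finite(2) linorder_not_less)
  define S2 where "S2 = {h\<in>S1. h \<noteq> h0 \<and> h \<noteq> (\<lambda>x. - h0 x)}"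
  have later: "t h0 < t h" if "h \<in> S2" for h
  proof -
    have hS: "h \<in> S1" using that by (simp add: S2_def)
    have "t h \<noteq> t h0"
    proof
      assume "t h = t h0"
      then have "h p * (h0 p - h0 q') = h0 p * (h p - h q')"
        using nzd[OF hS] nzd[OF h0(1)] by (simp add: t_def field_simps)
      then have "h0 p * h q' = h p * h0 q'" by (simp add: algebra_simps)
      then show False using par[OF S1(1)[OF h0(1)] S1(1)[OF hS]] that by (auto simp: S2_def)
    qed
    then show ?thesis using h0(2)[OF hS] by simp
  qed
  \<comment> \<open>The next crossing, or the end of the segment if there is none;
    \<open>insert 1\<close> keeps the minimum defined.\<close>
  define t2 where "t2 = Min (insert 1 (t ` S2))"
  have fS2: "finite (insert 1 (t ` S2))" using fS by (simp add: S2_def)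
  have t2: "t h0 < t2" "t2 \<le> 1" "\<And>h. h \<in> S2 \<Longrightarrow> t2 \<le> t h"
    using fS2 later t01(2)[OF h0(1)] unfolding t2_def by (auto simp: Min_gr_iff)
  define m where "m = (t h0 + t2) / 2"
  have m: "t h0 < m" "m < t2" "0 < m" "m < 1" using t2 t01(1)[OF h0(1)] by (auto simp: m_def field_simps)
  define r where "r = (1 - m) *\<^sub>R p + m *\<^sub>R q'"
  have hr: "h r = (1 - m) * h p + m * h q'" if HH: "h \<in> H" for h
  proof -
    obtain \<alpha> k where h: "h = (\<lambda>x. \<alpha> \<bullet> x - of_int k)" "\<alpha> \<in> \<Phi>" by (rule affine_formsE[OF HH])
    show ?thesis by (simp add: h r_def inner_add_right inner_scaleR_right algebra_simps)
  qed
  have hr': "h r = (h p - h q') * (t h - m)" if "h \<in> S1" for h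
    using nzd[OF that] unfolding hr[OF S1(1)[OF that]] t_def by (simp add: field_simps)
  have side: "0 < h p * h r" if hH: "h \<in> H" and nh: "h \<noteq> h0" "h \<noteq> (\<lambda>x. - h0 x)" for h
  proof (cases "h \<in> S1")
    case True
    then have "h \<in> S2" using nh by (simp add: S2_def)
    then have "0 < t h - m" using t2(3)[of h] m by linarith
    moreover have "0 < h p * (h p - h q')"
      using S1(2)[OF True] unfolding right_diff_distrib by (smt (verit) zero_le_square)
    ultimately have "0 < (h p * (h p - h q')) * (t h - m)" by (rule mult_pos_pos[rotated])
    then show ?thesis unfolding hr'[OF True] by (simp add: mult.assoc)
  next
    case False
    then have "\<not> splits h p q'" using hH sq by (simp add: S1_def split_set_def)
    then have "0 \<le> h p * h q'" by (simp add: splits_def)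
    moreover have "0 < h p * h p" using qz(2)[OF hH] by (metis not_real_square_gt_zero)
    ultimately have "0 < (1 - m) * (h p * h p) + m * (h p * h q')"
      using m by (intro add_pos_nonneg[OF mult_pos_pos[of "1 - m"] mult_nonneg_nonneg[of m]]) auto
    then show ?thesis unfolding hr[OF hH] by (simp add: algebra_simps)
  qed
  have sp0: "splits h0 p r"
  proof -
    have "0 < h0 p * (h0 p - h0 q')"
      using S1(2)[OF h0(1)] unfolding right_diff_distrib by (smt (verit) zero_le_square)
    then have "(h0 p * (h0 p - h0 q')) * (t h0 - m) < 0" using m by (intro mult_pos_neg) auto
    then show ?thesis unfolding splits_def hr'[OF h0(1)] by (simp add: mult.assoc)
  qed
  have "regular H r"
    unfolding regular_def
  proof
    fix h assume hH: "h \<in> H"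
    show "h r \<noteq> 0"
    proof (cases "h = h0 \<or> h = (\<lambda>x. - h0 x)")
      case True
      then show ?thesis using sp0 by (auto simp: splits_def)
    next
      case False
      then show ?thesis using side[OF hH] by auto
    qed
  qed
  moreover have "adjacent H h0 p r"
    unfolding adjacent_def using sp0 side by (force simp: splits_def)
  moreover have "splits h0 p q" "h0 \<in> H" using h0(1) by (auto simp: S1_def split_set_def)
  ultimately show ?thesis by blast
qed

text \<open>The segment from \<open>p\<close> to \<open>r\<close> meets the wall in a point
  \<open>e\<close> that the reflection fixes and that lies on no other hyperplane. For every other
  form, \<open>r\<close> is on the side of \<open>e\<close>, and so is the reflected
  \<open>p\<close>.\<close>

lemma adjacent_reflect:
  assumes reg: "regular H p" "regular H r" and a: "\<alpha> \<in> \<Phi>"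
    and adj: "adjacent H (\<lambda>x. \<alpha> \<bullet> x - of_int k) p r"
  shows "split_set H (aff_refl cor \<alpha> k p) r = {}"
proof -
  let ?s = "aff_refl cor \<alpha> k"
  define h where "h = (\<lambda>x. \<alpha> \<bullet> x - of_int k)"
  have hs: "h (?s x) = - h x" for x unfolding h_def by (rule aff_refl_form[OF a])
  have hpr: "h p * h r < 0" using adj by (simp add: adjacent_def splits_def h_def)
  have only: "h' = h \<or> h' = (\<lambda>x. - h x)" if "h' \<in> H" "splits h' p r" for h'
    using adj that by (auto simp: adjacent_def h_def)
  define t where "t = h p / (h p - h r)"
  have nzd: "h p - h r \<noteq> 0" using hpr by (auto simp: mult_less_0_iff)
  have t: "0 < t" "t < 1" using hpr by (auto simp: t_def mult_less_0_iff field_simps)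
  define e where "e = (1 - t) *\<^sub>R p + t *\<^sub>R r"
  have he: "g e = (1 - t) * g p + t * g r" if HH: "g \<in> H" for g
  proof -
    obtain \<beta> l where g: "g = (\<lambda>x. \<beta> \<bullet> x - of_int l)" "\<beta> \<in> \<Phi>" by (rule affine_formsE[OF HH])
    show ?thesis by (simp add: g e_def inner_add_right inner_scaleR_right algebra_simps)
  qed
  have hH: "h \<in> H" using a by (auto simp: h_def affine_forms_def)
  have "h e = h p - t * (h p - h r)" unfolding he[OF hH] by (simp add: algebra_simps)
  then have "h e = 0" using nzd by (simp add: t_def)
  then have se: "?s e = e" by (simp add: aff_refl_def h_def)
  have pe: "0 < g p * g e" "0 < g r * g e" if g: "g \<in> H" "g \<noteq> h" "g \<noteq> (\<lambda>x. - h x)" for g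
  proof -
    have z: "g p \<noteq> 0" "g r \<noteq> 0" using reg g(1) by (auto simp: regular_def)
    have "\<not> splits g p r" using only g by blast
    then have pr: "0 < g p * g r" using z by (simp add: splits_def not_less order.strict_iff_order)
    have sq: "0 < g p * g p" "0 < g r * g r" using z by (metis not_real_square_gt_zero)+
    have t': "0 < 1 - t" using t by simp
    have "0 < (1 - t) * (g p * g p) + t * (g p * g r)"
      by (rule add_pos_pos[OF mult_pos_pos[OF t' sq(1)] mult_pos_pos[OF t(1) pr]])
    then show "0 < g p * g e" unfolding he[OF g(1)] by (simp add: algebra_simps)
    have "0 < (1 - t) * (g p * g r) + t * (g r * g r)"
      by (rule add_pos_pos[OF mult_pos_pos[OF t' pr] mult_pos_pos[OF t(1) sq(2)]])
    then show "0 < g r * g e" unfolding he[OF g(1)] by (simp add: algebra_simps)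
  qed
  have "\<not> splits g (?s p) r" if g: "g \<in> H" for g
  proof (cases "g = h \<or> g = (\<lambda>x. - h x)")
    case True
    then have "g (?s p) * g r = - (h p * h r)" using hs by auto
    then show ?thesis using hpr by (simp add: splits_def)
  next
    case False
    have inv: "g = (\<lambda>x. g (?s (?s x)))" by (simp add: aff_refl_involution[OF a])
    have n1: "(\<lambda>x. g (?s x)) \<noteq> h"
    proof
      assume "(\<lambda>x. g (?s x)) = h"
      then have "g = (\<lambda>x. - h x)" using inv hs by (metis (no_types))
      then show False using False by blast
    qed
    have n2: "(\<lambda>x. g (?s x)) \<noteq> (\<lambda>x. - h x)"
    proof
      assume "(\<lambda>x. g (?s x)) = (\<lambda>x. - h x)"
      then have "g x = h x" for x using fun_cong[of _ _ "?s x"] inv hs by (metis (no_types) minus_minus)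
      then show False using False by blast
    qed
    have "0 < g (?s p) * g (?s e)" using pe(1)[OF form_pull[OF aff_refl_W[OF a] g] n1 n2] .
    then have "0 < g (?s p) * g e" by (simp add: se)
    then have "0 < g (?s p) * g r" using pos_mult_trans pe(2)[OF g] False by blast
    then show ?thesis by (simp add: splits_def)
  qed
  then show ?thesis by (auto simp: split_set_def)
qed

text \<open>Folding towards the base alcove: a reflection in a wall that separates \<open>q\<close>
  from the base point brings \<open>q\<close> nearer, since the distance from the base to the
  reflected \<open>q\<close> equals that from the neighbouring alcove to \<open>q\<close>.\<close>

lemma alcove_exists:
  assumes "regular H q" shows "\<exists>x\<in>W. split_set H (x base_pt) q = {}"
  using assms
proof (induction "dist_H base_pt q" arbitrary: q rule: less_induct)
  case less
  show ?case
  proof (cases "split_set H base_pt q = {}")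
    case True
    then show ?thesis using W_id by (intro bexI[of _ id]) auto
  next
    case False
    then obtain h r where h: "h \<in> H" "regular H r" "splits h base_pt q" "adjacent H h base_pt r"
      using exists_adjacent[OF base_regular less.prems] by blast
    obtain \<alpha> k where hk: "h = (\<lambda>x. \<alpha> \<bullet> x - of_int k)" "\<alpha> \<in> \<Phi>" by (rule affine_formsE[OF h(1)])
    let ?s = "aff_refl cor \<alpha> k"
    have s: "?s \<in> W" by (rule aff_refl_W[OF hk(2)])
    have e: "split_set H (?s base_pt) r = {}"
      using adjacent_reflect[OF base_regular h(2) hk(2)] h(4) hk(1) by blast
    have rs: "regular H (?s base_pt)" "regular H (?s q)" using regular_image[OF s] base_regular less.prems by auto
    have "dist_H base_pt (?s q) = dist_H (?s base_pt) (?s (?s q))" by (rule dist_H_image[OF s, symmetric])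
    also have "\<dots> = dist_H (?s base_pt) q" by (simp add: aff_refl_involution[OF hk(2)])
    also have "\<dots> = dist_H r q"
      using dist_H_cong[OF rs(1) h(2) less.prems less.prems e] by (simp add: split_set_def splits_def mult_less_0_iff)
    finally have "dist_H base_pt (?s q) < dist_H base_pt q"
      using adjacent_dist(1)[OF h(1,4) base_regular h(2) less.prems h(3)] by simp
    then obtain x where x: "x \<in> W" "split_set H (x base_pt) (?s q) = {}" using less.hyps rs(2) by blast
    have "dist_H (?s (x base_pt)) (?s (?s q)) = 0" unfolding dist_H_image[OF s] using x by simp
    then have "split_set H ((?s \<circ> x) base_pt) q = {}"
      by (simp add: aff_refl_involution[OF hk(2)] finite_split_set[OF fin])
    then show ?thesis using W_comp[OF s x(1)] by blast
  qed
qed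

end

section \<open>Conjugation steps in the Hecke algebra\<close>

text \<open>\<open>f\<close> is the Gram operator of the roots, whose kernel is exactly their common
  kernel; composed with a section over its range it forgets that kernel and nothing else.\<close>

lemma root_projection_exists:
  fixes \<Phi> :: "'a::euclidean_space set"
  assumes "finite \<Phi>"
  shows "\<exists>P. linear P \<and> (\<forall>\<alpha>\<in>\<Phi>. \<forall>x. \<alpha> \<bullet> P x = \<alpha> \<bullet> x) \<and> (\<forall>x. (\<forall>\<alpha>\<in>\<Phi>. \<alpha> \<bullet> x = 0) \<longrightarrow> P x = 0)"
proof -
  define f where "f x = (\<Sum>\<alpha>\<in>\<Phi>. (\<alpha> \<bullet> x) *\<^sub>R \<alpha>)" for x
  have lf: "linear f"
    unfolding f_def by (rule linearI) (simp_all add: inner_simps scaleR_left_distrib sum.distrib scaleR_sum_right)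
  have ker: "\<alpha> \<bullet> x = 0" if "f x = 0" "\<alpha> \<in> \<Phi>" for x \<alpha>
  proof -
    have "(\<Sum>\<alpha>\<in>\<Phi>. (\<alpha> \<bullet> x) * (\<alpha> \<bullet> x)) = f x \<bullet> x" by (simp add: f_def inner_sum_left)
    then have "(\<Sum>\<alpha>\<in>\<Phi>. (\<alpha> \<bullet> x) * (\<alpha> \<bullet> x)) = 0" by (simp add: that)
    then show ?thesis using assms that(2) by (subst (asm) sum_nonneg_eq_0_iff) auto
  qed
  obtain g where g: "linear g" "\<forall>v\<in>f ` UNIV. f (g v) = v"
    using linear_exists_right_inverse_on[OF lf subspace_UNIV] by blast
  show ?thesis
  proof (intro exI conjI ballI allI impI)
    show "linear (g \<circ> f)" by (rule linear_compose[OF lf g(1)])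
    fix \<alpha> x assume a: "\<alpha> \<in> \<Phi>"
    have "f ((g \<circ> f) x - x) = 0" using g(2) by (simp add: linear_diff[OF lf])
    from ker[OF this a] show "\<alpha> \<bullet> (g \<circ> f) x = \<alpha> \<bullet> x" by (simp add: inner_diff_right)
  next
    fix x assume "\<forall>\<alpha>\<in>\<Phi>. \<alpha> \<bullet> x = 0"
    then have "f x = 0" by (simp add: f_def)
    then show "(g \<circ> f) x = 0" by (simp add: linear_0[OF g(1)])
  qed
qed

context weyl_datum
begin

lemma G_pull:
  assumes "g \<in> G" "\<alpha> \<in> \<Phi>" shows "\<exists>\<beta>\<in>\<Phi>. \<forall>x. \<beta> \<bullet> x = \<alpha> \<bullet> g x"
proof -
  obtain g' where g': "g' \<in> G" "g' \<circ> g = id" using G_inverse[OF assms(1)] by blast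
  obtain \<beta> where b: "\<beta> \<in> \<Phi>" "\<And>x. \<beta> \<bullet> g' x = \<alpha> \<bullet> x" using G_props[OF g'(1)] assms(2) by blast
  have "\<beta> \<bullet> x = \<alpha> \<bullet> g x" for x using b(2)[of "g x"] g'(2) by (simp add: fun_eq_iff)
  then show ?thesis using b(1) by blast
qed

text \<open>Powers of \<open>g\<close> act on the finite set of roots, so two of them act equally.
  Only root pairings are controlled; \<open>g\<close> itself may have infinite order.\<close>

lemma root_action_periodic:
  assumes g: "g \<in> G"
  shows "\<exists>N>0. \<forall>\<alpha>\<in>\<Phi>. \<forall>x. \<alpha> \<bullet> (g ^^ N) x = \<alpha> \<bullet> x"
proof -
  have pG: "g ^^ n \<in> G" for n
  proof (induction n)
    case 0
    show ?case unfolding funpow.simps by (rule lg_id)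
  next
    case (Suc n)
    then show ?case unfolding funpow.simps by (rule G_comp[OF g])
  qed
  define \<pi> where "\<pi> n \<alpha> = (SOME \<beta>. \<beta> \<in> \<Phi> \<and> (\<forall>x. \<beta> \<bullet> x = \<alpha> \<bullet> (g ^^ n) x))" for n \<alpha>
  have p: "\<pi> n \<alpha> \<in> \<Phi>" "\<And>x. \<pi> n \<alpha> \<bullet> x = \<alpha> \<bullet> (g ^^ n) x" if "\<alpha> \<in> \<Phi>" for n \<alpha>
  proof -
    have "\<exists>\<beta>. \<beta> \<in> \<Phi> \<and> (\<forall>x. \<beta> \<bullet> x = \<alpha> \<bullet> (g ^^ n) x)" using G_pull[OF pG that] by blast
    from someI_ex[OF this] show "\<pi> n \<alpha> \<in> \<Phi>" "\<And>x. \<pi> n \<alpha> \<bullet> x = \<alpha> \<bullet> (g ^^ n) x" unfolding \<pi>_def by auto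
  qed
  have "range (\<lambda>n. restrict (\<pi> n) \<Phi>) \<subseteq> (\<Phi> \<rightarrow>\<^sub>E \<Phi>)" using p(1) by auto
  then have "finite (range (\<lambda>n. restrict (\<pi> n) \<Phi>))" using fin finite_PiE finite_subset by metis
  then have "\<not> inj (\<lambda>n. restrict (\<pi> n) \<Phi>)" using range_inj_infinite by blast
  then obtain i j where "i \<noteq> j" "restrict (\<pi> i) \<Phi> = restrict (\<pi> j) \<Phi>" by (auto simp: inj_def)
  then obtain i j where ij: "i < j" "restrict (\<pi> i) \<Phi> = restrict (\<pi> j) \<Phi>" by (metis linorder_neqE_nat)
  obtain g' where g': "g \<circ> g' = id" using G_inverse[OF g] by blast
  have gg: "(g ^^ n) ((g' ^^ n) x) = x" for n x
  proof (induction n arbitrary: x)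
    case (Suc n)
    have "(g ^^ Suc n) ((g' ^^ Suc n) x) = (g ^^ n) (g (g' ((g' ^^ n) x)))" by (simp add: funpow_swap1)
    then show ?case using Suc g' by (simp add: fun_eq_iff)
  qed simp
  have "\<alpha> \<bullet> (g ^^ (j - i)) x = \<alpha> \<bullet> x" if a: "\<alpha> \<in> \<Phi>" for \<alpha> x
  proof -
    have "\<pi> i \<alpha> = \<pi> j \<alpha>" using fun_cong[OF ij(2), of \<alpha>] a by simp
    then have "\<alpha> \<bullet> (g ^^ i) y = \<alpha> \<bullet> (g ^^ j) y" for y using p(2)[OF a] by metis
    moreover have "(g ^^ j) y = (g ^^ (j - i)) ((g ^^ i) y)" for y
      using ij(1) funpow_add[of "j - i" i g] by (simp add: fun_eq_iff)
    ultimately have "\<alpha> \<bullet> (g ^^ i) y = \<alpha> \<bullet> (g ^^ (j - i)) ((g ^^ i) y)" for y by simp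
    from this[of "(g' ^^ i) x"] show ?thesis by (simp add: gg)
  qed
  then show ?thesis using ij(1) by (intro exI[of _ "j - i"]) auto
qed

text \<open>The linear part \<open>g\<close> of \<open>w\<close> need not have finite order on the common kernel of the roots,
  which is invisible to the hyperplanes; it is replaced by the identity there.\<close>

lemma periodic_arrangement_exists:
  assumes "w \<in> W" shows "\<exists>L lam N. periodic_arrangement \<Phi> L lam N w (inv w)"
proof -
  obtain g t where w: "g \<in> G" "t \<in> lattice" "w = (\<lambda>x. g x + t)" using assms by (rule WE)
  obtain P where P: "linear P" "\<And>\<alpha> x. \<alpha> \<in> \<Phi> \<Longrightarrow> \<alpha> \<bullet> P x = \<alpha> \<bullet> x"
      "\<And>x. (\<And>\<alpha>. \<alpha> \<in> \<Phi> \<Longrightarrow> \<alpha> \<bullet> x = 0) \<Longrightarrow> P x = 0"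
    using root_projection_exists[OF fin] by blast
  obtain N where N: "0 < N" "\<And>\<alpha> x. \<alpha> \<in> \<Phi> \<Longrightarrow> \<alpha> \<bullet> (g ^^ N) x = \<alpha> \<bullet> x"
    using root_action_periodic[OF w(1)] by blast
  have lg: "linear g" using G_props[OF w(1)] by blast
  define L where "L x = x - P x + P (g x)" for x
  have linL: "linear L"
    by (rule linearI) (simp_all add: L_def linear_add[OF lg] linear_add[OF P(1)] linear_scale[OF lg]
        linear_scale[OF P(1)] scaleR_diff_right scaleR_right_distrib)
  have aL: "\<alpha> \<bullet> L x = \<alpha> \<bullet> g x" if "\<alpha> \<in> \<Phi>" for \<alpha> x
    using that by (simp add: L_def inner_simps P(2))
  have aLn: "\<alpha> \<in> \<Phi> \<Longrightarrow> \<alpha> \<bullet> (L ^^ n) x = \<alpha> \<bullet> (g ^^ n) x" for n \<alpha> x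
  proof (induction n arbitrary: \<alpha>)
    case (Suc n)
    obtain \<beta> where b: "\<beta> \<in> \<Phi>" "\<And>x. \<beta> \<bullet> x = \<alpha> \<bullet> g x" using G_pull[OF w(1) Suc.prems] by blast
    show ?case using Suc.IH[OF b(1)] by (simp add: aL[OF Suc.prems] b(2))
  qed simp
  have Peq: "P x = P y" if "\<And>\<alpha>. \<alpha> \<in> \<Phi> \<Longrightarrow> \<alpha> \<bullet> x = \<alpha> \<bullet> y" for x y
    using P(3)[of "x - y"] that by (simp add: inner_diff_right linear_diff[OF P(1)])
  \<comment> \<open>\<open>L\<close> never moves the component \<open>x - P x\<close>, and
    \<open>P x\<close> depends only on root pairings; so periodicity on the roots becomes
    periodicity of \<open>L\<close>.\<close>
  have "(L ^^ n) x - P ((L ^^ n) x) = x - P x" for n x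
  proof (induction n)
    case (Suc n)
    define y where "y = (L ^^ n) x"
    have "P (L y) = P (g y)" by (rule Peq) (rule aL)
    then have "L y - P (L y) = y - P y" by (simp add: L_def)
    then show ?case using Suc by (simp add: y_def)
  qed simp
  moreover have "P ((L ^^ N) x) = P x" for x by (rule Peq) (simp add: aLn N(2))
  ultimately have LN: "(L ^^ N) x = x" for x by (metis diff_add_cancel)
  have "periodic_arrangement \<Phi> L t N w (inv w)"
  proof (rule periodic_arrangement.intro)
    show "finite \<Phi>" by (rule fin)
    show "0 \<notin> \<Phi>" by (rule nz)
    show "- \<alpha> \<in> \<Phi>" if "\<alpha> \<in> \<Phi>" for \<alpha> using that by (rule neg)
    show "\<beta> = \<alpha> \<or> \<beta> = - \<alpha>" if "\<alpha> \<in> \<Phi>" "\<beta> \<in> \<Phi>" "\<beta> = c *\<^sub>R \<alpha>" for \<alpha> \<beta> c using that by (rule reduced)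
    show "linear L" by (rule linL)
    show "0 < N" by (rule N)
    show "(L ^^ N) x = x" for x by (rule LN)
    show "\<exists>\<beta>\<in>\<Phi>. \<forall>x. \<beta> \<bullet> x = \<alpha> \<bullet> L x" if "\<alpha> \<in> \<Phi>" for \<alpha> using G_pull[OF w(1) that] aL[OF that] by simp
    show "\<alpha> \<bullet> t \<in> \<int>" if "\<alpha> \<in> \<Phi>" for \<alpha> by (rule lattice_inner_Ints[OF root_lattice[OF that] w(2)])
    show "\<alpha> \<bullet> w x = \<alpha> \<bullet> (L x + t)" if "\<alpha> \<in> \<Phi>" for \<alpha> x by (simp add: w(3) inner_add_right aL[OF that])
    show "\<alpha> \<bullet> w (inv w x) = \<alpha> \<bullet> x" if "\<alpha> \<in> \<Phi>" for \<alpha> x by (simp add: W_inv(2)[OF assms])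
  qed
  then show ?thesis by blast
qed

lemma irreducible_points_equiv:
  assumes "w \<in> W" "regular H a" "regular H b" "irreducible_pt H w (inv w) a" "irreducible_pt H w (inv w) b"
  shows "conj_equiv H w (inv w) a b"
proof -
  obtain L lam N where "periodic_arrangement \<Phi> L lam N w (inv w)"
    using periodic_arrangement_exists[OF assms(1)] by blast
  then show ?thesis using assms(2-) by (rule periodic_arrangement.irreducible_conj_equiv)
qed

section \<open>Elements attached to alcoves, and their conjugates\<close>

lemma len_id: "len \<Phi> z id = 0"
  using len_dist[OF W_id] by (simp add: split_set_def splits_def mult_less_0_iff)

lemma split_set_self [simp]: "split_set H p p = {}"
  by (simp add: split_set_def splits_def mult_less_0_iff)

lemma split_empty_image: "w \<in> W \<Longrightarrow> split_set H p q = {} \<Longrightarrow> split_set H (w p) (w q) = {}"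
  using dist_H_image[of w p q] finite_split_set[OF fin, of "w p" "w q"] by simp

lemma split_empty_trans:
  "regular H p \<Longrightarrow> regular H q \<Longrightarrow> regular H r \<Longrightarrow> split_set H p q = {} \<Longrightarrow> split_set H q r = {} \<Longrightarrow> split_set H p r = {}"
  using dist_H_cong[of p q r r] by simp

text \<open>\<open>x\<close> maps the fundamental alcove to the alcove of the point \<open>a\<close>.\<close>

definition at_alcove :: "(real^'n \<Rightarrow> real^'n) \<Rightarrow> real^'n \<Rightarrow> bool" where
  "at_alcove x a \<longleftrightarrow> x \<in> W \<and> regular H a \<and> split_set H (x base_pt) a = {}"

definition conj_by :: "(real^'n \<Rightarrow> real^'n) \<Rightarrow> (real^'n \<Rightarrow> real^'n) \<Rightarrow> (real^'n \<Rightarrow> real^'n)" where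
  "conj_by x w = inv x \<circ> w \<circ> x"

lemma at_alcove_exists: "regular H a \<Longrightarrow> \<exists>x. at_alcove x a"
  using alcove_exists unfolding at_alcove_def by blast

lemma at_alcove_base: "x \<in> W \<Longrightarrow> at_alcove x (x base_pt)"
  by (simp add: at_alcove_def regular_image base_regular)

lemma at_alcove_comp: "w \<in> W \<Longrightarrow> at_alcove x a \<Longrightarrow> at_alcove (w \<circ> x) (w a)"
  unfolding at_alcove_def using W_comp regular_image split_empty_image by simp

lemma at_alcove_same: "at_alcove x a \<Longrightarrow> regular H b \<Longrightarrow> split_set H a b = {} \<Longrightarrow> at_alcove x b"
  unfolding at_alcove_def using split_empty_trans regular_image base_regular by blast

lemma conj_by_W: "x \<in> W \<Longrightarrow> w \<in> W \<Longrightarrow> conj_by x w \<in> W"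
  by (simp add: conj_by_def W_comp W_inverse)

lemma len_at:
  assumes "at_alcove x a" "at_alcove y b"
  shows "2 * len \<Phi> z (inv x \<circ> y) = dist_H a b"
proof -
  have "x \<in> W" "y \<in> W" using assms by (auto simp: at_alcove_def)
  then have "2 * len \<Phi> z (inv x \<circ> y) = dist_H (x base_pt) (y base_pt)" by (rule len_conj_dist)
  also have "split_set H (x base_pt) (y base_pt) = split_set H a b"
    using assms \<open>x \<in> W\<close> \<open>y \<in> W\<close> by (intro dist_H_cong) (auto simp: at_alcove_def regular_image base_regular)
  finally show ?thesis .
qed

lemma len_conj_by:
  assumes "at_alcove x a" "w \<in> W"
  shows "2 * len \<Phi> z (conj_by x w) = dist_H a (w a)"
  using len_at[OF assms(1) at_alcove_comp[OF assms(2,1)]] by (simp add: conj_by_def comp_assoc)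

end

locale hecke_datum = weyl_datum \<Phi> cor z \<Omega>
  for \<Phi> :: "(real^'n) set" and cor z \<Omega> +
  fixes v vi :: "'h::ring_1" and T :: "(real^'n \<Rightarrow> real^'n) \<Rightarrow> 'h"
  assumes hecke: "hecke_alg W (len \<Phi> z) (simple_refls \<Phi> cor z) v vi T"
begin

section \<open>Consequences of the Hecke relations\<close>

abbreviation "CS \<equiv> comm_span v vi"

lemma v_central: "v * h = h * v" using hecke unfolding hecke_alg_def by blast
lemma v_vi: "v * vi = 1" using hecke unfolding hecke_alg_def by (elim conjE)
lemma vi_v: "vi * v = 1" by (metis v_vi v_central)

lemma vi_central: "vi * h = h * vi"
proof -
  have "vi * h = vi * (h * (v * vi))" by (simp add: v_vi)
  also have "\<dots> = (vi * v) * h * vi" by (simp add: mult.assoc flip: v_central) (simp add: v_central mult.assoc)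
  finally show ?thesis by (simp add: vi_v)
qed

lemma T_mult: "x \<in> W \<Longrightarrow> y \<in> W \<Longrightarrow> len \<Phi> z (x \<circ> y) = len \<Phi> z x + len \<Phi> z y \<Longrightarrow> T (x \<circ> y) = T x * T y"
  using hecke by (simp add: hecke_alg_def)

lemma T_quad: "s \<in> simple_refls \<Phi> cor z \<Longrightarrow> T s * T s = (v - vi) * T s + 1"
proof -
  assume "s \<in> simple_refls \<Phi> cor z"
  then have "(T s - v) * (T s + vi) = 0" using hecke by (simp add: hecke_alg_def)
  then have "T s * T s + T s * vi - v * T s - v * vi = 0" by (simp add: algebra_simps)
  then show ?thesis using vi_central[of "T s"] v_vi by (simp add: algebra_simps)
qed

lemma vpow_central: "vpow v vi k * h = h * vpow v vi k"
proof -
  have "v ^ n * h = h * v ^ n" "vi ^ n * h = h * vi ^ n" for n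
    using power_commuting_commutes[of v h n] power_commuting_commutes[of vi h n] v_central[of h] vi_central[of h] by auto
  then show ?thesis by (simp add: vpow_def)
qed

text \<open>The relations do not name the unit. Since \<open>id\<close> has length 0,
  \<open>T id\<close> fixes every \<open>T w\<close>, hence everything they span over the central
  powers of \<open>v\<close>, in particular 1.\<close>

lemma T_id: "T id = 1"
proof -
  have "T id * h = h" for h
  proof -
    obtain c :: "int \<times> (real^'n \<Rightarrow> real^'n) \<Rightarrow> int" where c: "\<forall>p. c p \<noteq> 0 \<longrightarrow> snd p \<in> W"
        "h = (\<Sum>p\<in>{p. c p \<noteq> 0}. of_int (c p) * vpow v vi (fst p) * T (snd p))"
    proof -
      have "\<forall>h. \<exists>!c :: int \<times> (real^'n \<Rightarrow> real^'n) \<Rightarrow> int.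
         finite {p. c p \<noteq> 0} \<and> (\<forall>p. c p \<noteq> 0 \<longrightarrow> snd p \<in> W) \<and>
         h = (\<Sum>p\<in>{p. c p \<noteq> 0}. of_int (c p) * vpow v vi (fst p) * T (snd p))"
        using hecke unfolding hecke_alg_def by (elim conjE)
      from ex1_implies_ex[OF spec[OF this, of h]] that show thesis by (elim exE conjE)
    qed
    have "T id * (of_int (c p) * vpow v vi (fst p) * T (snd p)) = of_int (c p) * vpow v vi (fst p) * T (snd p)"
      if "p \<in> {p. c p \<noteq> 0}" for p
    proof -
      have "snd p \<in> W" using spec[OF c(1), of p] that by blast
      then have "T id * T (snd p) = T (snd p)" using T_mult[OF W_id, of "snd p"] len_id by simp
      moreover have "T id * (of_int (c p) * vpow v vi (fst p) * T (snd p)) = of_int (c p) * vpow v vi (fst p) * (T id * T (snd p))"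
        by (metis mult.assoc mult_of_int_commute vpow_central)
      ultimately show ?thesis by simp
    qed
    then show ?thesis unfolding c(2) sum_distrib_left by (intro sum.cong) auto
  qed
  from this[of 1] show ?thesis by simp
qed

text \<open>Transported back by \<open>x\<close>, the crossed wall becomes a wall of the fundamental
  alcove: the conjugated reflection is again an affine reflection, and just one hyperplane is
  crossed.\<close>

lemma crossing_simple:
  assumes x: "at_alcove x a" and b: "regular H b" and a: "\<alpha> \<in> \<Phi>"
    and adj: "adjacent H (\<lambda>x. \<alpha> \<bullet> x - of_int k) a b"
  shows "at_alcove (aff_refl cor \<alpha> k \<circ> x) b"
    and "inv x \<circ> aff_refl cor \<alpha> k \<circ> x \<in> simple_refls \<Phi> cor z"
    and "len \<Phi> z (inv x \<circ> aff_refl cor \<alpha> k \<circ> x) = 1"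
proof -
  let ?s = "aff_refl cor \<alpha> k"
  have xW: "x \<in> W" and ra: "regular H a" using x by (auto simp: at_alcove_def)
  show sb: "at_alcove (?s \<circ> x) b"
    using at_alcove_same[OF at_alcove_comp[OF aff_refl_W[OF a] x] b adjacent_reflect[OF ra b a adj]] .
  have hH: "(\<lambda>x. \<alpha> \<bullet> x - of_int k) \<in> H" using a unfolding affine_forms_def by blast
  have "2 * len \<Phi> z (inv x \<circ> (?s \<circ> x)) = 2"
    unfolding len_at[OF x sb] by (rule adjacent_split_set(2)[OF hH adj])
  then show l1: "len \<Phi> z (inv x \<circ> ?s \<circ> x) = 1" by (simp add: comp_assoc)
  obtain \<beta> l where bl: "\<beta> \<in> \<Phi>" "inv x \<circ> ?s = aff_refl cor \<beta> l \<circ> inv x"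
    using form_push[OF W_inverse(2)[OF xW] a, of k] by blast
  have "inv x \<circ> ?s \<circ> x = aff_refl cor \<beta> l" unfolding bl(2) by (simp add: fun_eq_iff W_inv(1)[OF xW])
  then show "inv x \<circ> ?s \<circ> x \<in> simple_refls \<Phi> cor z" using l1 bl(1) unfolding simple_refls_def by auto
qed

text \<open>In length 0 the inverse is \<open>T (inv x)\<close>; otherwise the first wall towards
  \<open>x base_pt\<close> splits off a simple reflection with lengths adding.\<close>

lemma T_invertible:
  assumes "x \<in> W" shows "\<exists>i. T x * i = 1 \<and> i * T x = 1"
  using assms
proof (induction "len \<Phi> z x" arbitrary: x rule: less_induct)
  case less
  note xW = less.prems
  show ?case
  proof (cases "split_set H base_pt (x base_pt) = {}")
    case True
    then have l: "len \<Phi> z x = 0" using len_dist[OF xW] by simp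
    have "split_set H (inv x base_pt) (inv x (x base_pt)) = {}"
      using split_empty_image[OF W_inverse(2)[OF xW] True] .
    then have "split_set H base_pt (inv x base_pt) = {}"
      using split_set_sym[of H base_pt "inv x base_pt"] W_inv(1)[OF xW] by simp
    then have l': "len \<Phi> z (inv x) = 0" using len_dist[OF W_inverse(2)[OF xW]] by simp
    have e: "x \<circ> inv x = id" "inv x \<circ> x = id" using W_inv[OF xW] by (auto simp: fun_eq_iff)
    have "T (x \<circ> inv x) = T x * T (inv x)" "T (inv x \<circ> x) = T (inv x) * T x"
      by (rule T_mult; use xW W_inverse(2)[OF xW] l l' e len_id in simp)+
    then show ?thesis using T_id e by (intro exI[of _ "T (inv x)"]) simp
  next
    case False
    have rx: "regular H (x base_pt)" using regular_image[OF xW base_regular] .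
    obtain h r where h: "h \<in> H" "regular H r" "splits h base_pt (x base_pt)" "adjacent H h base_pt r"
      using exists_adjacent[OF base_regular rx False] by blast
    obtain \<alpha> k where hk: "h = (\<lambda>x. \<alpha> \<bullet> x - of_int k)" "\<alpha> \<in> \<Phi>" using h(1) by (rule affine_formsE)
    define s where "s = aff_refl cor \<alpha> k"
    have b0: "at_alcove id base_pt" using at_alcove_base[OF W_id] by simp
    note cr = crossing_simple[OF b0 h(2) hk(2) h(4)[unfolded hk(1)], folded s_def]
    have s: "s \<in> W" unfolding s_def by (rule aff_refl_W[OF hk(2)])
    have ss: "s \<circ> s = id" unfolding s_def by (simp add: fun_eq_iff aff_refl_involution[OF hk(2)])
    have invs: "inv s = s" using ss inv_unique_comp by blast
    have ar: "at_alcove s r" using cr(1) by simp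
    have ax: "at_alcove x (x base_pt)" by (rule at_alcove_base[OF xW])
    have "2 * len \<Phi> z (s \<circ> x) = dist_H r (x base_pt)" using len_at[OF ar ax] by (simp add: invs)
    moreover have "dist_H base_pt (x base_pt) = dist_H r (x base_pt) + 2"
      by (rule adjacent_dist(1)[OF h(1,4) base_regular h(2) rx h(3)])
    ultimately have l: "len \<Phi> z x = 1 + len \<Phi> z (s \<circ> x)" using len_dist[OF xW] by simp
    have sx: "s \<circ> x \<in> W" by (rule W_comp[OF s xW])
    obtain i where i: "T (s \<circ> x) * i = 1" "i * T (s \<circ> x) = 1" using less.hyps[OF _ sx] l by auto
    have e: "s \<circ> (s \<circ> x) = x" using ss by (simp add: comp_assoc[symmetric])
    have Tx: "T x = T s * T (s \<circ> x)" using T_mult[OF s sx] l cr(3) by (simp add: e)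
    have q: "T s * T s = (v - vi) * T s + 1" using T_quad cr(2) by simp
    define c where "c = v - vi"
    \<comment> \<open>The quadratic relation reads \<open>T s * (T s - c) = 1\<close>.\<close>
    define j where "j = T s - c"
    have vc: "c * T s = T s * c" using v_central[of "T s"] vi_central[of "T s"] by (simp add: c_def algebra_simps)
    have j: "T s * j = 1" "j * T s = 1"
      using q[folded c_def] by (simp_all add: j_def right_diff_distrib left_diff_distrib vc)
    have "T x * (i * j) = T s * (T (s \<circ> x) * i) * j" by (simp add: Tx mult.assoc)
    moreover have "(i * j) * T x = i * (j * T s) * T (s \<circ> x)" by (simp add: Tx mult.assoc)
    ultimately show ?thesis using i j by (intro exI[of _ "i * j"]) simp
  qed
qed

section \<open>Congruence modulo commutators\<close>

definition cong_CS :: "'h \<Rightarrow> 'h \<Rightarrow> bool" where "cong_CS x y \<longleftrightarrow> x - y \<in> CS"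

lemma cong_refl: "cong_CS x x" by (simp add: cong_CS_def cs_zero)
lemma cong_sym: "cong_CS x y \<Longrightarrow> cong_CS y x" unfolding cong_CS_def using cs_neg[of "x - y"] by simp
lemma cong_trans: "cong_CS x y \<Longrightarrow> cong_CS y t \<Longrightarrow> cong_CS x t"
  unfolding cong_CS_def using cs_add[of "x - y" v vi "y - t"] by simp
lemma cong_add: "cong_CS x y \<Longrightarrow> cong_CS x' y' \<Longrightarrow> cong_CS (x + x') (y + y')"
  unfolding cong_CS_def using cs_add[of "x - y" v vi "x' - y'"] by (simp add: algebra_simps)
lemma cong_comm: "cong_CS (a * b) (b * a)" unfolding cong_CS_def by (rule cs_comm)

lemma cong_scale: "cong_CS x y \<Longrightarrow> cong_CS ((v - vi) * x) ((v - vi) * y)"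
proof -
  assume "cong_CS x y"
  then have c: "x - y \<in> CS" by (simp add: cong_CS_def)
  have "v * (x - y) \<in> CS" using cs_smult[OF c, of 1] by (simp add: vpow_def)
  moreover have "vi * (x - y) \<in> CS" using cs_smult[OF c, of "-1"] by (simp add: vpow_def)
  ultimately have "v * (x - y) + - (vi * (x - y)) \<in> CS" using cs_add cs_neg by blast
  then show ?thesis by (simp add: cong_CS_def algebra_simps)
qed

text \<open>As \<open>T u\<close> is a unit, equality of the two reduced products makes
  \<open>T y'\<close> an actual conjugate of \<open>T y\<close>; the same count gives equal
  lengths.\<close>

lemma additive_cong:
  assumes w: "w \<in> W" and x: "at_alcove x a" and x': "at_alcove x' b" and add: "additive H w (inv w) a b"
  shows "cong_CS (T (conj_by x w)) (T (conj_by x' w)) \<and> len \<Phi> z (conj_by x w) = len \<Phi> z (conj_by x' w)"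
proof -
  have W: "x \<in> W" "x' \<in> W" and reg: "regular H a" "regular H b" using x x' by (auto simp: at_alcove_def)
  have regw: "regular H (w a)" "regular H (w b)" using regular_image[OF w] reg by auto
  define u where "u = inv x \<circ> x'"
  define y where "y = conj_by x w"
  define y' where "y' = conj_by x' w"
  have uW: "u \<in> W" unfolding u_def by (intro W_comp W_inverse(2) W)
  have yW: "y \<in> W" "y' \<in> W" unfolding y_def y'_def using conj_by_W W w by auto
  have uy: "u \<circ> y' = inv x \<circ> (w \<circ> x')" "y \<circ> u = inv x \<circ> (w \<circ> x')"
    by (auto simp: u_def y_def y'_def conj_by_def fun_eq_iff W_inv[OF W(1)] W_inv[OF W(2)])
  have wx': "at_alcove (w \<circ> x') (w b)" by (rule at_alcove_comp[OF w x'])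
  have luy: "2 * len \<Phi> z (inv x \<circ> (w \<circ> x')) = dist_H a (w b)" by (rule len_at[OF x wx'])
  have lu: "2 * len \<Phi> z u = dist_H a b" unfolding u_def by (rule len_at[OF x x'])
  have ly: "2 * len \<Phi> z y = dist_H a (w a)" "2 * len \<Phi> z y' = dist_H b (w b)"
    unfolding y_def y'_def by (rule len_conj_by[OF x w], rule len_conj_by[OF x' w])
  have "dist_H a (w b) = dist_H a b + dist_H b (w b)"
    using add by (intro dist_H_additive reg regw) (auto simp: additive_def)
  then have 1: "len \<Phi> z (u \<circ> y') = len \<Phi> z u + len \<Phi> z y'" using luy lu ly by (simp add: uy)
  \<comment> \<open>The clause of \<open>additive\<close> on \<open>inv w a\<close> is applied to
    the pull-back of \<open>h\<close> along \<open>w\<close>, which turns it into a statement on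
    \<open>a\<close> and \<open>w a\<close>.\<close>
  have "dist_H a (w b) = dist_H a (w a) + dist_H (w a) (w b)"
  proof (intro dist_H_additive reg regw)
    fix h assume h: "h \<in> H" "splits h a (w a)"
    show "\<not> splits h (w a) (w b)"
    proof
      assume "splits h (w a) (w b)"
      then have "splits (\<lambda>x. h (w x)) a b" by (simp add: splits_def)
      then have "\<not> splits (\<lambda>x. h (w x)) a (inv w a)"
        using add form_pull[OF w h(1)] unfolding additive_def by blast
      then have "\<not> splits h (w a) a" by (simp add: splits_def W_inv(2)[OF w])
      then show False using h(2) splits_sym[of h a "w a"] by simp
    qed
  qed
  then have 2: "len \<Phi> z (y \<circ> u) = len \<Phi> z y + len \<Phi> z u" using luy lu ly dist_H_image[OF w] by (simp add: uy)
  have e: "T u * T y' = T y * T u"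
    using T_mult[OF uW yW(2) 1] T_mult[OF yW(1) uW 2] by (simp add: uy)
  obtain i where i: "T u * i = 1" "i * T u = 1" using T_invertible[OF uW] by blast
  have "T y' = i * (T u * T y')" using i by (simp flip: mult.assoc)
  then have "T y' = i * (T y * T u)" by (simp add: e)
  moreover have "(T y * T u) * i = T y" using i by (simp add: mult.assoc)
  ultimately have "cong_CS (T y) (T y')" using cong_comm[of "T y * T u" i] by simp
  moreover have "len \<Phi> z y = len \<Phi> z y'" using 1 2 by (simp add: uy)
  ultimately show ?thesis by (simp add: y_def y'_def)
qed

lemma same_alcove_cong:
  assumes "w \<in> W" "at_alcove x a" "at_alcove x' a"
  shows "cong_CS (T (conj_by x w)) (T (conj_by x' w)) \<and> len \<Phi> z (conj_by x w) = len \<Phi> z (conj_by x' w)"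
  using assms by (intro additive_cong[of w x a x' a]) (auto simp: additive_def splits_def mult_less_0_iff)

lemma inv_refl_comp:
  assumes "x \<in> W" "\<alpha> \<in> \<Phi>" shows "inv (aff_refl cor \<alpha> k \<circ> x) = inv x \<circ> aff_refl cor \<alpha> k"
  by (rule inv_unique_comp) (auto simp: fun_eq_iff W_inv[OF assms(1)] aff_refl_involution[OF assms(2)])

text \<open>An alcove determines its group element only up to length zero, so the claim is made for
  all choices; \<open>same_alcove_cong\<close> absorbs the difference. For an invariant wall the
  conjugate does not change at all.\<close>

lemma conj_equiv_cong:
  assumes w: "w \<in> W" and e: "conj_equiv H w (inv w) a b"
  shows "at_alcove x a \<Longrightarrow> at_alcove x' b \<Longrightarrow>
    cong_CS (T (conj_by x w)) (T (conj_by x' w)) \<and> len \<Phi> z (conj_by x w) = len \<Phi> z (conj_by x' w)"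
  using e
proof (induction arbitrary: x x' rule: conj_equiv.induct)
  case (ce_additive a b)
  then show ?case using additive_cong[OF w] by blast
next
  case (ce_wall a b h)
  obtain \<alpha> k where hk: "h = (\<lambda>x. \<alpha> \<bullet> x - of_int k)" "\<alpha> \<in> \<Phi>" using \<open>h \<in> H\<close> by (rule affine_formsE)
  let ?s = "aff_refl cor \<alpha> k"
  have xW: "x \<in> W" using ce_wall by (simp add: at_alcove_def)
  have adj: "adjacent H (\<lambda>x. \<alpha> \<bullet> x - of_int k) a b" using ce_wall hk by simp
  have sx: "at_alcove (?s \<circ> x) b"
    by (rule crossing_simple(1)[OF ce_wall.prems(1) ce_wall.hyps(2) hk(2) adj])
  have "w \<circ> ?s = ?s \<circ> w" using aff_refl_commute[OF w hk(2)] ce_wall hk by simp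
  then have c: "w (?s y) = ?s (w y)" for y by (simp add: fun_eq_iff)
  have "conj_by (?s \<circ> x) w = conj_by x w"
    unfolding conj_by_def inv_refl_comp[OF xW hk(2)]
    by (simp add: fun_eq_iff c aff_refl_involution[OF hk(2)])
  then show ?case using same_alcove_cong[OF w sx ce_wall.prems(2)] by simp
next
  case (ce_sym a b)
  then show ?case using cong_sym by metis
next
  case (ce_trans a b c)
  obtain x'' where "at_alcove x'' b"
    using at_alcove_exists conj_equiv_regular[OF ce_trans.hyps(1)] by blast
  then show ?case using ce_trans cong_trans by metis
qed

text \<open>\<open>T y = T s * T y2 * T s\<close> with lengths adding throughout. Rotating one
  factor \<open>T s\<close> to the front produces a square, and the quadratic relation replaces
  it.\<close>

lemma drop_cong:
  assumes w: "w \<in> W" and x: "at_alcove x a" and d: "drops H w (inv w) a b"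
  shows "\<exists>x'\<in>W. \<exists>y\<in>W. cong_CS (T (conj_by x w)) (T (conj_by x' w) + (v - vi) * T y) \<and>
     len \<Phi> z (conj_by x' w) < len \<Phi> z (conj_by x w) \<and> len \<Phi> z y < len \<Phi> z (conj_by x w)"
proof -
  obtain h where reg: "regular H a" "regular H b" and h: "h \<in> H" "adjacent H h a b" "\<not> invariant_wall w h"
      "splits h a (w a)" "splits h a (inv w a)" using d unfolding drops_def by blast
  obtain \<alpha> k where hk: "h = (\<lambda>x. \<alpha> \<bullet> x - of_int k)" "\<alpha> \<in> \<Phi>" using h(1) by (rule affine_formsE)
  have xW: "x \<in> W" using x by (simp add: at_alcove_def)
  define r where "r = aff_refl cor \<alpha> k"
  define s where "s = inv x \<circ> r \<circ> x"
  define y where "y = conj_by x w"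
  have rW: "r \<in> W" unfolding r_def by (rule aff_refl_W[OF hk(2)])
  have rr: "r (r t) = t" for t unfolding r_def by (rule aff_refl_involution[OF hk(2)])
  note cr = crossing_simple[OF x reg(2) hk(2) h(2)[unfolded hk(1)], folded r_def, folded s_def]
  have sW: "s \<in> W" unfolding s_def by (intro W_comp W_inverse(2) xW rW)
  have yW: "y \<in> W" unfolding y_def by (rule conj_by_W[OF xW w])
  define y2 where "y2 = conj_by (r \<circ> x) w"
  have y2W: "y2 \<in> W" unfolding y2_def by (rule conj_by_W[OF W_comp[OF rW xW] w])
  have y2: "y2 = s \<circ> y \<circ> s"
    unfolding y2_def y_def s_def conj_by_def r_def inv_refl_comp[OF xW hk(2)]
    by (auto simp: fun_eq_iff W_inv[OF xW])
  have invrx: "inv (r \<circ> x) = inv x \<circ> r" unfolding r_def by (rule inv_refl_comp[OF xW hk(2)])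
  have wH: "(\<lambda>t. h (w t)) \<in> H" "(\<lambda>t. h (inv w t)) \<in> H"
    using form_pull[OF w h(1)] form_pull[OF W_inverse(2)[OF w] h(1)] by auto
  have only: "h' = h \<or> h' = (\<lambda>x. - h x)" if "h' \<in> H" "splits h' a b" for h'
    using h(2) that by (auto simp: adjacent_def)
  have hab: "splits h a b" using h(2) by (simp add: adjacent_def)
  have "\<not> splits (\<lambda>t. h (w t)) a b"
    using only[OF wH(1)] h(3) unfolding invariant_wall_def by metis
  then have nw: "\<not> splits h (w a) (w b)" by (simp add: splits_def)
  have "\<not> splits (\<lambda>t. h (inv w t)) a b"
  proof
    assume "splits (\<lambda>t. h (inv w t)) a b"
    from only[OF wH(2) this] have "(\<forall>t. h (inv w t) = h t) \<or> (\<forall>t. h (inv w t) = - h t)" by metis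
    then have "(\<forall>t. h (inv w (w t)) = h (w t)) \<or> (\<forall>t. h (inv w (w t)) = - h (w t))" by blast
    then have "invariant_wall w h" unfolding invariant_wall_def W_inv(1)[OF w] by (metis minus_minus)
    then show False using h(3) by blast
  qed
  then have nw': "\<not> splits h (inv w a) (inv w b)" by (simp add: splits_def)
  have regw: "regular H (w a)" "regular H (w b)" "regular H (inv w a)" "regular H (inv w b)"
    using regular_image[OF w] regular_image[OF W_inverse(2)[OF w]] reg by auto
  have nz: "h a \<noteq> 0" "h b \<noteq> 0" "h (w a) \<noteq> 0" "h (w b) \<noteq> 0" "h (inv w a) \<noteq> 0" "h (inv w b) \<noteq> 0"
    using reg regw h(1) by (auto simp: regular_def)
  have awb: "splits h a (w b)" using splits_trans[of h a "w a" "w b", OF nz(1,3,4)] h(4) nw by blast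
  have aw'b: "splits h a (inv w b)" using splits_trans[of h a "inv w a" "inv w b", OF nz(1,5,6)] h(5) nw' by blast
  have d1: "dist_H a (w a) = dist_H b (w a) + 2" by (rule adjacent_dist(1)[OF h(1,2) reg regw(1) h(4)])
  have d2: "dist_H a (w b) = dist_H b (w b) + 2" by (rule adjacent_dist(1)[OF h(1,2) reg regw(2) awb])
  \<comment> \<open>Here the moving point passes from \<open>w a\<close> to \<open>w b\<close>,
    across the image of the wall under \<open>w\<close>; this image separates \<open>w a\<close>
    from \<open>b\<close> because \<open>h\<close> separates \<open>a\<close> from
    \<open>inv w b\<close>.\<close>
  have d3: "dist_H b (w a) = dist_H b (w b) + 2"
  proof -
    define g where "g = (\<lambda>t. h (inv w t))"
    have gw: "g (w t) = h t" for t by (simp add: g_def W_inv(1)[OF w])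
    have "adjacent H g (w a) (w b)"
      unfolding adjacent_def
    proof (intro conjI ballI impI)
      show "splits g (w a) (w b)" using hab by (simp add: splits_def gw)
      fix g' assume g': "g' \<in> H" "splits g' (w a) (w b)"
      then have "splits (\<lambda>t. g' (w t)) a b" by (simp add: splits_def)
      from only[OF form_pull[OF w g'(1)] this] consider "\<forall>t. g' (w t) = h t" | "\<forall>t. g' (w t) = - h t" by metis
      then show "g' = g \<or> g' = (\<lambda>x. - g x)"
      proof cases
        case 1
        then have "g' t = g t" for t using W_inv(2)[OF w, of t] gw by metis
        then show ?thesis by blast
      next
        case 2
        then have "g' t = - g t" for t using W_inv(2)[OF w, of t] gw by metis
        then show ?thesis by blast
      qed
    qed
    moreover have "splits g (w a) b" using aw'b by (simp add: splits_def gw) (simp add: g_def)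
    moreover have "g \<in> H" using wH(2) by (simp add: g_def)
    ultimately have "dist_H (w a) b = dist_H (w b) b + 2"
      using adjacent_dist(1)[of g "w a" "w b" b] regw reg by blast
    then show ?thesis using split_set_sym[of H b "w a"] split_set_sym[of H b "w b"] by simp
  qed
  have wx: "at_alcove (w \<circ> x) (w a)" by (rule at_alcove_comp[OF w x])
  have wrx: "at_alcove (w \<circ> (r \<circ> x)) (w b)" by (rule at_alcove_comp[OF w cr(1)])
  have l0: "2 * len \<Phi> z y = dist_H a (w a)" unfolding y_def by (rule len_conj_by[OF x w])
  have l1: "2 * len \<Phi> z (s \<circ> y) = dist_H b (w a)"
  proof -
    have "s \<circ> y = inv (r \<circ> x) \<circ> (w \<circ> x)"
      unfolding invrx by (simp add: s_def y_def conj_by_def fun_eq_iff W_inv[OF xW])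
    then show ?thesis using len_at[OF cr(1) wx] by simp
  qed
  have l2: "2 * len \<Phi> z y2 = dist_H b (w b)" unfolding y2_def by (rule len_conj_by[OF cr(1) w])
  have l3: "2 * len \<Phi> z (y \<circ> s) = dist_H a (w b)"
  proof -
    have "y \<circ> s = inv x \<circ> (w \<circ> (r \<circ> x))"
      by (simp add: s_def y_def conj_by_def fun_eq_iff W_inv[OF xW])
    then show ?thesis using len_at[OF x wrx] by simp
  qed
  have ss: "s (s t) = t" for t by (simp add: s_def W_inv[OF xW] rr)
  have e1: "s \<circ> (s \<circ> y) = y" and e2: "y2 \<circ> s = s \<circ> y" and e3: "s \<circ> y2 = y \<circ> s"
    by (auto simp: fun_eq_iff y2 ss)
  have ysW: "y \<circ> s \<in> W" "s \<circ> y \<in> W" using W_comp yW sW by auto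
  have Ty: "T y = T s * T (s \<circ> y)" using T_mult[OF sW ysW(2)] l0 l1 d1 cr(3) by (simp add: e1)
  have Tsy: "T (s \<circ> y) = T y2 * T s" using T_mult[OF y2W sW] l1 l2 d3 cr(3) by (simp add: e2)
  have Tys: "T (y \<circ> s) = T s * T y2" using T_mult[OF sW y2W] l2 l3 d2 cr(3) by (simp add: e3)
  have "T y = (T s * T y2) * T s" by (simp add: Ty Tsy mult.assoc)
  then have "cong_CS (T y) (T s * (T s * T y2))" using cong_comm by metis
  also have "T s * (T s * T y2) = (T s * T s) * T y2" by (simp add: mult.assoc)
  also have "\<dots> = T y2 + (v - vi) * T (y \<circ> s)" unfolding T_quad[OF cr(2)] Tys by (simp add: algebra_simps)
  finally have "cong_CS (T y) (T y2 + (v - vi) * T (y \<circ> s))" .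
  moreover have "len \<Phi> z y2 < len \<Phi> z y" "len \<Phi> z (y \<circ> s) < len \<Phi> z y" using l0 l2 l3 d1 d2 d3 by auto
  ultimately show ?thesis
    using W_comp[OF rW xW] ysW(1) unfolding y_def y2_def by blast
qed

end

section \<open>The class polynomials\<close>

lemma peval_upto: "degree f \<le> n \<Longrightarrow> peval f u = (\<Sum>i\<le>n. of_nat (coeff f i) * u ^ i)"
  unfolding peval_def by (rule sum.mono_neutral_left) (auto simp: coeff_eq_0)

lemma peval_0 [simp]: "peval 0 u = 0" by (simp add: peval_def)

lemma peval_1 [simp]: "peval 1 u = 1" by (simp add: peval_def)

lemma peval_add: "peval (f + g) u = peval f u + peval g u"
proof -
  define n where "n = max (degree f) (degree g)"
  have "degree (f + g) \<le> n" "degree f \<le> n" "degree g \<le> n" by (auto simp: n_def degree_add_le_max)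
  then show ?thesis by (simp add: peval_upto[of _ n] sum.distrib distrib_right)
qed

lemma peval_pCons_0: "peval (pCons 0 f) u = u * peval f u"
proof -
  have "degree (pCons 0 f) \<le> Suc (degree f)" by (simp add: degree_pCons_le)
  then have "peval (pCons 0 f) u = (\<Sum>i\<le>Suc (degree f). of_nat (coeff (pCons 0 f) i) * u ^ i)" by (rule peval_upto)
  also have "\<dots> = (\<Sum>i\<le>degree f. of_nat (coeff f i) * u ^ Suc i)"
    by (simp add: sum.atMost_Suc_shift del: sum.atMost_Suc power_Suc)
  also have "\<dots> = u * peval f u"
    unfolding peval_def sum_distrib_left
  proof (rule sum.cong)
    fix i
    have "of_nat (coeff f i) * u ^ Suc i = (of_nat (coeff f i) * u) * u ^ i" by (simp add: mult.assoc)
    also have "\<dots> = u * (of_nat (coeff f i) * u ^ i)"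
      by (simp add: mult_of_nat_commute mult.assoc)
    finally show "of_nat (coeff f i) * u ^ Suc i = u * (of_nat (coeff f i) * u ^ i)" .
  qed simp
  finally show ?thesis .
qed

locale hecke_reps = hecke_datum \<Phi> cor z \<Omega> v vi T
  for \<Phi> :: "(real^'n) set" and cor z \<Omega> and v vi :: "'h::ring_1" and T +
  fixes rep :: "(real^'n \<Rightarrow> real^'n) set \<Rightarrow> (real^'n \<Rightarrow> real^'n)"
  assumes rep: "\<forall>C\<in>conj_classes W. rep C \<in> C \<and> (\<forall>w'\<in>C. len \<Phi> z (rep C) \<le> len \<Phi> z w')"
begin

section \<open>Nonnegative combinations of class representatives\<close>

definition rep_sum :: "((real^'n \<Rightarrow> real^'n) set \<Rightarrow> nat poly) \<Rightarrow> 'h" where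
  "rep_sum f = (\<Sum>C\<in>{C \<in> conj_classes W. f C \<noteq> 0}. peval (f C) (v - vi) * T (rep C))"

text \<open>Stable under sums and under multiplication by \<open>v - vi\<close>, the operations of
  the recursion; since coefficients remain natural numbers, no cancellation has to be
  controlled.\<close>

definition expressible :: "'h \<Rightarrow> bool" where
  "expressible h \<longleftrightarrow> (\<exists>f. finite {C \<in> conj_classes W. f C \<noteq> 0} \<and> cong_CS h (rep_sum f))"

lemma rep_sum_superset:
  assumes "finite K" "K \<subseteq> conj_classes W" "{C \<in> conj_classes W. f C \<noteq> 0} \<subseteq> K"
  shows "rep_sum f = (\<Sum>C\<in>K. peval (f C) (v - vi) * T (rep C))"
  unfolding rep_sum_def using assms by (intro sum.mono_neutral_left) auto

lemma expressible_cong: "cong_CS h h' \<Longrightarrow> expressible h' \<Longrightarrow> expressible h"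
  unfolding expressible_def using cong_trans by blast

lemma expressible_add: assumes "expressible h" "expressible h'" shows "expressible (h + h')"
proof -
  obtain f g where f: "finite {C \<in> conj_classes W. f C \<noteq> 0}" "cong_CS h (rep_sum f)"
    and g: "finite {C \<in> conj_classes W. g C \<noteq> 0}" "cong_CS h' (rep_sum g)"
    using assms unfolding expressible_def by blast
  define K where "K = {C \<in> conj_classes W. f C \<noteq> 0} \<union> {C \<in> conj_classes W. g C \<noteq> 0}"
  have K: "finite K" "K \<subseteq> conj_classes W" using f g by (auto simp: K_def)
  have sub: "{C \<in> conj_classes W. f C + g C \<noteq> 0} \<subseteq> K" by (auto simp: K_def)
  have "rep_sum (\<lambda>C. f C + g C) = rep_sum f + rep_sum g"
    using rep_sum_superset[OF K, of f] rep_sum_superset[OF K, of g] rep_sum_superset[OF K sub]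
    by (simp add: K_def peval_add distrib_right sum.distrib)
  then have "cong_CS (h + h') (rep_sum (\<lambda>C. f C + g C))" using cong_add[OF f(2) g(2)] by simp
  moreover have "finite {C \<in> conj_classes W. f C + g C \<noteq> 0}" using sub K(1) by (rule finite_subset)
  ultimately show ?thesis unfolding expressible_def by (intro exI[of _ "\<lambda>C. f C + g C"]) simp
qed

lemma expressible_scale: assumes "expressible h" shows "expressible ((v - vi) * h)"
proof -
  obtain f where f: "finite {C \<in> conj_classes W. f C \<noteq> 0}" "cong_CS h (rep_sum f)"
    using assms unfolding expressible_def by blast
  have e: "{C \<in> conj_classes W. pCons 0 (f C) \<noteq> 0} = {C \<in> conj_classes W. f C \<noteq> 0}" by simp
  have "rep_sum (\<lambda>C. pCons 0 (f C)) = (v - vi) * rep_sum f"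
    unfolding rep_sum_def e sum_distrib_left by (simp add: peval_pCons_0 mult.assoc)
  then have "cong_CS ((v - vi) * h) (rep_sum (\<lambda>C. pCons 0 (f C)))" using cong_scale[OF f(2)] by simp
  then show ?thesis unfolding expressible_def using f(1) e by (intro exI[of _ "\<lambda>C. pCons 0 (f C)"]) simp
qed

lemma expressible_rep: assumes "C \<in> conj_classes W" shows "expressible (T (rep C))"
proof -
  define f :: "(real^'n \<Rightarrow> real^'n) set \<Rightarrow> nat poly" where "f C' = (if C' = C then 1 else 0)" for C'
  have s: "{C' \<in> conj_classes W. f C' \<noteq> 0} = {C}" using assms by (auto simp: f_def)
  have "rep_sum f = T (rep C)" unfolding rep_sum_def s by (simp add: f_def)
  then show ?thesis unfolding expressible_def using s cong_refl by (intro exI[of _ f]) simp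
qed

text \<open>The test is made at \<open>base_pt\<close>, whose conjugate is \<open>w\<close> itself.
  Either a drop is reachable and both new elements are shorter, or \<open>base_pt\<close> is
  irreducible and hence equivalent to the alcove of the chosen representative.\<close>

lemma expressible_T:
  assumes "w \<in> W" shows "expressible (T w)"
  using assms
proof (induction "len \<Phi> z w" arbitrary: w rule: less_induct)
  case less
  note w = less.prems
  have a0: "at_alcove id base_pt" using at_alcove_base[OF W_id] by simp
  have cid: "conj_by id w = w" by (simp add: conj_by_def)
  show ?case
  proof (cases "irreducible_pt H w (inv w) base_pt")
    case False
    then obtain b c where b: "conj_equiv H w (inv w) base_pt b" "drops H w (inv w) b c"
      unfolding irreducible_pt_def by blast
    obtain x where x: "at_alcove x b" using at_alcove_exists conj_equiv_regular[OF b(1)] by blast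
    have e: "cong_CS (T w) (T (conj_by x w))" "len \<Phi> z w = len \<Phi> z (conj_by x w)"
      using conj_equiv_cong[OF w b(1) a0 x] by (auto simp: cid)
    obtain x' y where d: "x' \<in> W" "y \<in> W" "cong_CS (T (conj_by x w)) (T (conj_by x' w) + (v - vi) * T y)"
        "len \<Phi> z (conj_by x' w) < len \<Phi> z (conj_by x w)" "len \<Phi> z y < len \<Phi> z (conj_by x w)"
      using drop_cong[OF w x b(2)] by blast
    have "expressible (T (conj_by x' w))" using less.hyps[OF _ conj_by_W[OF d(1) w]] d(4) e(2) by simp
    moreover have "expressible (T y)" using less.hyps[OF _ d(2)] d(5) e(2) by simp
    ultimately have "expressible (T (conj_by x' w) + (v - vi) * T y)"
      by (intro expressible_add expressible_scale)
    then show ?thesis using expressible_cong[OF cong_trans[OF e(1) d(3)]] by blast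
  next
    case True
    define C where "C = conj_class W w"
    have C: "C \<in> conj_classes W" unfolding C_def conj_classes_def using w by blast
    have "rep C \<in> C" using rep C by blast
    then obtain u where u: "u \<in> W" "rep C \<circ> u = u \<circ> w" unfolding C_def conj_class_def by blast
    define x where "x = inv u"
    have xW: "x \<in> W" unfolding x_def by (rule W_inverse(2)[OF u(1)])
    have invx: "inv x = u" unfolding x_def using W_inverse(1)[OF u(1)] by (rule inv_inv_eq)
    have rC: "rep C = conj_by x w"
    proof
      fix t
      have "rep C (u (inv u t)) = u (w (inv u t))" using fun_cong[OF u(2), of "inv u t"] by simp
      then show "rep C t = conj_by x w t" unfolding W_inv(2)[OF u(1)] by (simp add: conj_by_def invx) (simp add: x_def)
    qed
    have conj_in: "conj_by y w \<in> C" if y: "y \<in> W" for y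
    proof -
      have "conj_by y w \<circ> inv y = inv y \<circ> w" by (simp add: conj_by_def fun_eq_iff W_inv(2)[OF y])
      then show ?thesis unfolding C_def conj_class_def using conj_by_W[OF y w] W_inverse(2)[OF y] by blast
    qed
    have ax: "at_alcove x (x base_pt)" by (rule at_alcove_base[OF xW])
    \<comment> \<open>A drop reachable from this alcove would yield a conjugate shorter than the
      representative of minimal length.\<close>
    have "irreducible_pt H w (inv w) (x base_pt)"
      unfolding irreducible_pt_def
    proof (intro allI impI notI)
      fix b c assume b: "conj_equiv H w (inv w) (x base_pt) b" "drops H w (inv w) b c"
      obtain y where y: "at_alcove y b" using at_alcove_exists conj_equiv_regular[OF b(1)] by blast
      have l: "len \<Phi> z (conj_by x w) = len \<Phi> z (conj_by y w)" using conj_equiv_cong[OF w b(1) ax y] by blast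
      obtain x' where x': "x' \<in> W" "len \<Phi> z (conj_by x' w) < len \<Phi> z (conj_by y w)"
        using drop_cong[OF w y b(2)] by blast
      have "len \<Phi> z (rep C) \<le> len \<Phi> z (conj_by x' w)" using rep C conj_in[OF x'(1)] by blast
      then show False using x'(2) l by (simp add: rC)
    qed
    then have "conj_equiv H w (inv w) base_pt (x base_pt)"
      using irreducible_points_equiv[OF w base_regular regular_image[OF xW base_regular] True] by blast
    from conj_equiv_cong[OF w this a0 ax] have "cong_CS (T w) (T (rep C))" by (simp add: cid rC)
    then show ?thesis using expressible_cong expressible_rep[OF C] by blast
  qed
qed

end

theorem theorem5p2:
  fixes \<Phi> :: "(real^'n) set" and cor :: "real^'n \<Rightarrow> real^'n" and z :: "real^'n"
    and \<Omega> :: "(real^'n \<Rightarrow> real^'n) set"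
    and v vi :: "'h::ring_1" and T :: "(real^'n \<Rightarrow> real^'n) \<Rightarrow> 'h"
    and rep :: "(real^'n \<Rightarrow> real^'n) set \<Rightarrow> (real^'n \<Rightarrow> real^'n)"
  assumes "root_datum \<Phi> cor"
    and "\<forall>\<alpha>\<in>\<Phi>. \<alpha> \<bullet> z \<noteq> 0"
    and "diagram_group \<Phi> cor z \<Omega>"
    and "hecke_alg (ext_affine_weyl \<Phi> cor \<Omega>) (len \<Phi> z) (simple_refls \<Phi> cor z) v vi T"
    and "\<forall>C\<in>conj_classes (ext_affine_weyl \<Phi> cor \<Omega>).
           rep C \<in> C \<and> (\<forall>w'\<in>C. len \<Phi> z (rep C) \<le> len \<Phi> z w')"
  shows "\<forall>w\<in>ext_affine_weyl \<Phi> cor \<Omega>. \<exists>f :: (real^'n \<Rightarrow> real^'n) set \<Rightarrow> nat poly.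
           finite {C \<in> conj_classes (ext_affine_weyl \<Phi> cor \<Omega>). f C \<noteq> 0} \<and>
           T w - (\<Sum>C\<in>{C \<in> conj_classes (ext_affine_weyl \<Phi> cor \<Omega>). f C \<noteq> 0}.
                    peval (f C) (v - vi) * T (rep C)) \<in> comm_span v vi"
proof -
  interpret hecke_reps \<Phi> cor z \<Omega> v vi T rep
    using assms by unfold_locales
  show ?thesis
    using expressible_T unfolding expressible_def cong_CS_def rep_sum_def by blast
qed

end
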